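(* Let $n\ge1$, $s\in(0,1)$, let $\Omega\subset\mathbb R^n$ be a bounded open set with Lipschitz boundary, and let $f\ge0$, $f\in L^{\frac n\sigma}(\Omega)$ for some $\sigma\in(0,s)$, be such that there exist $r_o>0$ and $x_o\in\Omega$ with $B_{r_o}(x_o)\subset\Omega$ and $\int_{B_{r_o}(x_o)}f\,dx>0$. (i) Let $h_s^f(\Omega)\ge1$ and let $u\in\mathcal W_0^{s,1}(\Omega)$. If for almost all $t\in(0,+\infty)$ the set $\{u\ge t\}$ is a minimizer of $\mathcal P_s$, then $u$ is a non-negative minimizer of $\mathcal F_1^s$. (ii) Suppose that there exists a weak solution of $(-\Delta)_1^su=f$ in $\Omega$, $u=0$ in $\mathbb R^n\setminus\Omega$. If $u\in\mathcal W_0^{s,1}(\Omega)$ is a non-negative minimizer of $\mathcal F_1^s$, then for every $t\in(0,+\infty)$ the set $\{u\ge t\}$ is a minimizer of $\mathcal P_s$.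
   Context: $\mathcal W^{s,1}_0(\Omega)$ is the closure of $C_c^\infty(\Omega)$ in the norm $\|u\|_{W^{s,1}(\Omega)}=\|u\|_{L^1(\Omega)}+\int_\Omega\int_\Omega\frac{|u(x)-u(y)|}{|x-y|^{n+s}}dxdy$, its elements being functions on $\mathbb R^n$ vanishing on $\mathbb R^n\setminus\Omega$ (for Lipschitz bounded $\Omega$ it equals the set of all $u:\mathbb R^n\to\mathbb R$ with $u=0$ on $\mathbb R^n\setminus\Omega$ and finite norm). $\mathcal F_1^s(u)=\frac12\iint_{\mathbb R^{2n}}\frac{|u(x)-u(y)|}{|x-y|^{n+s}}dxdy-\int_\Omega fu\,dx$; a minimizer of $\mathcal F_1^s$ is a $u\in\mathcal W_0^{s,1}(\Omega)$ with $\mathcal F_1^s(u)\le\mathcal F_1^s(v)$ for all $v\in\mathcal W_0^{s,1}(\Omega)$. $\operatorname{Per}_s(A)=\frac12\iint_{\mathbb R^{2n}}\frac{|\chi_A(x)-\chi_A(y)|}{|x-y|^{n+s}}dxdy$, where $\chi_A$ is the characteristic function of $A$; $|A|_f=\int_Af\,dx$; $\mathcal P_s(E)=\operatorname{Per}_s(E)-|E|_f$. A measurable set $E\subset\Omega$ is a minimizer of $\mathcal P_s$ if $\mathcal P_s(E)\le\mathcal P_s(F)$ for all measurable $F\subset\Omega$. The $(s,f)$-Cheeger constant is $h_s^f(\Omega)=\inf\left\{\frac{\operatorname{Per}_s(A)}{|A|_f}\,:\,A\subset\Omega \text{ measurable},\ |A|_f>0\right\}$. Weak solution: $u$ is a weak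 solution of $(-\Delta)_1^su=f$ in $\Omega$, $u=0$ in $\mathbb R^n\setminus\Omega$, if $u\in\mathcal W_0^{s,1}(\Omega)$ and there exists $\mathbf z\in L^\infty(\mathbb R^{2n})$ with $\|\mathbf z\|_{L^\infty(\mathbb R^{2n})}\le1$, $\mathbf z(x,y)=-\mathbf z(y,x)$, such that $\frac12\iint_{\mathbb R^{2n}}\frac{\mathbf z(x,y)}{|x-y|^{n+s}}(w(x)-w(y))dxdy=\int_\Omega fw\,dx$ for all $w\in\mathcal W_0^{s,1}(\Omega)$, and $\mathbf z(x,y)\in\operatorname{sgn}(u(x)-u(y))$ for a.e. $(x,y)\in\mathbb R^{2n}\setminus(\mathbb R^n\setminus\Omega)^2$. Here $\operatorname{sgn}(t)=\{1\}$ if $t>0$, $\{-1\}$ if $t<0$, $[-1,1]$ if $t=0$.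
   Formalization: In (i) the hypothesis that u is non-negative almost everywhere is added: as printed (i) fails for u = −φ with φ ≥ 0 a nonzero test function, since then every set {u ≥ t}, t > 0, is empty and the empty set minimizes P_s when the Cheeger constant is at least 1. *)

theory Defs
  imports "HOL-Analysis.Analysis"
begin

text \<open>
  The ambient space is an arbitrary Euclidean space \<^typ>\<open>'a::euclidean_space\<close> of dimension
  \<open>n = DIM('a) \<ge> 1\<close>. Measurability and ``almost everywhere'' always refer to Lebesgue measure.
\<close>

text \<open>
  Every boundary point has a neighbourhood in which, after a rotation taking the last coordinate
  axis to the direction \<open>e\<close>, the domain is the strict epigraph of a Lipschitz function \<open>g\<close> of
  the remaining coordinates (the hyperplane orthogonal to \<open>e\<close>).
\<close>
definition lipschitz_boundary :: "'a::euclidean_space set \<Rightarrow> bool" where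
  "lipschitz_boundary \<Omega> \<longleftrightarrow>
     (\<forall>p\<in>frontier \<Omega>. \<exists>r>0. \<exists>e g L. norm e = 1 \<and> L-lipschitz_on {y. y \<bullet> e = 0} g \<and>
        \<Omega> \<inter> ball p r = {x \<in> ball p r. g (x - (x \<bullet> e) *\<^sub>R e) < x \<bullet> e})"

fun C_k :: "nat \<Rightarrow> ('a::euclidean_space \<Rightarrow> real) \<Rightarrow> bool" where
  "C_k 0 \<phi> \<longleftrightarrow> continuous_on UNIV \<phi>"
| "C_k (Suc k) \<phi> \<longleftrightarrow>
     \<phi> differentiable_on UNIV \<and> (\<forall>v. C_k k (\<lambda>x. frechet_derivative \<phi> (at x) v))"

definition Cc_infinity :: "'a::euclidean_space set \<Rightarrow> ('a \<Rightarrow> real) set" where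
  "Cc_infinity \<Omega> =
     {\<phi>. (\<forall>k. C_k k \<phi>) \<and> compact (closure {x. \<phi> x \<noteq> 0}) \<and> closure {x. \<phi> x \<noteq> 0} \<subseteq> \<Omega>}"

definition gagliardo :: "real \<Rightarrow> 'a::euclidean_space set \<Rightarrow> ('a \<Rightarrow> real) \<Rightarrow> ennreal" where
  "gagliardo s D u =
     (\<integral>\<^sup>+ p \<in> D \<times> D. ennreal (\<bar>u (fst p) - u (snd p)\<bar> /
        norm (fst p - snd p) powr (real DIM('a) + s)) \<partial>lebesgue)"

definition Ws1_norm :: "real \<Rightarrow> 'a::euclidean_space set \<Rightarrow> ('a \<Rightarrow> real) \<Rightarrow> ennreal" where
  "Ws1_norm s \<Omega> u = (\<integral>\<^sup>+ x \<in> \<Omega>. ennreal \<bar>u x\<bar> \<partial>lebesgue) + gagliardo s \<Omega> u"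

text \<open>
  Elements are honest functions that vanish everywhere off \<open>\<Omega>\<close>. Finiteness of
  \<open>Ws1_norm s \<Omega> u\<close> need not be required: it follows from approximability by test functions.
\<close>
definition W0s1 :: "real \<Rightarrow> 'a::euclidean_space set \<Rightarrow> ('a \<Rightarrow> real) set" where
  "W0s1 s \<Omega> =
     {u \<in> borel_measurable lebesgue. (\<forall>x. x \<notin> \<Omega> \<longrightarrow> u x = 0) \<and>
        (\<forall>\<epsilon>>0. \<exists>\<phi>\<in>Cc_infinity \<Omega>. Ws1_norm s \<Omega> (\<lambda>x. u x - \<phi> x) < ennreal \<epsilon>)}"

definition F_energy ::
    "real \<Rightarrow> 'a::euclidean_space set \<Rightarrow> ('a \<Rightarrow> real) \<Rightarrow> ('a \<Rightarrow> real) \<Rightarrow> ereal" where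
  "F_energy s \<Omega> f u =
     enn2ereal (gagliardo s UNIV u / 2) - ereal (LINT x:\<Omega>|lebesgue. f x * u x)"

definition F_minimizer ::
    "real \<Rightarrow> 'a::euclidean_space set \<Rightarrow> ('a \<Rightarrow> real) \<Rightarrow> ('a \<Rightarrow> real) \<Rightarrow> bool" where
  "F_minimizer s \<Omega> f u \<longleftrightarrow>
     u \<in> W0s1 s \<Omega> \<and> (\<forall>v\<in>W0s1 s \<Omega>. F_energy s \<Omega> f u \<le> F_energy s \<Omega> f v)"

definition Per :: "real \<Rightarrow> 'a::euclidean_space set \<Rightarrow> ennreal" where
  "Per s A = gagliardo s UNIV (indicator A) / 2"

definition weighted_vol :: "('a::euclidean_space \<Rightarrow> real) \<Rightarrow> 'a set \<Rightarrow> real" where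
  "weighted_vol f A = (LINT x:A|lebesgue. f x)"

definition P_energy :: "real \<Rightarrow> ('a::euclidean_space \<Rightarrow> real) \<Rightarrow> 'a set \<Rightarrow> ereal" where
  "P_energy s f E = enn2ereal (Per s E) - ereal (weighted_vol f E)"

definition P_minimizer ::
    "real \<Rightarrow> 'a::euclidean_space set \<Rightarrow> ('a \<Rightarrow> real) \<Rightarrow> 'a set \<Rightarrow> bool" where
  "P_minimizer s \<Omega> f E \<longleftrightarrow> E \<in> sets lebesgue \<and> E \<subseteq> \<Omega> \<and>
     (\<forall>F. F \<in> sets lebesgue \<and> F \<subseteq> \<Omega> \<longrightarrow> P_energy s f E \<le> P_energy s f F)"

definition cheeger :: "real \<Rightarrow> ('a::euclidean_space \<Rightarrow> real) \<Rightarrow> 'a set \<Rightarrow> ennreal" where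
  "cheeger s f \<Omega> =
     (INF A \<in> {A. A \<in> sets lebesgue \<and> A \<subseteq> \<Omega> \<and> 0 < weighted_vol f A}.
        Per s A / ennreal (weighted_vol f A))"

definition sgn_graph :: "real \<Rightarrow> real set" where
  "sgn_graph t = (if 0 < t then {1} else if t < 0 then {-1} else {-1..1})"

text \<open>
  The function \<open>z\<close> represents a class in \<open>L\<^sup>\<infinity>\<close>, so the bound and the antisymmetry are
  imposed almost everywhere.
\<close>
definition weak_solution ::
    "real \<Rightarrow> 'a::euclidean_space set \<Rightarrow> ('a \<Rightarrow> real) \<Rightarrow> ('a \<Rightarrow> real) \<Rightarrow> bool" where
  "weak_solution s \<Omega> f u \<longleftrightarrow> u \<in> W0s1 s \<Omega> \<and>
     (\<exists>z \<in> borel_measurable (lebesgue :: ('a \<times> 'a) measure).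
        (AE p in lebesgue. \<bar>z p\<bar> \<le> 1) \<and>
        (AE p in lebesgue. z p = - z (snd p, fst p)) \<and>
        (\<forall>w\<in>W0s1 s \<Omega>.
           (LINT p|lebesgue. z p / norm (fst p - snd p) powr (real DIM('a) + s) *
              (w (fst p) - w (snd p))) / 2
           = (LINT x:\<Omega>|lebesgue. f x * w x)) \<and>
        (AE p in lebesgue. p \<notin> (- \<Omega>) \<times> (- \<Omega>) \<longrightarrow> z p \<in> sgn_graph (u (fst p) - u (snd p))))"

end

theory Submission
  imports Defs
begin

text \<open>
  Write \<open>E\<^sub>t = {x. t \<le> u x}\<close>. Both halves of the energy split over level sets: for \<open>u \<ge> 0\<close> the coarea
  formula (\<open>coarea_Per\<close>) gives half the Gagliardo energy of \<open>u\<close> as the integral of \<open>Per s E\<^sub>t\<close> over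
  \<open>t > 0\<close>, and the layer-cake formula (\<open>pairing_layer_cake\<close>) gives \<open>\<integral> f u\<close> as the integral of
  \<open>weighted_vol f E\<^sub>t\<close>. So \<open>F_energy\<close> of \<open>u\<close> is the integral over \<open>t\<close> of \<open>P_energy\<close> of \<open>E\<^sub>t\<close>, as soon
  as the latter is finite. In both parts the minimal value of both functionals is \<open>0\<close>,
  which turns ``minimizer'' into ``nonpositive energy''.

  Part (i). The Cheeger condition says \<open>weighted_vol f A \<le> Per s A\<close> for all \<open>A\<close>, hence \<open>F_energy \<ge> 0\<close>
  everywhere (\<open>F_energy_nonneg\<close>). Comparison of \<open>E\<^sub>t\<close> with the empty set gives
  \<open>Per s E\<^sub>t \<le> weighted_vol f E\<^sub>t\<close> for almost all \<open>t\<close>, and integration gives \<open>F_energy \<le> 0\<close> for \<open>u\<close>,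
  provided that \<open>f u\<close> is integrable. Integrability comes from a gap in the masses of the levels: the
  isoperimetric inequality \<open>Per s E \<ge> c \<bar>E\<bar> powr (1 - s/n)\<close> and the Hoelder bound
  \<open>weighted_vol f E \<le> C \<bar>E\<bar> powr (1 - \<sigma>/n)\<close> with \<open>\<sigma> < s\<close> show that each \<open>E\<^sub>t\<close> is either null or has
  measure above a fixed positive constant; since \<open>u\<close> is in \<open>L\<^sup>1\<close>, the second case stops at some
  height, so \<open>u\<close> is bounded.

  Part (ii). The weak formulation, with \<open>\<bar>z\<bar> \<le> 1\<close>, bounds \<open>\<integral> f w\<close> by half the energy of \<open>w\<close> for every
  \<open>w\<close> in the space, and comparison with the zero function gives \<open>F_energy \<le> 0\<close> for a minimizer. The main step is to transfer the bound from
  test functions to indicators, that is, to prove \<open>weighted_vol f A \<le> Per s A\<close> for every measurable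
  \<open>A \<subseteq> \<Omega>\<close> (\<open>test_inequality_imp_vol_le_Per\<close>). For this the indicator of \<open>A\<close> is cut off near the
  boundary and mollified. Mollification does not increase the energy. The cutoff costs little because
  of a Hardy inequality: outside a Lipschitz domain there are balls of size comparable to the distance
  \<open>d\<close> to the boundary (exterior corkscrews), so \<open>Per s A\<close> controls the integral of \<open>d powr (- s)\<close>
  over \<open>A\<close>, and this is exactly the integrable majorant of the cutoff error. Afterwards the integral of
  \<open>Per s E\<^sub>t - weighted_vol f E\<^sub>t\<close>, a nonnegative function of \<open>t\<close>, is nonpositive, so it vanishes for
  almost every \<open>t\<close>. Lower semicontinuity of the perimeter along \<open>t\<^sub>k \<up> t\<close> extends this to every \<open>t > 0\<close>.
\<close>

section \<open>The Gagliardo energy and almost-everywhere classes\<close>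

definition kern :: "real \<Rightarrow> 'a::euclidean_space \<Rightarrow> real" where
  "kern s z = 1 / norm z powr (real DIM('a) + s)"

lemma kern_nonneg [simp]: "0 \<le> kern s z"
  by (simp add: kern_def)

lemma kern_measurable [measurable]: "kern s \<in> borel_measurable borel"
  unfolding kern_def[abs_def] by measurable

lemma fst_snd_borel [measurable]:
  "(fst :: 'a::euclidean_space \<times> 'b::euclidean_space \<Rightarrow> 'a) \<in> borel \<rightarrow>\<^sub>M borel"
  "(snd :: 'a \<times> 'b \<Rightarrow> 'b) \<in> borel \<rightarrow>\<^sub>M borel"
  unfolding borel_prod[symmetric] by measurable

text \<open>
  Null sets of the factor give null sets of the product. With this, energies may be computed with
  Borel representatives, for which joint measurability and Tonelli are available.
\<close>

lemma AE_lborel_pairI: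
  fixes P :: "'a::euclidean_space \<Rightarrow> bool"
  assumes "AE x in lborel. P x"
  shows "AE p in (lborel :: ('a \<times> 'a) measure). P (fst p) \<and> P (snd p)"
proof -
  obtain N where N: "{x. \<not> P x} \<subseteq> N" "emeasure lborel N = 0" "N \<in> sets lborel"
    using AE_E[OF assms] by auto
  have ae: "AE x in lborel. x \<notin> N"
    using N by (auto intro!: AE_not_in simp: null_sets_def)
  have [measurable]: "N \<in> sets borel"
    using N(3) by simp
  have "AE p in lborel \<Otimes>\<^sub>M lborel. fst p \<notin> N \<and> snd p \<notin> N"
  proof (rule lborel_pair.AE_pair_measure)
    show "{p \<in> space (lborel \<Otimes>\<^sub>M lborel). fst p \<notin> N \<and> snd p \<notin> N} \<in> sets (lborel \<Otimes>\<^sub>M lborel)"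
      by measurable
    show "AE x in lborel. AE y in lborel. fst (x, y) \<notin> N \<and> snd (x, y) \<notin> N"
      using ae by auto
  qed
  then show ?thesis
    unfolding lborel_prod by eventually_elim (use N(1) in blast)
qed

lemma gagliardo_UNIV:
  "gagliardo s UNIV u =
     (\<integral>\<^sup>+ p. ennreal (\<bar>u (fst p) - u (snd p)\<bar> * kern s (fst p - snd p)) \<partial>lborel)"
  by (simp add: gagliardo_def kern_def nn_integral_completion)

lemma gagliardo_cong_AE:
  assumes "AE x in lborel. u x = v x"
  shows "gagliardo s UNIV u = gagliardo s UNIV v"
  unfolding gagliardo_UNIV
  by (rule nn_integral_cong_AE) (use AE_lborel_pairI[OF assms] in eventually_elim, simp)

lemma gagliardo_mono_AE:
  assumes "AE p in lborel. \<bar>u (fst p) - u (snd p)\<bar> \<le> \<bar>v (fst p) - v (snd p)\<bar>"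
  shows "gagliardo s UNIV u \<le> gagliardo s UNIV v"
  unfolding gagliardo_UNIV
  by (rule nn_integral_mono_AE)
    (use assms in \<open>eventually_elim, auto intro!: ennreal_leI mult_right_mono\<close>)

lemma borel_representative:
  fixes u :: "'a::euclidean_space \<Rightarrow> real"
  assumes "u \<in> borel_measurable lebesgue"
  obtains u' where "u' \<in> borel_measurable borel" "AE x in lborel. u x = u' x"
  using completion_ex_borel_measurable_real[OF assms] by auto

lemma gagliardo_iterated:
  assumes [measurable]: "u \<in> borel_measurable borel"
  shows "gagliardo s UNIV u = (\<integral>\<^sup>+ x. \<integral>\<^sup>+ y. ennreal (\<bar>u x - u y\<bar> * kern s (x - y)) \<partial>lborel \<partial>lborel)"
  unfolding gagliardo_UNIV lborel_prod[symmetric]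
  by (subst lborel.nn_integral_fst[symmetric]) (auto simp: split_beta)

section \<open>Coarea and layer-cake formulas\<close>

lemma nn_integral_level_indicator:
  fixes a b :: real
  assumes "0 \<le> a" "0 \<le> b"
  shows "(\<integral>\<^sup>+ t. ennreal \<bar>indicator {x. t \<le> x} a - indicator {x. t \<le> x} b\<bar> * indicator {0<..} t \<partial>lborel)
     = ennreal \<bar>a - b\<bar>"
proof -
  have "(\<integral>\<^sup>+ t. ennreal \<bar>indicator {x. t \<le> x} a - indicator {x. t \<le> x} b\<bar> * indicator {0<..} t \<partial>lborel)
      = (\<integral>\<^sup>+ t. indicator {min a b <.. max a b} t \<partial>lborel)"
    using assms by (intro nn_integral_cong) (auto simp: indicator_def)
  also have "\<dots> = ennreal \<bar>a - b\<bar>"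
    by (simp add: abs_real_def max_def min_def)
  finally show ?thesis .
qed

lemma level_sets_AE:
  fixes u v :: "'a \<Rightarrow> real"
  assumes "AE x in M. u x = v x"
  shows "AE x in M. (indicator {x. t \<le> u x} x :: real) = indicator {x. t \<le> v x} x"
  using assms by eventually_elim (simp add: indicator_def)

text \<open>
  The difference \<open>\<bar>u x - u y\<bar>\<close> is the measure of the set of heights \<open>t\<close> that separate \<open>u x\<close> from
  \<open>u y\<close>; Tonelli then moves the integral over \<open>t\<close> to the outside.
\<close>

lemma coarea_borel:
  fixes u :: "'a::euclidean_space \<Rightarrow> real"
  assumes [measurable]: "u \<in> borel_measurable borel" and "\<And>x. 0 \<le> u x"
  shows "gagliardo s UNIV u =
    (\<integral>\<^sup>+ t. gagliardo s UNIV (indicator {x. t \<le> u x}) * indicator {0<..} t \<partial>lborel)" (is ?eq)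
    and "(\<lambda>t. gagliardo s UNIV (indicator {x. t \<le> u x})) \<in> borel_measurable borel" (is ?meas)
proof -
  let ?d = "\<lambda>t (p::'a \<times> 'a). ennreal \<bar>indicator {x. t \<le> u x} (fst p) - indicator {x. t \<le> u x} (snd p)\<bar>"
  let ?k = "\<lambda>p::'a \<times> 'a. ennreal (kern s (fst p - snd p))"
  have sets: "{q::('a \<times> 'a) \<times> real. snd q \<le> u (fst (fst q))} \<in> sets borel"
    "{q::('a \<times> 'a) \<times> real. snd q \<le> u (snd (fst q))} \<in> sets borel"
    by measurable
  have [measurable]: "(\<lambda>p::('a \<times> 'a) \<times> real. indicator {x. snd p \<le> u x} (fst (fst p)) :: real) \<in> borel_measurable borel"
    "(\<lambda>p::('a \<times> 'a) \<times> real. indicator {x. snd p \<le> u x} (snd (fst p)) :: real) \<in> borel_measurable borel"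
    using sets[THEN borel_measurable_indicator] by (simp_all add: indicator_def[abs_def])
  have "gagliardo s UNIV u = (\<integral>\<^sup>+ p. \<integral>\<^sup>+ t. ?d t p * indicator {0<..} t * ?k p \<partial>lborel \<partial>lborel)"
    unfolding gagliardo_UNIV
  proof (intro nn_integral_cong)
    fix p :: "'a \<times> 'a"
    have "(\<integral>\<^sup>+ t. ?d t p * indicator {0<..} t * ?k p \<partial>lborel)
       = (\<integral>\<^sup>+ t. ?d t p * indicator {0<..} t \<partial>lborel) * ?k p"
      by (rule nn_integral_multc) (simp add: indicator_def)
    also have "(\<integral>\<^sup>+ t. ?d t p * indicator {0<..} t \<partial>lborel) = ennreal \<bar>u (fst p) - u (snd p)\<bar>"
      using nn_integral_level_indicator[of "u (fst p)" "u (snd p)"] assms(2)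
      by (simp add: indicator_def)
    finally show "ennreal (\<bar>u (fst p) - u (snd p)\<bar> * kern s (fst p - snd p))
      = (\<integral>\<^sup>+ t. ?d t p * indicator {0<..} t * ?k p \<partial>lborel)"
      by (simp add: ennreal_mult)
  qed
  also have "\<dots> = (\<integral>\<^sup>+ t. \<integral>\<^sup>+ p. ?d t p * indicator {0<..} t * ?k p \<partial>lborel \<partial>lborel)"
    by (rule lborel_pair.Fubini'[symmetric]) (simp add: split_beta lborel_prod)
  also have "\<dots> = (\<integral>\<^sup>+ t. gagliardo s UNIV (indicator {x. t \<le> u x}) * indicator {0<..} t \<partial>lborel)"
    unfolding gagliardo_UNIV
    by (intro nn_integral_cong) (auto simp: ennreal_mult indicator_def[of "{0<..}"])
  finally show ?eq .
  have "(\<lambda>t. \<integral>\<^sup>+ p. ?d t p * ?k p \<partial>lborel) \<in> borel_measurable lborel"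
    by (rule lborel.borel_measurable_nn_integral) (simp add: split_beta lborel_prod)
  then show ?meas
    unfolding gagliardo_UNIV by (simp add: ennreal_mult)
qed

lemma coarea:
  fixes u :: "'a::euclidean_space \<Rightarrow> real"
  assumes "u \<in> borel_measurable lebesgue" and nn: "AE x in lborel. 0 \<le> u x"
  shows "gagliardo s UNIV u =
    (\<integral>\<^sup>+ t. gagliardo s UNIV (indicator {x. t \<le> u x}) * indicator {0<..} t \<partial>lborel)" (is ?eq)
    and "(\<lambda>t. gagliardo s UNIV (indicator {x. t \<le> u x})) \<in> borel_measurable borel" (is ?meas)
proof -
  obtain u' where [measurable]: "u' \<in> borel_measurable borel" and u': "AE x in lborel. u x = u' x"
    using borel_representative[OF assms(1)] .
  define w where "w x = max 0 (u' x)" for x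
  have uw: "AE x in lborel. u x = w x"
    using u' nn by eventually_elim (simp add: w_def)
  have levels: "gagliardo s UNIV (indicator {x. t \<le> w x}) = gagliardo s UNIV (indicator {x. t \<le> u x})" for t
    by (intro gagliardo_cong_AE level_sets_AE AE_symmetric[OF uw])
  have w: "w \<in> borel_measurable borel" "\<And>x. 0 \<le> w x"
    by (simp_all add: w_def[abs_def])
  have "gagliardo s UNIV u = gagliardo s UNIV w"
    by (rule gagliardo_cong_AE[OF uw])
  also have "\<dots> = (\<integral>\<^sup>+ t. gagliardo s UNIV (indicator {x. t \<le> w x}) * indicator {0<..} t \<partial>lborel)"
    by (rule coarea_borel(1)[OF w])
  also have "\<dots> = (\<integral>\<^sup>+ t. gagliardo s UNIV (indicator {x. t \<le> u x}) * indicator {0<..} t \<partial>lborel)"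
    by (simp only: levels)
  finally show ?eq .
  show ?meas
    using coarea_borel(2)[OF w, of s] by (simp only: levels)
qed

lemma layer_cake_borel:
  fixes u :: "'a::euclidean_space \<Rightarrow> real"
  assumes [measurable]: "u \<in> borel_measurable borel" "g \<in> borel_measurable borel" and "\<And>x. 0 \<le> u x"
  shows "(\<integral>\<^sup>+ x. g x * ennreal (u x) \<partial>lborel) =
    (\<integral>\<^sup>+ t. (\<integral>\<^sup>+ x. g x * indicator {x. t \<le> u x} x \<partial>lborel) * indicator {0<..} t \<partial>lborel)" (is ?eq)
    and "(\<lambda>t. \<integral>\<^sup>+ x. g x * indicator {x. t \<le> u x} x \<partial>lborel) \<in> borel_measurable borel" (is ?meas)
proof -
  have "{q::'a \<times> real. snd q \<le> u (fst q)} \<in> sets borel"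
    by measurable
  then have ind[measurable]: "(\<lambda>p::'a \<times> real. indicator {x. snd p \<le> u x} (fst p) :: ennreal) \<in> borel_measurable borel"
    using borel_measurable_indicator[of "{q::'a \<times> real. snd q \<le> u (fst q)}" borel] by (simp add: indicator_def[abs_def])
  have "(\<integral>\<^sup>+ x. g x * ennreal (u x) \<partial>lborel)
      = (\<integral>\<^sup>+ x. \<integral>\<^sup>+ t. g x * (indicator {x. t \<le> u x} x * indicator {0<..} t) \<partial>lborel \<partial>lborel)"
  proof (intro nn_integral_cong)
    fix x
    have "(\<integral>\<^sup>+ t. indicator {x. t \<le> u x} x * indicator {0<..} t \<partial>lborel) = (\<integral>\<^sup>+ t. indicator {0<..u x} t \<partial>lborel)"
      by (intro nn_integral_cong) (auto simp: indicator_def)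
    also have "\<dots> = ennreal (u x)"
      using assms(3)[of x] by simp
    finally show "g x * ennreal (u x) = (\<integral>\<^sup>+ t. g x * (indicator {x. t \<le> u x} x * indicator {0<..} t) \<partial>lborel)"
      by (subst nn_integral_cmult) (auto simp: indicator_def)
  qed
  also have "\<dots> = (\<integral>\<^sup>+ t. \<integral>\<^sup>+ x. g x * (indicator {x. t \<le> u x} x * indicator {0<..} t) \<partial>lborel \<partial>lborel)"
    by (rule lborel_pair.Fubini'[symmetric]) (simp add: split_beta lborel_prod)
  also have "\<dots> = (\<integral>\<^sup>+ t. (\<integral>\<^sup>+ x. g x * indicator {x. t \<le> u x} x \<partial>lborel) * indicator {0<..} t \<partial>lborel)"
    by (intro nn_integral_cong) (auto simp: indicator_def[of "{0<..}"])
  finally show ?eq .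
  have "(\<lambda>t. \<integral>\<^sup>+ x. g x * indicator {x. t \<le> u x} x \<partial>lborel) \<in> borel_measurable lborel"
    by (rule lborel.borel_measurable_nn_integral) (simp add: split_beta lborel_prod)
  then show ?meas
    by simp
qed

lemma layer_cake:
  fixes u :: "'a::euclidean_space \<Rightarrow> real"
  assumes "u \<in> borel_measurable lebesgue" "g \<in> borel_measurable borel" and nn: "AE x in lborel. 0 \<le> u x"
  shows "(\<integral>\<^sup>+ x. g x * ennreal (u x) \<partial>lborel) =
    (\<integral>\<^sup>+ t. (\<integral>\<^sup>+ x. g x * indicator {x. t \<le> u x} x \<partial>lborel) * indicator {0<..} t \<partial>lborel)" (is ?eq)
    and "(\<lambda>t. \<integral>\<^sup>+ x. g x * indicator {x. t \<le> u x} x \<partial>lborel) \<in> borel_measurable borel" (is ?meas)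
proof -
  obtain u' where [measurable]: "u' \<in> borel_measurable borel" and u': "AE x in lborel. u x = u' x"
    using borel_representative[OF assms(1)] .
  define w where "w x = max 0 (u' x)" for x
  have uw: "AE x in lborel. u x = w x"
    using u' nn by eventually_elim (simp add: w_def)
  have w: "w \<in> borel_measurable borel"
    by (simp add: w_def[abs_def])
  have eq: "(\<integral>\<^sup>+ x. g x * indicator {x. t \<le> w x} x \<partial>lborel) = (\<integral>\<^sup>+ x. g x * indicator {x. t \<le> u x} x \<partial>lborel)" for t
    by (rule nn_integral_cong_AE) (use uw in eventually_elim, simp add: indicator_def)
  have "(\<integral>\<^sup>+ x. g x * ennreal (u x) \<partial>lborel) = (\<integral>\<^sup>+ x. g x * ennreal (w x) \<partial>lborel)"
    by (rule nn_integral_cong_AE) (use uw in eventually_elim, simp)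
  also have "\<dots> = (\<integral>\<^sup>+ t. (\<integral>\<^sup>+ x. g x * indicator {x. t \<le> w x} x \<partial>lborel) * indicator {0<..} t \<partial>lborel)"
    by (rule layer_cake_borel(1)[OF w assms(2)]) (simp add: w_def)
  also have "\<dots> = (\<integral>\<^sup>+ t. (\<integral>\<^sup>+ x. g x * indicator {x. t \<le> u x} x \<partial>lborel) * indicator {0<..} t \<partial>lborel)"
    by (simp only: eq)
  finally show ?eq .
  show ?meas
    using layer_cake_borel(2)[OF w assms(2)] by (simp only: eq) (simp add: w_def)
qed

text \<open>
  Lower semicontinuity of the energy under pointwise convergence, by Fatou.
\<close>

lemma gagliardo_liminf:
  fixes v :: "nat \<Rightarrow> 'a::euclidean_space \<Rightarrow> real"
  assumes [measurable]: "\<And>k. v k \<in> borel_measurable borel"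
    and "AE x in lborel. (\<lambda>k. v k x) \<longlonglongrightarrow> u x"
  shows "gagliardo s UNIV u \<le> liminf (\<lambda>k. gagliardo s UNIV (v k))"
proof -
  have "gagliardo s UNIV u = (\<integral>\<^sup>+ p. liminf (\<lambda>k. ennreal (\<bar>v k (fst p) - v k (snd p)\<bar> * kern s (fst p - snd p))) \<partial>lborel)"
    unfolding gagliardo_UNIV
  proof (rule nn_integral_cong_AE, use AE_lborel_pairI[OF assms(2)] in eventually_elim)
    case (elim p)
    then have "(\<lambda>k. ennreal (\<bar>v k (fst p) - v k (snd p)\<bar> * kern s (fst p - snd p)))
        \<longlonglongrightarrow> ennreal (\<bar>u (fst p) - u (snd p)\<bar> * kern s (fst p - snd p))"
      by (intro tendsto_ennrealI tendsto_mult tendsto_rabs tendsto_diff tendsto_const) auto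
    then show ?case
      by (rule lim_imp_Liminf[OF trivial_limit_sequentially, symmetric])
  qed
  also have "\<dots> \<le> liminf (\<lambda>k. gagliardo s UNIV (v k))"
    unfolding gagliardo_UNIV by (rule nn_integral_liminf) measurable
  finally show ?thesis .
qed

section \<open>The functionals in terms of a Borel weight\<close>

lemma energy_nonpos_iff:
  assumes "0 \<le> I"
  shows "enn2ereal X - ereal I \<le> 0 \<longleftrightarrow> X \<le> ennreal I"
  using assms by (cases X) (auto simp: enn2ereal_ennreal ennreal_le_iff top_ereal_def top_unique)

lemma energy_nonpos_imp:
  assumes "enn2ereal X - ereal I \<le> 0"
  shows "X \<le> ennreal I"
  using assms by (cases X) (auto simp: enn2ereal_ennreal ennreal_leI)

lemma energy_nonneg_iff:
  "0 \<le> enn2ereal X - ereal I \<longleftrightarrow> ennreal I \<le> X"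
  by (cases X) (auto simp: enn2ereal_ennreal ennreal_le_iff2 top_ereal_def)

text \<open>
  The weight \<open>f\<close> is only Lebesgue measurable and only controlled on \<open>\<Omega>\<close>. All pairings with it are
  expressed through a nonnegative integrable Borel function \<open>g\<close> that agrees with \<open>f\<close> on \<open>\<Omega>\<close> and
  vanishes off \<open>\<Omega>\<close>, so that they become integrals of nonnegative functions over the whole space.
\<close>

locale weight_representative =
  fixes \<Omega> :: "'a::euclidean_space set" and f g :: "'a \<Rightarrow> real"
  assumes open_domain: "open \<Omega>"
    and f_measurable: "set_borel_measurable lebesgue \<Omega> f"
    and weight_measurable [measurable]: "g \<in> borel_measurable borel"
    and weight_nonneg: "\<And>x. 0 \<le> g x"
    and weight_AE: "AE x in lborel. g x = indicator \<Omega> x * f x"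
    and weight_integrable: "integrable lborel g"
begin

lemma domain_sets [measurable]: "\<Omega> \<in> sets borel"
  using open_domain by simp

text \<open>
  When \<open>f u\<close> is not integrable, the left-hand side is \<open>0\<close> by convention, so the bound holds for every
  \<open>u\<close>.
\<close>

lemma pairing_le:
  "ennreal (LINT x:\<Omega>|lebesgue. f x * u x) \<le> (\<integral>\<^sup>+ x. ennreal (g x) * ennreal \<bar>u x\<bar> \<partial>lborel)"
proof (cases "set_integrable lebesgue \<Omega> (\<lambda>x. f x * u x)")
  case True
  have "ennreal (LINT x:\<Omega>|lebesgue. f x * u x) \<le> ennreal (norm (LINT x:\<Omega>|lebesgue. f x * u x))"
    by (intro ennreal_leI) simp
  also have "\<dots> \<le> (\<integral>\<^sup>+ x. ennreal (norm (indicator \<Omega> x *\<^sub>R (f x * u x))) \<partial>lebesgue)"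
    using True unfolding set_lebesgue_integral_def set_integrable_def
    by (rule integral_norm_bound_ennreal)
  also have "\<dots> = (\<integral>\<^sup>+ x. ennreal (g x) * ennreal \<bar>u x\<bar> \<partial>lborel)"
    unfolding nn_integral_completion
  proof (rule nn_integral_cong_AE, use weight_AE in eventually_elim)
    case (elim x)
    then have "norm (indicator \<Omega> x *\<^sub>R (f x * u x)) = \<bar>g x\<bar> * \<bar>u x\<bar>"
      by (simp add: abs_mult)
    then show ?case
      using weight_nonneg[of x] by (simp add: ennreal_mult)
  qed
  finally show ?thesis .
next
  case False
  then show ?thesis
    by (simp add: set_lebesgue_integral_def set_integrable_def not_integrable_integral_eq)
qed

lemma pairing_eq:
  assumes u: "u \<in> borel_measurable lebesgue" "AE x in lborel. 0 \<le> u x"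
    and fin: "(\<integral>\<^sup>+ x. ennreal (g x) * ennreal (u x) \<partial>lborel) < \<infinity>"
  shows "ennreal (LINT x:\<Omega>|lebesgue. f x * u x) = (\<integral>\<^sup>+ x. ennreal (g x) * ennreal (u x) \<partial>lborel)" (is ?eq)
    and "0 \<le> (LINT x:\<Omega>|lebesgue. f x * u x)" (is ?nn)
proof -
  let ?h = "\<lambda>x. indicator \<Omega> x *\<^sub>R (f x * u x)"
  have "(\<lambda>x. indicator \<Omega> x *\<^sub>R f x * u x) \<in> borel_measurable lebesgue"
    using f_measurable u(1) unfolding set_borel_measurable_def by (rule borel_measurable_times)
  then have meas: "?h \<in> borel_measurable lebesgue"
    by (simp add: mult.assoc)
  have ae: "AE x in lborel. ?h x = g x * u x"
    using weight_AE by eventually_elim simp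
  have nn: "AE x in lebesgue. 0 \<le> ?h x"
    unfolding AE_completion_iff using ae u(2) by eventually_elim (metis mult_nonneg_nonneg weight_nonneg)
  have eq: "(\<integral>\<^sup>+ x. ennreal (?h x) \<partial>lebesgue) = (\<integral>\<^sup>+ x. ennreal (g x) * ennreal (u x) \<partial>lborel)"
    unfolding nn_integral_completion
    by (rule nn_integral_cong_AE)
      (use ae u(2) in eventually_elim, metis ennreal_mult weight_nonneg)
  have int: "integrable lebesgue ?h"
    by (rule integrableI_nonneg[OF meas nn]) (use fin in \<open>simp only: eq\<close>)
  show ?eq
    unfolding set_lebesgue_integral_def eq[symmetric] by (rule nn_integral_eq_integral[OF int nn, symmetric])
  show ?nn
    unfolding set_lebesgue_integral_def by (rule integral_nonneg_AE[OF nn])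
qed

lemma weight_nn_integral_finite: "(\<integral>\<^sup>+ x. ennreal (g x) \<partial>lborel) < \<infinity>"
  using integrableD(2)[OF weight_integrable] weight_nonneg by (simp add: less_top)

lemma weighted_vol_eq:
  assumes "A \<in> sets lebesgue"  "A \<subseteq> \<Omega>"
  shows "ennreal (weighted_vol f A) = (\<integral>\<^sup>+ x. ennreal (g x) * indicator A x \<partial>lborel)"
    and "0 \<le> weighted_vol f A"
proof -
  have "(\<integral>\<^sup>+ x. ennreal (g x) * ennreal (indicator A x) \<partial>lborel) \<le> (\<integral>\<^sup>+ x. ennreal (g x) \<partial>lborel)"
    by (intro nn_integral_mono) (simp add: indicator_def)
  then have fin: "(\<integral>\<^sup>+ x. ennreal (g x) * ennreal (indicator A x) \<partial>lborel) < \<infinity>"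
    using weight_nn_integral_finite by (rule le_less_trans)
  have eq: "weighted_vol f A = (LINT x:\<Omega>|lebesgue. f x * indicator A x)"
    unfolding weighted_vol_def set_lebesgue_integral_def
    by (rule Bochner_Integration.integral_cong) (use assms(2) in \<open>auto simp: indicator_def\<close>)
  show "ennreal (weighted_vol f A) = (\<integral>\<^sup>+ x. ennreal (g x) * indicator A x \<partial>lborel)"
    using pairing_eq(1)[of "indicator A", OF _ _ fin] assms(1) by (simp add: eq ennreal_indicator)
  show "0 \<le> weighted_vol f A"
    using pairing_eq(2)[of "indicator A", OF _ _ fin] assms(1) by (simp add: eq)
qed

lemma level_set_in_domain:
  assumes "u \<in> borel_measurable lebesgue" "\<And>x. x \<notin> \<Omega> \<Longrightarrow> u x = (0::real)" "0 < t"
  shows "{x. t \<le> u x} \<in> sets lebesgue" "{x. t \<le> u x} \<subseteq> \<Omega>"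
proof -
  show "{x. t \<le> u x} \<in> sets lebesgue"
    using measurable_sets[OF assms(1), of "{t..}"] by (simp add: vimage_def)
  show "{x. t \<le> u x} \<subseteq> \<Omega>"
    using assms(2,3) by force
qed

lemma pairing_layer_cake:
  assumes "u \<in> borel_measurable lebesgue" "\<And>x. x \<notin> \<Omega> \<Longrightarrow> u x = 0" "AE x in lborel. 0 \<le> u x"
  shows "(\<integral>\<^sup>+ x. ennreal (g x) * ennreal (u x) \<partial>lborel) =
    (\<integral>\<^sup>+ t. ennreal (weighted_vol f {x. t \<le> u x}) * indicator {0<..} t \<partial>lborel)" (is ?eq)
    and "(\<lambda>t. ennreal (weighted_vol f {x. t \<le> u x}) * indicator {0<..} t) \<in> borel_measurable borel" (is ?meas)
proof -
  have levels: "(\<integral>\<^sup>+ x. ennreal (g x) * indicator {x. t \<le> u x} x \<partial>lborel) * indicator {0<..} t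
       = ennreal (weighted_vol f {x. t \<le> u x}) * indicator {0<..} t" for t :: real
    using weighted_vol_eq(1)[OF level_set_in_domain[OF assms(1,2), of t]]
    by (cases "0 < t") auto
  have "(\<integral>\<^sup>+ x. ennreal (g x) * ennreal (u x) \<partial>lborel) =
     (\<integral>\<^sup>+ t. (\<integral>\<^sup>+ x. ennreal (g x) * indicator {x. t \<le> u x} x \<partial>lborel) * indicator {0<..} t \<partial>lborel)"
    by (rule layer_cake(1)) (use assms in auto)
  then show ?eq
    by (simp only: levels)
  have "(\<lambda>t. (\<integral>\<^sup>+ x. ennreal (g x) * indicator {x. t \<le> u x} x \<partial>lborel) * indicator {0<..} t)
      \<in> borel_measurable borel"
    using layer_cake(2)[OF assms(1) _ assms(3), of "\<lambda>x. ennreal (g x)"] by measurable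
  then show ?meas
    by (simp only: levels)
qed

end

lemma coarea_Per:
  fixes u :: "'a::euclidean_space \<Rightarrow> real"
  assumes "u \<in> borel_measurable lebesgue" "AE x in lborel. 0 \<le> u x"
  shows "gagliardo s UNIV u / 2 = (\<integral>\<^sup>+ t. Per s {x. t \<le> u x} * indicator {0<..} t \<partial>lborel)" (is ?eq)
    and "(\<lambda>t. Per s {x. t \<le> u x} * indicator {0<..} t) \<in> borel_measurable borel" (is ?meas)
proof -
  have eq: "Per s {x. t \<le> u x} * indicator {0<..} t
      = gagliardo s UNIV (indicator {x. t \<le> u x}) * indicator {0<..} t / 2" for t :: real
    by (simp add: Per_def indicator_def)
  note [measurable] = coarea(2)[OF assms, of s]
  show ?eq
    unfolding coarea(1)[OF assms] eq by (subst nn_integral_divide) auto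
  show ?meas
    unfolding eq by measurable
qed

text \<open>
  The quotient in the Cheeger constant only ranges over sets with positive weighted volume; for the
  others the bound is trivial.
\<close>

lemma weighted_vol_le_Per_if_cheeger:
  assumes "1 \<le> cheeger s f \<Omega>" "A \<in> sets lebesgue" "A \<subseteq> \<Omega>"
  shows "ennreal (weighted_vol f A) \<le> Per s A"
proof (cases "0 < weighted_vol f A")
  case True
  have "1 \<le> Per s A / ennreal (weighted_vol f A)"
    using assms(1) unfolding cheeger_def le_INF_iff using assms(2,3) True by blast
  then have "ennreal (weighted_vol f A) * 1 \<le> ennreal (weighted_vol f A) * (Per s A / ennreal (weighted_vol f A))"
    by (rule mult_left_mono) simp
  also have "\<dots> = Per s A"
    using True by (simp add: ennreal_times_divide mult.commute mult_divide_eq_ennreal)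
  finally show ?thesis
    by simp
qed (simp add: ennreal_neg)

context weight_representative
begin

text \<open>
  Replacing \<open>v\<close> by \<open>\<bar>v\<bar>\<close> does not raise the energy and does not lower the pairing, and for nonnegative functions the
  inequality between volume and perimeter integrates over the levels.
\<close>

lemma F_energy_nonneg:
  assumes vol_le: "\<And>A. A \<in> sets lebesgue \<Longrightarrow> A \<subseteq> \<Omega> \<Longrightarrow> ennreal (weighted_vol f A) \<le> Per s A"
    and v: "v \<in> borel_measurable lebesgue" "\<And>x. x \<notin> \<Omega> \<Longrightarrow> v x = 0"
  shows "0 \<le> F_energy s \<Omega> f v"
proof -
  let ?w = "\<lambda>x. \<bar>v x\<bar>"
  have w: "?w \<in> borel_measurable lebesgue" "\<And>x. x \<notin> \<Omega> \<Longrightarrow> ?w x = 0" "AE x in lborel. 0 \<le> ?w x"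
    using v by auto
  have "ennreal (LINT x:\<Omega>|lebesgue. f x * v x) \<le> (\<integral>\<^sup>+ x. ennreal (g x) * ennreal (?w x) \<partial>lborel)"
    by (rule pairing_le)
  also have "\<dots> = (\<integral>\<^sup>+ t. ennreal (weighted_vol f {x. t \<le> ?w x}) * indicator {0<..} t \<partial>lborel)"
    by (rule pairing_layer_cake(1)[OF w])
  also have "\<dots> \<le> (\<integral>\<^sup>+ t. Per s {x. t \<le> ?w x} * indicator {0<..} t \<partial>lborel)"
    by (intro nn_integral_mono)
      (use vol_le[OF level_set_in_domain[OF w(1,2)]] in \<open>auto simp: indicator_def[of "{0<..}"]\<close>)
  also have "\<dots> = gagliardo s UNIV ?w / 2"
    by (rule coarea_Per(1)[OF w(1,3), symmetric])
  also have "\<dots> \<le> gagliardo s UNIV v / 2"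
    by (intro divide_right_mono_ennreal gagliardo_mono_AE AE_I2) simp
  finally show ?thesis
    by (simp add: F_energy_def energy_nonneg_iff)
qed

lemma P_energy_nonpos_iff:
  assumes "A \<in> sets lebesgue" "A \<subseteq> \<Omega>"
  shows "P_energy s f A \<le> 0 \<longleftrightarrow> Per s A \<le> ennreal (weighted_vol f A)"
  unfolding P_energy_def by (rule energy_nonpos_iff[OF weighted_vol_eq(2)[OF assms]])

text \<open>
  If the pairing were infinite, the Bochner integral in \<open>F_energy\<close> would be \<open>0\<close> by convention and the
  comparison of the two integrals over the levels would say nothing about \<open>F_energy\<close>.
\<close>

lemma F_energy_nonpos:
  assumes u: "u \<in> borel_measurable lebesgue" "\<And>x. x \<notin> \<Omega> \<Longrightarrow> u x = 0" "AE x in lborel. 0 \<le> u x"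
    and le: "AE t in lborel. 0 < t \<longrightarrow> Per s {x. t \<le> u x} \<le> ennreal (weighted_vol f {x. t \<le> u x})"
    and fin: "(\<integral>\<^sup>+ x. ennreal (g x) * ennreal (u x) \<partial>lborel) < \<infinity>"
  shows "F_energy s \<Omega> f u \<le> 0"
proof -
  have "gagliardo s UNIV u / 2 = (\<integral>\<^sup>+ t. Per s {x. t \<le> u x} * indicator {0<..} t \<partial>lborel)"
    by (rule coarea_Per(1)[OF u(1,3)])
  also have "\<dots> \<le> (\<integral>\<^sup>+ t. ennreal (weighted_vol f {x. t \<le> u x}) * indicator {0<..} t \<partial>lborel)"
    by (rule nn_integral_mono_AE) (use le in eventually_elim, simp add: indicator_def[of "{0<..}"])
  also have "\<dots> = (\<integral>\<^sup>+ x. ennreal (g x) * ennreal (u x) \<partial>lborel)"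
    by (rule pairing_layer_cake(1)[OF u, symmetric])
  also have "\<dots> = ennreal (LINT x:\<Omega>|lebesgue. f x * u x)"
    by (rule pairing_eq(1)[OF u(1,3) fin, symmetric])
  finally show ?thesis
    using pairing_eq(2)[OF u(1,3) fin] by (simp add: F_energy_def energy_nonpos_iff)
qed

end

section \<open>Fractional isoperimetric inequality and concentration of mass\<close>

text \<open>
  The constant produced by a ball of twice the volume of the set, not the optimal one.
\<close>

definition isop_const :: "'a::euclidean_space itself \<Rightarrow> real \<Rightarrow> real" where
  "isop_const _ s = (2 / unit_ball_vol (real DIM('a))) powr (- (1 + s / real DIM('a)))"

lemma isop_const_pos: "0 < isop_const TYPE('a::euclidean_space) s"
  unfolding isop_const_def by (simp add: unit_ball_vol_pos less_imp_neq[symmetric])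

text \<open>
  Let \<open>m\<close> be the measure of \<open>E\<close> and \<open>R\<close> the radius of a ball of measure \<open>2 m\<close>. Around each point of \<open>E\<close>,
  at least half of the ball of radius \<open>R\<close> lies outside \<open>E\<close>, and there the kernel is at least
  \<open>R powr (- (n + s))\<close>.
\<close>

lemma fractional_isoperimetric:
  fixes E :: "'a::euclidean_space set"
  assumes [measurable]: "E \<in> sets borel" and m: "emeasure lborel E = ennreal m" "0 < m" and s: "0 < s"
  shows "ennreal (isop_const TYPE('a) s * m powr (1 - s / real DIM('a))) \<le> gagliardo s UNIV (indicator E)"
proof -
  define n where "n = real DIM('a)"
  define \<omega> where "\<omega> = unit_ball_vol n"
  \<comment> \<open>a ball of radius \<open>R\<close> has measure \<open>2 * m\<close>\<close>
  define R where "R = (2 * m / \<omega>) powr (1 / n)"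
  have n: "0 < n" by (simp add: n_def)
  have \<omega>: "0 < \<omega>" unfolding \<omega>_def by (rule unit_ball_vol_pos) (use n in simp)
  have R: "0 < R" using m \<omega> by (simp add: R_def)
  have "R ^ DIM('a) = R powr n"
    using R by (simp add: n_def powr_realpow)
  also have "\<dots> = 2 * m / \<omega>"
    using n m \<omega> by (simp add: R_def powr_powr)
  finally have Rn: "\<omega> * R ^ DIM('a) = 2 * m"
    using \<omega> by simp
  define q where "q = R powr (- (n + s))"
  have q: "0 \<le> q" by (simp add: q_def)
  have inner: "ennreal (q * m) \<le> (\<integral>\<^sup>+ y. ennreal (\<bar>indicator E x - indicator E y\<bar> * kern s (x - y)) \<partial>lborel)"
    if x: "x \<in> E" for x
  proof -
    have "ennreal (2 * m) = emeasure lborel (cball x R)"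
      using R by (subst emeasure_cball) (simp_all add: Rn[symmetric] \<omega>_def n_def)
    also have "\<dots> \<le> emeasure lborel ((cball x R - E) \<union> E)"
      by (intro emeasure_mono) auto
    also have "\<dots> \<le> emeasure lborel (cball x R - E) + ennreal m"
      unfolding m(1)[symmetric] by (intro emeasure_subadditive) auto
    finally have "ennreal m + ennreal m \<le> emeasure lborel (cball x R - E) + ennreal m"
      using m(2) by (simp flip: ennreal_plus)
    then have vol: "ennreal m \<le> emeasure lborel (cball x R - E)"
      by (cases "emeasure lborel (cball x R - E)") (use m(2) in \<open>auto simp flip: ennreal_plus\<close>)
    have "ennreal (q * m) \<le> ennreal q * emeasure lborel (cball x R - E)"
      using vol q m(2) by (simp add: ennreal_mult mult_left_mono)
    also have "\<dots> = (\<integral>\<^sup>+ y. ennreal q * indicator (cball x R - E) y \<partial>lborel)"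
      by (rule nn_integral_cmult_indicator[symmetric]) simp
    also have "\<dots> \<le> (\<integral>\<^sup>+ y. ennreal (\<bar>indicator E x - indicator E y\<bar> * kern s (x - y)) \<partial>lborel)"
    proof (intro nn_integral_mono)
      fix y
      show "ennreal q * indicator (cball x R - E) y \<le> ennreal (\<bar>indicator E x - indicator E y\<bar> * kern s (x - y))"
      proof (cases "y \<in> cball x R - E")
        case True
        then have "0 < norm (x - y)" "norm (x - y) \<le> R"
          using x by (auto simp: dist_norm)
        then have "q \<le> norm (x - y) powr (- (n + s))"
          unfolding q_def using n s by (intro powr_mono2') auto
        also have "\<dots> = kern s (x - y)"
          unfolding kern_def n_def by (rule powr_minus_divide)
        finally show ?thesis
          using True x by (simp add: ennreal_leI)
      qed simp
    qed
    finally show ?thesis .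
  qed
  have "isop_const TYPE('a) s * m powr (1 - s / n) = m * (q * m)"
  proof -
    have "q = (2 / \<omega> * m) powr (- (1 + s / n))"
    proof -
      have "1 / n * - (n + s) = - (1 + s / n)"
        using n by (simp add: field_simps)
      then show ?thesis
        unfolding q_def R_def powr_powr by simp
    qed
    also have "\<dots> = isop_const TYPE('a) s * m powr (- (1 + s / n))"
      using m \<omega> by (subst powr_mult) (auto simp: isop_const_def \<omega>_def n_def)
    finally have q_eq: "q = isop_const TYPE('a) s * m powr (- (1 + s / n))" .
    have "m * m = m powr 2"
      using m(2) by (simp add: power2_eq_square)
    then have "m powr (- (1 + s / n)) * (m * m) = m powr (1 - s / n)"
      by (simp add: powr_add[symmetric])
    then show ?thesis
      by (simp add: q_eq mult_ac)
  qed
  then have "ennreal (isop_const TYPE('a) s * m powr (1 - s / n)) = ennreal (q * m) * emeasure lborel E"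
    using m q by (simp add: ennreal_mult[symmetric] mult_ac)
  also have "\<dots> = (\<integral>\<^sup>+ x. ennreal (q * m) * indicator E x \<partial>lborel)"
    by (rule nn_integral_cmult_indicator[symmetric]) simp
  also have "\<dots> \<le> (\<integral>\<^sup>+ x. \<integral>\<^sup>+ y. ennreal (\<bar>indicator E x - indicator E y\<bar> * kern s (x - y)) \<partial>lborel \<partial>lborel)"
    by (intro nn_integral_mono) (use inner in \<open>auto simp: indicator_def\<close>)
  also have "\<dots> = gagliardo s UNIV (indicator E)"
    by (rule gagliardo_iterated[symmetric]) simp
  finally show ?thesis
    by (simp add: n_def)
qed

lemma borel_inner_representative:
  fixes E :: "'a::euclidean_space set"
  assumes "E \<in> sets lebesgue"
  obtains E' where "E' \<in> sets borel" "E' \<subseteq> E" "AE x in lborel. x \<in> E \<longleftrightarrow> x \<in> E'"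
proof -
  obtain S N N' where *: "E = S \<union> N" "N \<subseteq> N'" "N' \<in> null_sets lborel" "S \<in> sets lborel"
    using assms by (rule sets_completionE)
  have "AE x in lborel. x \<in> E \<longleftrightarrow> x \<in> S"
    using AE_not_in[OF *(3)] by eventually_elim (use *(1,2) in auto)
  then show thesis
    using that[of S] * by auto
qed

text \<open>
  Split \<open>g\<close> at the height \<open>l = m powr (- 1 / p)\<close>: below \<open>l\<close> bound it by \<open>l\<close>, above \<open>l\<close> by
  \<open>l powr (1 - p) * g powr p\<close>. This \<open>l\<close> balances the two contributions.
\<close>

lemma hoelder_set_bound:
  assumes [measurable]: "g \<in> borel_measurable borel" "E \<in> sets borel"
    and g: "\<And>x. 0 \<le> g x" and p: "1 < p"
    and C: "(\<integral>\<^sup>+ x. ennreal (g x powr p) \<partial>lborel) \<le> ennreal C" "0 \<le> C"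
    and m: "emeasure lborel E = ennreal m" "0 < m"
  shows "(\<integral>\<^sup>+ x. ennreal (g x) * indicator E x \<partial>lborel) \<le> ennreal ((1 + C) * m powr (1 - 1 / p))"
proof -
  define l where "l = m powr (- 1 / p)"
  have l: "0 < l" using m by (simp add: l_def)
  have pointwise: "g x \<le> l + l powr (1 - p) * g x powr p" for x
  proof (cases "g x \<le> l")
    case False
    then have gl: "l < g x" "0 < g x" using l by auto
    have "g x = g x powr (1 - p) * g x powr p"
      using gl by (simp add: powr_add[symmetric])
    also have "\<dots> \<le> l powr (1 - p) * g x powr p"
      using gl l p by (intro mult_right_mono powr_mono2') auto
    finally show ?thesis
      using l by simp
  qed (simp add: add_increasing2)
  have "(\<integral>\<^sup>+ x. ennreal (g x) * indicator E x \<partial>lborel)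
      \<le> (\<integral>\<^sup>+ x. ennreal l * indicator E x + ennreal (l powr (1 - p)) * ennreal (g x powr p) \<partial>lborel)"
    by (intro nn_integral_mono)
      (use pointwise l in \<open>auto simp: indicator_def ennreal_mult[symmetric] ennreal_plus[symmetric] simp del: ennreal_plus intro!: ennreal_leI\<close>)
  also have "\<dots> = ennreal l * ennreal m + ennreal (l powr (1 - p)) * (\<integral>\<^sup>+ x. ennreal (g x powr p) \<partial>lborel)"
    by (simp add: nn_integral_add nn_integral_cmult m(1))
  also have "\<dots> \<le> ennreal l * ennreal m + ennreal (l powr (1 - p)) * ennreal C"
    by (intro add_left_mono mult_left_mono C(1)) simp
  also have "\<dots> = ennreal (l * m + l powr (1 - p) * C)"
    using l m C(2) by (simp add: ennreal_mult)
  also have "l * m = m powr (1 - 1 / p)"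
    using m(2) powr_add[of m "- 1 / p" 1] by (simp add: l_def)
  also have "l powr (1 - p) = m powr (1 - 1 / p)"
  proof -
    have "- 1 / p * (1 - p) = 1 - 1 / p"
      using p by (simp add: field_simps)
    then show ?thesis
      unfolding l_def powr_powr by (rule arg_cong)
  qed
  finally show ?thesis
    by (simp add: algebra_simps)
qed

text \<open>
  The isoperimetric exponent \<open>1 - s/n\<close> is smaller than \<open>1 - \<sigma>/n\<close>, so for small \<open>m\<close> the perimeter would
  exceed the assumed upper bound.
\<close>

lemma mass_lower_bound:
  fixes E :: "'a::euclidean_space set"
  assumes s: "0 < s" "\<sigma> < s" and K: "0 < K"
    and E: "E \<in> sets lebesgue" "emeasure lebesgue E = ennreal m" "0 < m"
    and le: "Per s E \<le> ennreal (K * m powr (1 - \<sigma> / real DIM('a)))"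
  shows "(isop_const TYPE('a) s / (2 * K)) powr (real DIM('a) / (s - \<sigma>)) \<le> m"
proof -
  define n where "n = real DIM('a)"
  define c where "c = isop_const TYPE('a) s"
  have n: "0 < n" by (simp add: n_def)
  have c: "0 < c" by (simp add: c_def isop_const_pos)
  obtain E' where [measurable]: "E' \<in> sets borel" and ae: "AE x in lborel. x \<in> E \<longleftrightarrow> x \<in> E'"
    using borel_inner_representative[OF E(1)] .
  have m': "emeasure lborel E' = ennreal m"
  proof -
    have "emeasure lebesgue E = emeasure lebesgue E'"
      by (rule emeasure_eq_AE) (use ae E(1) in \<open>auto simp: AE_completion_iff\<close>)
    then show ?thesis
      using E(2) by simp
  qed
  have "ennreal (c * m powr (1 - s / n)) \<le> gagliardo s UNIV (indicator E')"
    unfolding c_def n_def by (rule fractional_isoperimetric) (use m' E s in auto)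
  also have "\<dots> = gagliardo s UNIV (indicator E)"
    by (rule gagliardo_cong_AE) (use ae in eventually_elim, simp add: indicator_def)
  also have "\<dots> = 2 * Per s E"
    by (simp add: Per_def ennreal_times_divide mult.commute[of 2] mult_divide_eq_ennreal)
  also have "\<dots> \<le> 2 * ennreal (K * m powr (1 - \<sigma> / n))"
    unfolding n_def by (rule mult_left_mono[OF le]) simp
  also have "\<dots> = ennreal (2 * K * m powr (1 - \<sigma> / n))"
    using K by (simp add: ennreal_mult mult.assoc)
  finally have "c * m powr (1 - s / n) \<le> 2 * K * m powr (1 - \<sigma> / n)"
    using K by (simp add: ennreal_le_iff)
  also have "m powr (1 - \<sigma> / n) = m powr (1 - s / n) * m powr ((s - \<sigma>) / n)"
    by (simp add: powr_add[symmetric] diff_divide_distrib)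
  finally have "c \<le> 2 * K * m powr ((s - \<sigma>) / n)"
    using E(3) by (simp add: mult.left_commute[of _ "m powr (1 - s / n)"])
  then have "c / (2 * K) \<le> m powr ((s - \<sigma>) / n)"
    using K by (simp add: field_simps)
  then have "(c / (2 * K)) powr (n / (s - \<sigma>)) \<le> (m powr ((s - \<sigma>) / n)) powr (n / (s - \<sigma>))"
    using c K n s by (intro powr_mono2) auto
  also have "\<dots> = m"
    using n s E(3) by (simp add: powr_powr)
  finally show ?thesis
    by (simp add: c_def n_def)
qed

text \<open>
  By Markov's inequality the measure of the superlevel sets of an \<open>L\<^sup>1\<close> function tends to zero, so it
  eventually falls below the gap \<open>c\<close>.
\<close>

lemma levels_eventually_null:
  fixes u :: "'a::euclidean_space \<Rightarrow> real"
  assumes u: "u \<in> borel_measurable lebesgue" "AE x in lborel. 0 \<le> u x"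
    and L1: "(\<integral>\<^sup>+ x. ennreal (u x) \<partial>lborel) < \<infinity>"
    and c: "0 < c"
    and gap: "AE t in lborel. 0 < t \<longrightarrow>
      emeasure lebesgue {x. t \<le> u x} = 0 \<or> ennreal c \<le> emeasure lebesgue {x. t \<le> u x}"
  obtains T where "0 < T" "AE t in lborel. T \<le> t \<longrightarrow> emeasure lebesgue {x. t \<le> u x} = 0"
proof -
  obtain A where A: "0 \<le> A" "(\<integral>\<^sup>+ x. ennreal (u x) \<partial>lborel) = ennreal A"
    using L1 by (cases "\<integral>\<^sup>+ x. ennreal (u x) \<partial>lborel") auto
  define T where "T = (A + 1) / c"
  have T: "0 < T" using A c by (simp add: T_def)
  have small: "emeasure lebesgue {x. t \<le> u x} < ennreal c" if t: "T \<le> t" for t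
  proof -
    have t0: "0 < t" using T t by simp
    have meas: "{x. t \<le> u x} \<in> sets lebesgue"
      using measurable_sets[OF u(1), of "{t..}"] by (simp add: vimage_def)
    have "ennreal t * emeasure lebesgue {x. t \<le> u x} = (\<integral>\<^sup>+ x. ennreal t * indicator {x. t \<le> u x} x \<partial>lebesgue)"
      by (rule nn_integral_cmult_indicator[symmetric, OF meas])
    also have "\<dots> \<le> (\<integral>\<^sup>+ x. ennreal (u x) \<partial>lebesgue)"
      by (intro nn_integral_mono) (auto simp: indicator_def ennreal_leI)
    also have "\<dots> = ennreal A"
      by (simp add: nn_integral_completion A(2))
    finally have *: "ennreal t * emeasure lebesgue {x. t \<le> u x} \<le> ennreal A" .
    have "A < t * c"
    proof -
      have "A < T * c" using c by (simp add: T_def)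
      also have "\<dots> \<le> t * c" using t c by simp
      finally show ?thesis .
    qed
    show ?thesis
    proof (rule ccontr)
      assume "\<not> ?thesis"
      then have "ennreal t * ennreal c \<le> ennreal t * emeasure lebesgue {x. t \<le> u x}"
        by (intro mult_left_mono) auto
      also note *
      finally have "ennreal (t * c) \<le> ennreal A"
        using t0 c by (simp add: ennreal_mult)
      then show False
        using \<open>A < t * c\<close> A(1) by (simp add: ennreal_le_iff)
    qed
  qed
  show thesis
  proof (rule that[OF T])
    show "AE t in lborel. T \<le> t \<longrightarrow> emeasure lebesgue {x. t \<le> u x} = 0"
      using gap by eventually_elim (use small T in \<open>force simp: not_less[symmetric]\<close>)
  qed
qed

section \<open>Minimizing level sets give a minimizing function\<close>

lemma Cc_infinity_integrable:
  fixes \<phi> :: "'a::euclidean_space \<Rightarrow> real"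
  assumes "\<phi> \<in> Cc_infinity \<Omega>"
  shows "integrable lborel \<phi>"
proof -
  let ?K = "closure {x. \<phi> x \<noteq> 0}"
  have "C_k 0 \<phi>" and K: "compact ?K"
    using assms unfolding Cc_infinity_def by blast+
  then have "continuous_on UNIV \<phi>" by simp
  then have "integrable lborel (\<lambda>x. indicator ?K x *\<^sub>R \<phi> x)"
    by (intro borel_integrable_compact K) (rule continuous_on_subset[OF _ subset_UNIV])
  also have "(\<lambda>x. indicator ?K x *\<^sub>R \<phi> x) = \<phi>"
  proof
    fix x show "indicator ?K x *\<^sub>R \<phi> x = \<phi> x"
      using closure_subset[of "{x. \<phi> x \<noteq> 0}"] by (cases "\<phi> x = 0") (auto simp: indicator_def)
  qed
  finally show ?thesis .
qed

lemma W0s1_L1: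
  assumes "u \<in> W0s1 s \<Omega>"
  shows "(\<integral>\<^sup>+ x. ennreal \<bar>u x\<bar> \<partial>lborel) < \<infinity>"
proof -
  obtain \<phi> where \<phi>: "\<phi> \<in> Cc_infinity \<Omega>" "Ws1_norm s \<Omega> (\<lambda>x. u x - \<phi> x) < ennreal 1"
    using assms zero_less_one unfolding W0s1_def by blast
  have u: "u \<in> borel_measurable lebesgue" "\<And>x. x \<notin> \<Omega> \<Longrightarrow> u x = 0"
    using assms by (auto simp: W0s1_def)
  have int: "integrable lborel \<phi>"
    by (rule Cc_infinity_integrable[OF \<phi>(1)])
  then have [measurable]: "\<phi> \<in> borel_measurable borel" by simp
  have \<phi>0: "\<phi> x = 0" if "x \<notin> \<Omega>" for x
    using \<phi>(1) closure_subset[of "{x. \<phi> x \<noteq> 0}"] that by (auto simp: Cc_infinity_def)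
  have "(\<integral>\<^sup>+ x. ennreal \<bar>u x - \<phi> x\<bar> \<partial>lebesgue) = (\<integral>\<^sup>+ x\<in>\<Omega>. ennreal \<bar>u x - \<phi> x\<bar> \<partial>lebesgue)"
    by (intro nn_integral_cong) (auto simp: indicator_def u \<phi>0)
  also have "\<dots> \<le> Ws1_norm s \<Omega> (\<lambda>x. u x - \<phi> x)"
    by (simp add: Ws1_norm_def)
  finally have fin: "(\<integral>\<^sup>+ x. ennreal \<bar>u x - \<phi> x\<bar> \<partial>lebesgue) < \<infinity>"
    using \<phi>(2) by (auto intro: le_less_trans less_trans)
  have "(\<integral>\<^sup>+ x. ennreal \<bar>u x\<bar> \<partial>lebesgue) \<le> (\<integral>\<^sup>+ x. ennreal \<bar>u x - \<phi> x\<bar> + ennreal \<bar>\<phi> x\<bar> \<partial>lebesgue)"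
    by (intro nn_integral_mono) (auto simp flip: ennreal_plus intro!: ennreal_leI)
  also have "\<dots> = (\<integral>\<^sup>+ x. ennreal \<bar>u x - \<phi> x\<bar> \<partial>lebesgue) + (\<integral>\<^sup>+ x. ennreal \<bar>\<phi> x\<bar> \<partial>lebesgue)"
    using u(1) measurable_completion[of \<phi> lborel borel] by (intro nn_integral_add) auto
  also have "\<dots> < \<infinity>"
    using fin int by (simp add: nn_integral_completion integrable_iff_bounded)
  finally show ?thesis
    by (simp add: nn_integral_completion)
qed

text \<open>
  On the bounded set \<open>\<Omega>\<close>, \<open>L\<^sup>p\<close> is contained in \<open>L\<^sup>1\<close> because \<open>a \<le> 1 + a powr p\<close>.
\<close>

lemma weight_representative_exists:
  fixes \<Omega> :: "'a::euclidean_space set"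
  assumes \<Omega>: "open \<Omega>" "bounded \<Omega>" and p: "1 < p"
    and f_nonneg: "AE x in lebesgue. x \<in> \<Omega> \<longrightarrow> 0 \<le> f x"
    and f_measurable: "set_borel_measurable lebesgue \<Omega> f"
    and f_Lp: "set_integrable lebesgue \<Omega> (\<lambda>x. \<bar>f x\<bar> powr p)"
  obtains g C where "weight_representative \<Omega> f g" "0 \<le> C"
    "(\<integral>\<^sup>+ x. ennreal (g x powr p) \<partial>lborel) \<le> ennreal C"
proof -
  have [measurable]: "\<Omega> \<in> sets borel" using \<Omega>(1) by simp
  obtain g' where [measurable]: "g' \<in> borel_measurable borel"
    and g': "AE x in lborel. indicator \<Omega> x *\<^sub>R f x = g' x"
    using f_measurable unfolding set_borel_measurable_def by (rule borel_representative)
  define g where "g x = indicator \<Omega> x * max 0 (g' x)" for x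
  have [measurable]: "g \<in> borel_measurable borel"
    unfolding g_def[abs_def] by measurable
  have g_nonneg: "0 \<le> g x" for x by (simp add: g_def)
  have ae: "AE x in lborel. g x = indicator \<Omega> x * f x"
    using g' f_nonneg[unfolded AE_completion_iff]
    by eventually_elim (auto simp: g_def indicator_def split: if_splits)
  have fin: "(\<integral>\<^sup>+ x. ennreal (g x powr p) \<partial>lborel) < \<infinity>"
  proof -
    have "(\<integral>\<^sup>+ x. ennreal (g x powr p) \<partial>lborel) = (\<integral>\<^sup>+ x. ennreal (norm (indicator \<Omega> x *\<^sub>R \<bar>f x\<bar> powr p)) \<partial>lborel)"
      by (rule nn_integral_cong_AE)
        (use ae f_nonneg[unfolded AE_completion_iff] in eventually_elim, auto simp: indicator_def)
    also have "\<dots> < \<infinity>"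
      using integrableD(2)[OF f_Lp[unfolded set_integrable_def]]
      by (simp add: nn_integral_completion less_top)
    finally show ?thesis .
  qed
  have "integrable lborel g"
  proof (rule integrableI_nonneg)
    have "(\<integral>\<^sup>+ x. ennreal (g x) \<partial>lborel) \<le> (\<integral>\<^sup>+ x. indicator \<Omega> x + ennreal (g x powr p) \<partial>lborel)"
    proof (intro nn_integral_mono)
      fix x
      show "ennreal (g x) \<le> indicator \<Omega> x + ennreal (g x powr p)"
      proof (cases "g x \<le> 1")
        case True
        then show ?thesis
          by (cases "x \<in> \<Omega>") (auto simp: g_def[of x] add_increasing2)
      next
        case False
        then have "g x \<le> g x powr p"
          using p powr_mono[of 1 p "g x"] by simp
        then show ?thesis
          by (intro add_increasing ennreal_leI) auto
      qed
    qed
    also have "\<dots> = emeasure lborel \<Omega> + (\<integral>\<^sup>+ x. ennreal (g x powr p) \<partial>lborel)"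
      by (simp add: nn_integral_add)
    also have "\<dots> < \<infinity>"
      using fin emeasure_bounded_finite[OF \<Omega>(2)] by simp
    finally show "(\<integral>\<^sup>+ x. ennreal (g x) \<partial>lborel) < \<infinity>" .
  qed (simp_all add: g_nonneg)
  then have "weight_representative \<Omega> f g"
    using \<Omega>(1) f_measurable g_nonneg ae by unfold_locales auto
  moreover obtain C where "0 \<le> C" "(\<integral>\<^sup>+ x. ennreal (g x powr p) \<partial>lborel) = ennreal C"
    using fin by (cases "\<integral>\<^sup>+ x. ennreal (g x powr p) \<partial>lborel") auto
  ultimately show thesis
    using that[of g C] by simp
qed

lemma P_energy_empty [simp]: "P_energy s f {} = 0"
  by (simp add: P_energy_def Per_def gagliardo_UNIV weighted_vol_def set_lebesgue_integral_def
      zero_ereal_def[symmetric] zero_ennreal.rep_eq)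

context weight_representative
begin

lemma weighted_vol_hoelder:
  assumes p: "1 < p"
    and C: "(\<integral>\<^sup>+ x. ennreal (g x powr p) \<partial>lborel) \<le> ennreal C" "0 \<le> C"
    and E: "E \<in> sets lebesgue" "E \<subseteq> \<Omega>" "emeasure lebesgue E = ennreal m" "0 < m"
  shows "ennreal (weighted_vol f E) \<le> ennreal ((1 + C) * m powr (1 - 1 / p))"
proof -
  obtain E' where [measurable]: "E' \<in> sets borel" and ae: "AE x in lborel. x \<in> E \<longleftrightarrow> x \<in> E'"
    using borel_inner_representative[OF E(1)] .
  have "emeasure lebesgue E = emeasure lebesgue E'"
    by (rule emeasure_eq_AE) (use ae E(1) in \<open>auto simp: AE_completion_iff\<close>)
  then have m': "emeasure lborel E' = ennreal m"
    using E(3) by simp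
  have "ennreal (weighted_vol f E) = (\<integral>\<^sup>+ x. ennreal (g x) * indicator E' x \<partial>lborel)"
    unfolding weighted_vol_eq(1)[OF E(1,2)]
    by (rule nn_integral_cong_AE) (use ae in eventually_elim, simp add: indicator_def)
  also have "\<dots> \<le> ennreal ((1 + C) * m powr (1 - 1 / p))"
    by (rule hoelder_set_bound) (use weight_nonneg p C m' E(4) in auto)
  finally show ?thesis .
qed

text \<open>
  Levels with perimeter at most their weighted volume are null or have a definite mass. Hence they are
  null above some height \<open>T\<close>, and the layer-cake integral is at most \<open>T\<close> times the total weight.
\<close>

lemma level_minimizers_imp_finite_pairing:
  assumes s: "0 < \<sigma>" "\<sigma> < s" "s < 1"
    and C: "(\<integral>\<^sup>+ x. ennreal (g x powr (real DIM('a) / \<sigma>)) \<partial>lborel) \<le> ennreal C" "0 \<le> C"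
    and bdd: "bounded \<Omega>"
    and u: "u \<in> borel_measurable lebesgue" "\<And>x. x \<notin> \<Omega> \<Longrightarrow> u x = 0" "AE x in lborel. 0 \<le> u x"
    and L1: "(\<integral>\<^sup>+ x. ennreal (u x) \<partial>lborel) < \<infinity>"
    and le: "AE t in lborel. 0 < t \<longrightarrow> Per s {x. t \<le> u x} \<le> ennreal (weighted_vol f {x. t \<le> u x})"
  shows "(\<integral>\<^sup>+ x. ennreal (g x) * ennreal (u x) \<partial>lborel) < \<infinity>"
proof -
  define c where "c = (isop_const TYPE('a) s / (2 * (1 + C))) powr (real DIM('a) / (s - \<sigma>))"
  have sets_\<Omega>: "\<Omega> \<in> sets lebesgue"
    by (rule sets_completionI_sets) (use domain_sets in simp)
  have n: "\<sigma> < real DIM('a)"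
    using s DIM_positive[where 'a='a] by (smt (verit) of_nat_1 of_nat_mono One_nat_def Suc_leI)
  have p: "1 < real DIM('a) / \<sigma>"
    using s n by (simp add: less_divide_eq del: One_nat_def)
  have c: "0 < c"
    using isop_const_pos[where 'a='a, of s] C(2) by (simp add: c_def)
  have gap: "AE t in lborel. 0 < t \<longrightarrow>
      emeasure lebesgue {x. t \<le> u x} = 0 \<or> ennreal c \<le> emeasure lebesgue {x. t \<le> u x}"
    using le
  proof eventually_elim
    case (elim t)
    show ?case
    proof (intro impI disjCI)
      assume t: "0 < t" and nz: "\<not> ennreal c \<le> emeasure lebesgue {x. t \<le> u x}"
      note E = level_set_in_domain[OF u(1,2) t]
      have "emeasure lebesgue {x. t \<le> u x} \<le> emeasure lebesgue \<Omega>"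
        by (intro emeasure_mono E sets_\<Omega>)
      also have "\<dots> < \<infinity>"
        using emeasure_bounded_finite[OF bdd] by simp
      finally obtain m where m: "0 \<le> m" "emeasure lebesgue {x. t \<le> u x} = ennreal m"
        by (cases "emeasure lebesgue {x. t \<le> u x}") auto
      show "emeasure lebesgue {x. t \<le> u x} = 0"
      proof (rule ccontr)
        assume "emeasure lebesgue {x. t \<le> u x} \<noteq> 0"
        then have m0: "0 < m" using m by (cases "m = 0") auto
        have "Per s {x. t \<le> u x} \<le> ennreal ((1 + C) * m powr (1 - 1 / (real DIM('a) / \<sigma>)))"
          using elim t weighted_vol_hoelder[OF p C E m(2) m0] by (auto intro: order_trans)
        then have "c \<le> m"
          unfolding c_def
          by (intro mass_lower_bound[where \<sigma>=\<sigma>]) (use s C E m m0 in auto)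
        then show False
          using nz m by (simp add: ennreal_leI)
      qed
    qed
  qed
  obtain T where T: "0 < T" "AE t in lborel. T \<le> t \<longrightarrow> emeasure lebesgue {x. t \<le> u x} = 0"
    using levels_eventually_null[OF u(1,3) L1 c gap] .
  have "(\<integral>\<^sup>+ x. ennreal (g x) * ennreal (u x) \<partial>lborel)
     = (\<integral>\<^sup>+ t. ennreal (weighted_vol f {x. t \<le> u x}) * indicator {0<..} t \<partial>lborel)"
    by (rule pairing_layer_cake(1)[OF u])
  also have "\<dots> \<le> (\<integral>\<^sup>+ t. (\<integral>\<^sup>+ x. ennreal (g x) \<partial>lborel) * indicator {0..T} t \<partial>lborel)"
  proof (rule nn_integral_mono_AE, use T(2) in eventually_elim)
    case (elim t)
    show ?case
    proof (cases "0 < t")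
      case True
      note E = level_set_in_domain[OF u(1,2) True]
      have eq: "ennreal (weighted_vol f {x. t \<le> u x}) = (\<integral>\<^sup>+ x. ennreal (g x) * indicator {x. t \<le> u x} x \<partial>lborel)"
        by (rule weighted_vol_eq(1)[OF E])
      show ?thesis
      proof (cases "T \<le> t")
        case True
        then have "{x. t \<le> u x} \<in> null_sets lebesgue"
          using elim E by (intro null_setsI) auto
        then have null: "AE x in lborel. x \<notin> {x. t \<le> u x}"
          using AE_not_in AE_completion_iff by blast
        have "(\<integral>\<^sup>+ x. ennreal (g x) * indicator {x. t \<le> u x} x \<partial>lborel) = (\<integral>\<^sup>+ x. 0 \<partial>(lborel :: 'a measure))"
          by (rule nn_integral_cong_AE) (use null in eventually_elim, simp)
        then show ?thesis
          using eq by simp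
      next
        case False
        then show ?thesis
          unfolding eq using True by (auto simp: indicator_def intro!: nn_integral_mono)
      qed
    qed simp
  qed
  also have "\<dots> = (\<integral>\<^sup>+ x. ennreal (g x) \<partial>lborel) * ennreal T"
    using T(1) by (subst nn_integral_cmult_indicator) auto
  also have "\<dots> < \<infinity>"
    using weight_nn_integral_finite by (simp add: ennreal_mult_less_top)
  finally show ?thesis .
qed

theorem minimizing_levels_imp_minimizer:
  assumes s: "0 < \<sigma>" "\<sigma> < s" "s < 1"
    and C: "(\<integral>\<^sup>+ x. ennreal (g x powr (real DIM('a) / \<sigma>)) \<partial>lborel) \<le> ennreal C" "0 \<le> C"
    and bdd: "bounded \<Omega>"
    and cheeger: "1 \<le> cheeger s f \<Omega>"
    and u: "u \<in> W0s1 s \<Omega>" "AE x in lebesgue. 0 \<le> u x"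
    and levels: "AE t in lebesgue. 0 < t \<longrightarrow> P_minimizer s \<Omega> f {x. t \<le> u x}"
  shows "F_minimizer s \<Omega> f u"
proof -
  have u': "u \<in> borel_measurable lebesgue" "\<And>x. x \<notin> \<Omega> \<Longrightarrow> u x = 0" "AE x in lborel. 0 \<le> u x"
    using u by (auto simp: W0s1_def AE_completion_iff)
  have le: "AE t in lborel. 0 < t \<longrightarrow> Per s {x. t \<le> u x} \<le> ennreal (weighted_vol f {x. t \<le> u x})"
    using levels[unfolded AE_completion_iff]
  proof eventually_elim
    case (elim t)
    show ?case
    proof
      assume "0 < t"
      with elim have "P_energy s f {x. t \<le> u x} \<le> P_energy s f {}"
        unfolding P_minimizer_def by blast
      then show "Per s {x. t \<le> u x} \<le> ennreal (weighted_vol f {x. t \<le> u x})"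
        using P_energy_nonpos_iff[OF level_set_in_domain[OF u'(1,2) \<open>0 < t\<close>]] by simp
    qed
  qed
  have "(\<integral>\<^sup>+ x. ennreal (u x) \<partial>lborel) \<le> (\<integral>\<^sup>+ x. ennreal \<bar>u x\<bar> \<partial>lborel)"
    by (intro nn_integral_mono ennreal_leI) simp
  then have L1: "(\<integral>\<^sup>+ x. ennreal (u x) \<partial>lborel) < \<infinity>"
    using W0s1_L1[OF u(1)] by (rule le_less_trans)
  have upper: "F_energy s \<Omega> f u \<le> 0"
    by (rule F_energy_nonpos[OF u' le level_minimizers_imp_finite_pairing[OF s C bdd u' L1 le]])
  have lower: "0 \<le> F_energy s \<Omega> f v" if "v \<in> W0s1 s \<Omega>" for v
    by (rule F_energy_nonneg[OF weighted_vol_le_Per_if_cheeger[OF cheeger]]) (use that in \<open>auto simp: W0s1_def\<close>)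
  show ?thesis
    using u(1) order_trans[OF upper lower] by (simp add: F_minimizer_def)
qed

end

section \<open>Exterior corkscrews and a Hardy inequality\<close>

text \<open>
  Below the graph of an \<open>L\<close>-Lipschitz function there is a downward cone at each point that is not above
  the graph. The ball of the statement sits inside this cone: going down by \<open>R / 2\<close> leaves room for a
  lateral displacement of order \<open>R / (1 + L)\<close>. The factor \<open>2 * L\<close> in place of \<open>L\<close> comes from bounding the
  norm of the projection \<open>x - (x \<bullet> e) *\<^sub>R e\<close> by \<open>2 * norm x\<close>.
\<close>

lemma local_exterior_corkscrew:
  fixes p :: "'a::euclidean_space"
  assumes e: "norm e = 1" and L: "L-lipschitz_on {y. y \<bullet> e = 0} g"
    and graph: "\<Omega> \<inter> ball p r = {x \<in> ball p r. g (x - (x \<bullet> e) *\<^sub>R e) < x \<bullet> e}"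
    and q: "q \<in> ball p (r / 2)" "q \<notin> \<Omega>" and R: "0 < R" "R \<le> r / 2"
  shows "ball (q - (R / 2) *\<^sub>R e) (R / (2 * (1 + 2 * L))) \<subseteq> cball q R - \<Omega>"
proof
  let ?\<pi> = "\<lambda>x::'a. x - (x \<bullet> e) *\<^sub>R e"
  have ee: "e \<bullet> e = 1"
    using e by (simp add: norm_eq_1)
  have \<pi>: "?\<pi> x \<in> {y. y \<bullet> e = 0}" for x
    by (simp add: inner_diff_left ee)
  have L0: "0 \<le> L"
    using L by (rule lipschitz_on_nonneg)
  fix y
  assume y: "y \<in> ball (q - (R / 2) *\<^sub>R e) (R / (2 * (1 + 2 * L)))"
  define w where "w = y - (q - (R / 2) *\<^sub>R e)"
  have "norm w < R / (2 * (1 + 2 * L))"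
    using y by (simp add: w_def dist_norm norm_minus_commute)
  then have w: "(1 + 2 * L) * norm w < R / 2"
    using L0 by (simp add: field_simps)
  have "norm w \<le> (1 + 2 * L) * norm w"
    using L0 by (simp add: algebra_simps)
  with w have w': "norm w < R / 2" by simp
  have y_eq: "y = q - (R / 2) *\<^sub>R e + w" by (simp add: w_def)
  have "norm (y - q) \<le> norm (w) + norm ((R / 2) *\<^sub>R e)"
    using norm_triangle_ineq4[of w "(R / 2) *\<^sub>R e"] by (simp add: y_eq)
  also have "\<dots> < R"
    using w' R e by simp
  finally have yq: "dist q y < R"
    by (simp add: dist_norm norm_minus_commute)
  have "dist p y \<le> dist p q + dist q y"
    by (rule dist_triangle)
  then have yp: "y \<in> ball p r"
    using yq q(1) R by simp
  have qp: "q \<in> ball p r"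
    using q(1) R by auto
  have "y \<notin> \<Omega>"
  proof
    assume "y \<in> \<Omega>"
    then have "g (?\<pi> y) < y \<bullet> e"
      using graph yp by blast
    also have "y \<bullet> e = q \<bullet> e - R / 2 + w \<bullet> e"
      by (simp add: y_eq inner_diff_left inner_add_left ee)
    also have "w \<bullet> e \<le> norm w"
      using norm_cauchy_schwarz[of w e] e by simp
    finally have 1: "g (?\<pi> y) < q \<bullet> e - R / 2 + norm w" by simp
    have 2: "q \<bullet> e \<le> g (?\<pi> q)"
      using graph qp q(2) by force
    have "?\<pi> y - ?\<pi> q = w - (w \<bullet> e) *\<^sub>R e"
      by (simp add: y_eq inner_diff_left inner_add_left ee algebra_simps)
    then have "dist (?\<pi> y) (?\<pi> q) \<le> norm w + norm ((w \<bullet> e) *\<^sub>R e)"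
      by (metis dist_norm norm_triangle_ineq4)
    also have "\<dots> \<le> 2 * norm w"
      using Cauchy_Schwarz_ineq2[of w e] e by simp
    finally have "dist (?\<pi> y) (?\<pi> q) \<le> 2 * norm w" .
    then have "L * dist (?\<pi> y) (?\<pi> q) \<le> L * (2 * norm w)"
      using L0 by (rule mult_left_mono)
    moreover have "dist (g (?\<pi> y)) (g (?\<pi> q)) \<le> L * dist (?\<pi> y) (?\<pi> q)"
      by (rule lipschitz_onD[OF L \<pi> \<pi>])
    ultimately have "g (?\<pi> q) \<le> g (?\<pi> y) + L * (2 * norm w)"
      by (simp add: dist_real_def)
    then show False
      using 1 2 w by (simp add: algebra_simps)
  qed
  then show "y \<in> cball q R - \<Omega>"
    using yq by simp
qed

text \<open>
  The boundary is compact, so finitely many charts suffice. One number \<open>\<rho>\<close> serves both as the maximal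
  scale and as the relative size of the ball.
\<close>

lemma uniform_exterior_corkscrew:
  fixes \<Omega> :: "'a::euclidean_space set"
  assumes "open \<Omega>" "bounded \<Omega>" "lipschitz_boundary \<Omega>"
  obtains \<rho> where "0 < \<rho>"
    "\<And>q R. q \<in> frontier \<Omega> \<Longrightarrow> 0 < R \<Longrightarrow> R \<le> \<rho> \<Longrightarrow> \<exists>y. ball y (\<rho> * R) \<subseteq> cball q R - \<Omega>"
proof -
  have "\<forall>p\<in>frontier \<Omega>. \<exists>\<rho>>0. \<forall>q R. q \<in> ball p \<rho> \<longrightarrow> q \<notin> \<Omega> \<longrightarrow> 0 < R \<longrightarrow> R \<le> \<rho> \<longrightarrow>
     (\<exists>y. ball y (\<rho> * R) \<subseteq> cball q R - \<Omega>)"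
  proof
    fix p assume "p \<in> frontier \<Omega>"
    then obtain r e g L where *: "0 < r" "norm e = 1" "L-lipschitz_on {y. y \<bullet> e = 0} g"
      "\<Omega> \<inter> ball p r = {x \<in> ball p r. g (x - (x \<bullet> e) *\<^sub>R e) < x \<bullet> e}"
      using bspec[OF assms(3)[unfolded lipschitz_boundary_def]] by blast
    define \<rho> where "\<rho> = min (r / 2) (1 / (2 * (1 + 2 * L)))"
    have "0 \<le> L" using *(3) by (rule lipschitz_on_nonneg)
    then have "0 < \<rho>" using *(1) by (simp add: \<rho>_def)
    moreover have "\<exists>y. ball y (\<rho> * R) \<subseteq> cball q R - \<Omega>"
      if q: "q \<in> ball p \<rho>" "q \<notin> \<Omega>" and R: "0 < R" "R \<le> \<rho>" for q R
    proof -
      have "ball (q - (R / 2) *\<^sub>R e) (R / (2 * (1 + 2 * L))) \<subseteq> cball q R - \<Omega>"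
        by (rule local_exterior_corkscrew[OF *(2-4)]) (use q R in \<open>auto simp: \<rho>_def\<close>)
      moreover have "\<rho> * R \<le> 1 / (2 * (1 + 2 * L)) * R"
        using R by (intro mult_right_mono) (auto simp: \<rho>_def)
      then have "ball (q - (R / 2) *\<^sub>R e) (\<rho> * R) \<subseteq> ball (q - (R / 2) *\<^sub>R e) (R / (2 * (1 + 2 * L)))"
        by (intro subset_ball) simp
      ultimately show ?thesis
        by blast
    qed
    ultimately show "\<exists>\<rho>>0. \<forall>q R. q \<in> ball p \<rho> \<longrightarrow> q \<notin> \<Omega> \<longrightarrow> 0 < R \<longrightarrow> R \<le> \<rho> \<longrightarrow>
        (\<exists>y. ball y (\<rho> * R) \<subseteq> cball q R - \<Omega>)"
      by blast
  qed
  from bchoice[OF this] obtain r where r: "\<forall>p\<in>frontier \<Omega>. 0 < r p \<and>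
      (\<forall>q R. q \<in> ball p (r p) \<longrightarrow> q \<notin> \<Omega> \<longrightarrow> 0 < R \<longrightarrow> R \<le> r p \<longrightarrow> (\<exists>y. ball y (r p * R) \<subseteq> cball q R - \<Omega>))"
    by blast
  have "compact (frontier \<Omega>)"
    using assms(2) by (rule compact_frontier_bounded)
  moreover have "frontier \<Omega> \<subseteq> (\<Union>p\<in>frontier \<Omega>. ball p (r p))"
    using r by (intro subsetI UN_I) auto
  ultimately obtain D where D: "D \<subseteq> frontier \<Omega>" "finite D" "frontier \<Omega> \<subseteq> (\<Union>p\<in>D. ball p (r p))"
    using compactE_image[of "frontier \<Omega>" "frontier \<Omega>" "\<lambda>p. ball p (r p)"] by auto
  define \<rho> where "\<rho> = Min (insert 1 (r ` D))"
  show thesis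
  proof (rule that)
    show "0 < \<rho>"
      using D(1,2) r by (auto simp: \<rho>_def)
    fix q R assume q: "q \<in> frontier \<Omega>" and R: "0 < R" "R \<le> \<rho>"
    then obtain p where p: "p \<in> D" "q \<in> ball p (r p)"
      using D(3) by blast
    have \<rho>: "\<rho> \<le> r p"
      using p(1) D(2) by (auto simp: \<rho>_def)
    have "q \<notin> \<Omega>"
      using q assms(1) by (auto simp: frontier_def interior_open)
    then obtain y where "ball y (r p * R) \<subseteq> cball q R - \<Omega>"
      using r p D(1) R order_trans[OF R(2) \<rho>] by blast
    moreover have "ball y (\<rho> * R) \<subseteq> ball y (r p * R)"
      using \<rho> R by (intro subset_ball mult_right_mono) auto
    ultimately show "\<exists>y. ball y (\<rho> * R) \<subseteq> cball q R - \<Omega>"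
      by blast
  qed
qed

text \<open>
  Apply the uniform version at a nearest boundary point of \<open>x\<close>. The scale must not exceed \<open>\<rho>\<close>, whereas
  the distance to the boundary is only bounded by the diameter; shrinking it by the fixed factor \<open>\<tau>\<close>
  makes one constant valid for all points of \<open>\<Omega>\<close>.
\<close>

lemma exterior_corkscrew:
  fixes \<Omega> :: "'a::euclidean_space set"
  assumes \<Omega>: "open \<Omega>" "bounded \<Omega>" "lipschitz_boundary \<Omega>"
  obtains \<kappa> where "0 < \<kappa>"
    "\<And>x. x \<in> \<Omega> \<Longrightarrow> \<exists>y. ball y (\<kappa> * infdist x (- \<Omega>)) \<subseteq> cball x (2 * infdist x (- \<Omega>)) - \<Omega>"
proof -
  obtain \<rho> where \<rho>: "0 < \<rho>"
    and cork: "\<And>q R. q \<in> frontier \<Omega> \<Longrightarrow> 0 < R \<Longrightarrow> R \<le> \<rho> \<Longrightarrow> \<exists>y. ball y (\<rho> * R) \<subseteq> cball q R - \<Omega>"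
    using uniform_exterior_corkscrew[OF \<Omega>] by metis
  obtain z where z: "z \<notin> \<Omega>"
    using \<Omega>(2) not_bounded_UNIV by (metis UNIV_eq_I)
  then have ne: "- \<Omega> \<noteq> {}" and cl: "closed (- \<Omega>)"
    using \<Omega>(1) by auto
  obtain M0 where M0: "\<And>x. x \<in> \<Omega> \<Longrightarrow> dist z x \<le> M0"
    using \<Omega>(2) bounded_any_center[of \<Omega> z] by auto
  define M where "M = max 1 M0"
  have M: "0 < M" by (simp add: M_def)
  \<comment> \<open>chosen such that \<open>\<tau> * d \<le> min d \<rho>\<close> for every distance \<open>d \<le> M\<close>\<close>
  define \<tau> where "\<tau> = min 1 (\<rho> / M)"
  have \<tau>: "0 < \<tau>" "\<tau> \<le> 1" "\<tau> * M \<le> \<rho>"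
    using \<rho> M by (auto simp: \<tau>_def min_def field_simps)
  show thesis
  proof (rule that)
    show "0 < \<rho> * \<tau>" using \<rho> \<tau> by simp
    fix x assume x: "x \<in> \<Omega>"
    define d where "d = infdist x (- \<Omega>)"
    have d: "0 < d"
      unfolding d_def using x by (intro infdist_pos_not_in_closed cl ne) simp
    obtain q where q: "q \<in> - \<Omega>" "d = dist x q"
      using infdist_attains_inf[OF cl ne, of x] unfolding d_def by auto
    have "ball x d \<subseteq> \<Omega>"
    proof
      fix y assume "y \<in> ball x d"
      then show "y \<in> \<Omega>"
        using infdist_le[of y "- \<Omega>" x] by (force simp: d_def)
    qed
    then have "cball x d \<subseteq> closure \<Omega>"
      using closure_mono[of "ball x d" \<Omega>] d by (simp add: closure_ball)
    then have "q \<in> frontier \<Omega>"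
      using q \<Omega>(1) by (auto simp: frontier_def interior_open)
    moreover have "d \<le> M"
      using infdist_le[of z "- \<Omega>" x] z M0[OF x] by (simp add: d_def M_def dist_commute)
    then have "\<tau> * d \<le> \<rho>"
      using \<tau> by (meson mult_left_mono less_imp_le order_trans)
    ultimately obtain y where y: "ball y (\<rho> * (\<tau> * d)) \<subseteq> cball q (\<tau> * d) - \<Omega>"
      using cork[of q "\<tau> * d"] \<tau> d by auto
    have "cball q (\<tau> * d) \<subseteq> cball x (2 * d)"
    proof -
      have "\<tau> * d \<le> d" using \<tau> d by simp
      then have "dist x y \<le> 2 * d" if "dist q y \<le> \<tau> * d" for y
        using q(2) dist_triangle[of x y q] that by simp
      then show ?thesis
        by auto
    qed
    with y show "\<exists>y. ball y (\<rho> * \<tau> * infdist x (- \<Omega>)) \<subseteq> cball x (2 * infdist x (- \<Omega>)) - \<Omega>"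
      unfolding d_def[symmetric] by (intro exI[of _ y]) (auto simp: mult.assoc)
  qed
qed

text \<open>
  At distance \<open>d\<close> from the boundary the corkscrew ball has volume of order \<open>d ^ n\<close> and lies within
  \<open>2 * d\<close> of \<open>x\<close>, where the kernel is at least of order \<open>d powr (- (n + s))\<close>.
\<close>

lemma exterior_kernel_bound:
  fixes \<Omega> :: "'a::euclidean_space set"
  assumes \<Omega>: "open \<Omega>" "bounded \<Omega>" "lipschitz_boundary \<Omega>" and s: "0 < s"
  obtains c where "0 < c"
    "\<And>x. x \<in> \<Omega> \<Longrightarrow> ennreal (c * infdist x (- \<Omega>) powr (- s))
       \<le> (\<integral>\<^sup>+ y. ennreal (kern s (x - y)) * indicator (- \<Omega>) y \<partial>lborel)"
proof -
  obtain \<kappa> where \<kappa>: "0 < \<kappa>" and cork: "\<And>x. x \<in> \<Omega> \<Longrightarrow> \<exists>y. ball y (\<kappa> * infdist x (- \<Omega>)) \<subseteq> cball x (2 * infdist x (- \<Omega>)) - \<Omega>"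
    using exterior_corkscrew[OF \<Omega>] by metis
  define n where "n = real DIM('a)"
  have n: "0 < n" by (simp add: n_def)
  define \<omega> where "\<omega> = unit_ball_vol n"
  have \<omega>: "0 < \<omega>" unfolding \<omega>_def by (rule unit_ball_vol_pos) (use n in simp)
  have [measurable]: "\<Omega> \<in> sets borel" using \<Omega>(1) by simp
  obtain z where "z \<notin> \<Omega>"
    using \<Omega>(2) not_bounded_UNIV by (metis UNIV_eq_I)
  then have ne: "- \<Omega> \<noteq> {}" and cl: "closed (- \<Omega>)"
    using \<Omega>(1) by auto
  define c where "c = 2 powr (- (n + s)) * \<omega> * \<kappa> powr n"
  show thesis
  proof (rule that)
    show "0 < c" using \<omega> \<kappa> by (simp add: c_def)
    fix x assume x: "x \<in> \<Omega>"
    define d where "d = infdist x (- \<Omega>)"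
    have d: "0 < d"
      unfolding d_def using x by (intro infdist_pos_not_in_closed cl ne) simp
    obtain y0 where y0: "ball y0 (\<kappa> * d) \<subseteq> cball x (2 * d) - \<Omega>"
      using cork[OF x] unfolding d_def by auto
    define q where "q = (2 * d) powr (- (n + s))"
    have "c * d powr (- s) = q * (\<omega> * (\<kappa> * d) ^ DIM('a))"
    proof -
      have "(\<kappa> * d) ^ DIM('a) = \<kappa> powr n * d powr n"
        using \<kappa> d by (simp add: n_def powr_realpow power_mult_distrib)
      moreover have "q = 2 powr (- (n + s)) * d powr (- (n + s))"
        using d by (simp add: q_def powr_mult)
      moreover have "d powr (- (n + s)) * d powr n = d powr (- s)"
        by (simp add: powr_add[symmetric])
      ultimately show ?thesis
        by (simp add: c_def mult_ac)
    qed
    then have "ennreal (c * d powr (- s)) = ennreal q * emeasure lborel (ball y0 (\<kappa> * d))"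
      using \<kappa> d \<omega> by (simp add: emeasure_ball ennreal_mult[symmetric] q_def \<omega>_def n_def)
    also have "\<dots> = (\<integral>\<^sup>+ y. ennreal q * indicator (ball y0 (\<kappa> * d)) y \<partial>lborel)"
      by (rule nn_integral_cmult_indicator[symmetric]) simp
    also have "\<dots> \<le> (\<integral>\<^sup>+ y. ennreal (kern s (x - y)) * indicator (- \<Omega>) y \<partial>lborel)"
    proof (intro nn_integral_mono)
      fix y
      show "ennreal q * indicator (ball y0 (\<kappa> * d)) y \<le> ennreal (kern s (x - y)) * indicator (- \<Omega>) y"
      proof (cases "y \<in> ball y0 (\<kappa> * d)")
        case True
        then have y: "y \<notin> \<Omega>" "norm (x - y) \<le> 2 * d"
          using y0 by (auto simp: dist_norm)
        then have "0 < norm (x - y)"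
          using x by auto
        then have "q \<le> norm (x - y) powr (- (n + s))"
          unfolding q_def using n s y(2) by (intro powr_mono2') auto
        also have "\<dots> = kern s (x - y)"
          unfolding kern_def n_def by (rule powr_minus_divide)
        finally show ?thesis
          using y(1) True by (simp add: ennreal_leI)
      qed simp
    qed
    finally show "ennreal (c * infdist x (- \<Omega>) powr (- s))
       \<le> (\<integral>\<^sup>+ y. ennreal (kern s (x - y)) * indicator (- \<Omega>) y \<partial>lborel)"
      by (simp only: d_def)
  qed
qed

text \<open>
  Interactions between \<open>F\<close> and the complement of \<open>\<Omega>\<close> alone already contribute the weighted integral to
  the energy of the indicator.
\<close>

lemma hardy_inequality_indicator:
  fixes \<Omega> :: "'a::euclidean_space set"
  assumes \<Omega>: "open \<Omega>" "bounded \<Omega>" "lipschitz_boundary \<Omega>" and s: "0 < s"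
  assumes F[measurable]: "F \<in> sets borel" and sub: "F \<subseteq> \<Omega>"
    and fin: "gagliardo s UNIV (indicator F) < \<infinity>"
  shows "(\<integral>\<^sup>+ x. ennreal (infdist x (- \<Omega>) powr (- s)) * indicator F x \<partial>lborel) < \<infinity>"
proof -
  obtain c where c: "0 < c" and *: "\<And>x. x \<in> \<Omega> \<Longrightarrow> ennreal (c * infdist x (- \<Omega>) powr (- s))
       \<le> (\<integral>\<^sup>+ y. ennreal (kern s (x - y)) * indicator (- \<Omega>) y \<partial>lborel)"
    using exterior_kernel_bound[OF \<Omega> s] by metis
  have [measurable]: "(\<lambda>x. infdist x (- \<Omega>)) \<in> borel_measurable borel"
    by (intro borel_measurable_continuous_onI continuous_on_infdist continuous_on_id)
  have "ennreal c * (\<integral>\<^sup>+ x. ennreal (infdist x (- \<Omega>) powr (- s)) * indicator F x \<partial>lborel)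
      = (\<integral>\<^sup>+ x. ennreal (c * infdist x (- \<Omega>) powr (- s)) * indicator F x \<partial>lborel)"
    using c by (subst nn_integral_cmult[symmetric]) (auto simp: ennreal_mult mult.assoc)
  also have "\<dots> \<le> (\<integral>\<^sup>+ x. \<integral>\<^sup>+ y. ennreal (\<bar>indicator F x - indicator F y\<bar> * kern s (x - y)) \<partial>lborel \<partial>lborel)"
  proof (intro nn_integral_mono)
    fix x
    show "ennreal (c * infdist x (- \<Omega>) powr (- s)) * indicator F x
       \<le> (\<integral>\<^sup>+ y. ennreal (\<bar>indicator F x - indicator F y\<bar> * kern s (x - y)) \<partial>lborel)"
    proof (cases "x \<in> F")
      case True
      have "ennreal (c * infdist x (- \<Omega>) powr (- s)) \<le> (\<integral>\<^sup>+ y. ennreal (kern s (x - y)) * indicator (- \<Omega>) y \<partial>lborel)"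
        using True sub by (intro *) auto
      also have "\<dots> \<le> (\<integral>\<^sup>+ y. ennreal (\<bar>indicator F x - indicator F y\<bar> * kern s (x - y)) \<partial>lborel)"
        using True sub by (intro nn_integral_mono) (auto simp: indicator_def)
      finally show ?thesis
        using True by simp
    qed simp
  qed
  also have "\<dots> = gagliardo s UNIV (indicator F)"
    by (rule gagliardo_iterated[symmetric]) simp
  finally have "ennreal c * (\<integral>\<^sup>+ x. ennreal (infdist x (- \<Omega>) powr (- s)) * indicator F x \<partial>lborel) < \<infinity>"
    using fin by (rule le_less_trans)
  then show ?thesis
    using c by (auto simp: ennreal_mult_less_top)
qed

section \<open>Cutting off near the boundary\<close>

lemma radial_integral:
  fixes a s :: real
  assumes a: "0 < a" and s: "0 < s" "s < 1"
  shows "(\<integral>\<^sup>+ t. ennreal (min 1 (a * t) * t powr (- 1 - s)) * indicator {0<..} t \<partial>lborel)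
    \<le> ennreal ((1 / (1 - s) + 1 / s) * a powr s)"
proof -
  let ?b = "1 / a"
  have b: "0 < ?b" using a by simp
  have "((\<lambda>t. a * t powr (- s)) has_integral a * (?b powr (- s + 1) / (- s + 1))) {0..?b}"
    by (intro has_integral_mult_right has_integral_powr_from_0) (use s b in auto)
  then have 1: "(\<integral>\<^sup>+ t. ennreal (indicator {0..?b} t * (a * t powr (- s))) \<partial>lborel)
      = ennreal (a * (?b powr (- s + 1) / (- s + 1)))"
    by (rule nn_integral_has_integral_lebesgue[rotated]) (use a in simp)
  have "((\<lambda>t. t powr (- 1 - s)) has_integral - (?b powr (- 1 - s + 1)) / (- 1 - s + 1)) {?b..}"
    by (intro has_integral_powr_to_inf) (use s b in auto)
  then have 2: "(\<integral>\<^sup>+ t. ennreal (indicator {?b..} t * t powr (- 1 - s)) \<partial>lborel)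
      = ennreal (- (?b powr (- 1 - s + 1)) / (- 1 - s + 1))"
    by (rule nn_integral_has_integral_lebesgue[rotated]) simp
  have "(\<integral>\<^sup>+ t. ennreal (min 1 (a * t) * t powr (- 1 - s)) * indicator {0<..} t \<partial>lborel)
     \<le> (\<integral>\<^sup>+ t. ennreal (indicator {0..?b} t * (a * t powr (- s))) + ennreal (indicator {?b..} t * t powr (- 1 - s)) \<partial>lborel)"
  proof (intro nn_integral_mono)
    fix t :: real
    show "ennreal (min 1 (a * t) * t powr (- 1 - s)) * indicator {0<..} t
      \<le> ennreal (indicator {0..?b} t * (a * t powr (- s))) + ennreal (indicator {?b..} t * t powr (- 1 - s))"
    proof (cases "0 < t")
      case True
      have eq: "a * t powr (- s) = a * t * t powr (- 1 - s)"
        using True powr_add[of t 1 "- 1 - s"] by simp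
      show ?thesis
      proof (cases "t \<le> ?b")
        case True
        have "min 1 (a * t) * t powr (- 1 - s) \<le> a * t powr (- s)"
          unfolding eq by (intro mult_right_mono) auto
        then show ?thesis
          using True \<open>0 < t\<close> by (intro add_increasing2) (auto simp: ennreal_leI)
      next
        case False
        have "min 1 (a * t) * t powr (- 1 - s) \<le> 1 * t powr (- 1 - s)"
          by (intro mult_right_mono) auto
        then show ?thesis
          using False \<open>0 < t\<close> by (intro add_increasing) (auto simp: ennreal_leI)
      qed
    qed simp
  qed
  also have "\<dots> = ennreal (a * (?b powr (- s + 1) / (- s + 1))) + ennreal (- (?b powr (- 1 - s + 1)) / (- 1 - s + 1))"
    by (subst nn_integral_add) (simp_all only: 1 2, measurable)
  also have "\<dots> = ennreal ((1 / (1 - s) + 1 / s) * a powr s)"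
  proof -
    have "?b powr (- s) = a powr s"
      using a by (simp add: powr_divide powr_minus)
    moreover have "a * ?b powr (- s + 1) = a powr s"
      using a b powr_add[of ?b "- s" 1] \<open>?b powr (- s) = a powr s\<close> by simp
    ultimately have "a * (?b powr (- s + 1) / (- s + 1)) + - (?b powr (- 1 - s + 1)) / (- 1 - s + 1)
       = (1 / (1 - s) + 1 / s) * a powr s"
      by (simp add: algebra_simps)
    moreover have "0 \<le> a * (?b powr (- s + 1) / (- s + 1))" "0 \<le> - (?b powr (- 1 - s + 1)) / (- 1 - s + 1)"
      using a s by auto
    ultimately show ?thesis
      by (metis ennreal_plus)
  qed
  finally show ?thesis .
qed

text \<open>
  A substitute for polar coordinates: the kernel at \<open>z\<close> is estimated by an integral over radii
  \<open>t \<ge> norm z\<close>, of which only \<open>norm z \<le> t \<le> 2 * norm z\<close> is used. After Tonelli the inner integral over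
  \<open>z\<close> is just the volume of a ball of radius \<open>t\<close>.
\<close>

lemma truncated_kernel_radial:
  fixes z :: "'a::euclidean_space"
  assumes a: "0 < a" and s: "0 < s" and z: "z \<noteq> 0"
  shows "ennreal (min 1 (a * norm z) * kern s z)
    \<le> ennreal (2 powr (real DIM('a) + s + 1)) *
      (\<integral>\<^sup>+ t. ennreal (min 1 (a * t) * t powr (- real DIM('a) - s - 1)) * indicator {norm z..} t \<partial>lborel)"
proof -
  define r where "r = norm z"
  define n where "n = real DIM('a)"
  have r: "0 < r" using z by (simp add: r_def)
  have n: "0 < n" by (simp add: n_def)
  let ?q = "min 1 (a * r) * (2 * r) powr (- n - s - 1)"
  have "min 1 (a * r) * kern s z = 2 powr (n + s + 1) * (?q * r)"
  proof -
    have "kern s z = r powr (- n - s)"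
      using powr_minus_divide[of r "n + s"] by (simp add: kern_def r_def n_def)
    also have "\<dots> = r powr (- n - s - 1) * r"
      using r powr_add[of r "- n - s - 1" 1] by simp
    moreover have "2 powr (n + s + 1) * 2 powr (- n - s - 1) = (1::real)"
      by (simp add: powr_add[symmetric])
    then have "2 powr (n + s + 1) * (2 * r) powr (- n - s - 1) = r powr (- n - s - 1)"
      using r by (simp add: powr_mult mult.assoc[symmetric])
    ultimately show ?thesis
      by (simp add: mult_ac)
  qed
  then have "ennreal (min 1 (a * r) * kern s z) = ennreal (2 powr (n + s + 1)) * (ennreal ?q * ennreal r)"
    using a r by (simp only: ennreal_mult[symmetric]) (simp add: ennreal_mult[symmetric])
  moreover have "ennreal ?q * ennreal r = (\<integral>\<^sup>+ t. ennreal ?q * indicator {r..2 * r} t \<partial>lborel)"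
    using r by (subst nn_integral_cmult_indicator) auto
  moreover have "\<dots> \<le> (\<integral>\<^sup>+ t. ennreal (min 1 (a * t) * t powr (- n - s - 1)) * indicator {norm z..} t \<partial>lborel)"
  proof (intro nn_integral_mono)
    fix t
    show "ennreal ?q * indicator {r..2 * r} t \<le> ennreal (min 1 (a * t) * t powr (- n - s - 1)) * indicator {norm z..} t"
    proof (cases "t \<in> {r..2 * r}")
      case True
      then have "min 1 (a * r) \<le> min 1 (a * t)"
        using a by (intro min.mono) auto
      moreover have "(2 * r) powr (- n - s - 1) \<le> t powr (- n - s - 1)"
        using True r n s by (intro powr_mono2') auto
      ultimately have "?q \<le> min 1 (a * t) * t powr (- n - s - 1)"
        using a r True by (intro mult_mono) auto
      then show ?thesis
        using True by (simp add: r_def ennreal_leI)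
    qed simp
  qed
  ultimately show ?thesis
    unfolding n_def r_def by (simp only: mult_left_mono zero_le)
qed

definition trunc_kern_const :: "'a::euclidean_space itself \<Rightarrow> real \<Rightarrow> real" where
  "trunc_kern_const _ s = 2 powr (real DIM('a) + s + 1) * unit_ball_vol (real DIM('a)) * (1 / (1 - s) + 1 / s)"

text \<open>
  Truncation by \<open>min 1 (a * norm z)\<close> gives integrability at the origin because \<open>s < 1\<close>; at infinity
  \<open>s > 0\<close> suffices. The power \<open>a powr s\<close> is dictated by scaling.
\<close>

lemma truncated_kernel_integral:
  fixes a s :: real
  assumes a: "0 < a" and s: "0 < s" "s < 1"
  shows "(\<integral>\<^sup>+ z. ennreal (min 1 (a * norm z) * kern s z) \<partial>(lborel :: 'a::euclidean_space measure))
    \<le> ennreal (trunc_kern_const TYPE('a) s * a powr s)"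
proof -
  define n where "n = real DIM('a)"
  have n: "0 < n" by (simp add: n_def)
  define \<omega> where "\<omega> = unit_ball_vol n"
  have \<omega>: "0 < \<omega>" unfolding \<omega>_def by (rule unit_ball_vol_pos) (use n in simp)
  define c where "c = 2 powr (n + s + 1)"
  have c: "0 < c" by (simp add: c_def)
  let ?h = "\<lambda>t. min 1 (a * t) * t powr (- n - s - 1)"
  have sets: "{p :: 'a \<times> real. norm (fst p) \<le> snd p} \<in> sets borel"
    by measurable
  have [measurable]: "(\<lambda>p :: 'a \<times> real. indicator {norm (fst p)..} (snd p) :: ennreal) \<in> borel_measurable borel"
    using borel_measurable_indicator[OF sets] by (simp add: indicator_def[abs_def])
  have "(\<integral>\<^sup>+ z. ennreal (min 1 (a * norm z) * kern s z) \<partial>(lborel :: 'a measure))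
     \<le> (\<integral>\<^sup>+ z. (\<integral>\<^sup>+ t. ennreal c * (ennreal (?h t) * (indicator {norm z..} t * indicator {0<..} t)) \<partial>lborel) \<partial>(lborel :: 'a measure))"
  proof (intro nn_integral_mono)
    fix z :: 'a
    show "ennreal (min 1 (a * norm z) * kern s z)
      \<le> (\<integral>\<^sup>+ t. ennreal c * (ennreal (?h t) * (indicator {norm z..} t * indicator {0<..} t)) \<partial>lborel)"
    proof (cases "z = 0")
      case False
      then have "ennreal (min 1 (a * norm z) * kern s z)
         \<le> ennreal c * (\<integral>\<^sup>+ t. ennreal (?h t) * indicator {norm z..} t \<partial>lborel)"
        unfolding c_def n_def by (intro truncated_kernel_radial a s)
      also have "(\<integral>\<^sup>+ t. ennreal (?h t) * indicator {norm z..} t \<partial>lborel)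
         = (\<integral>\<^sup>+ t. ennreal (?h t) * (indicator {norm z..} t * indicator {0<..} t) \<partial>lborel)"
      proof (intro nn_integral_cong)
        fix t
        have "0 < t" if "norm z \<le> t"
          using that False by (meson less_le_trans zero_less_norm_iff)
        then show "ennreal (?h t) * indicator {norm z..} t = ennreal (?h t) * (indicator {norm z..} t * indicator {0<..} t)"
          by (auto simp: indicator_def)
      qed
      also have "ennreal c * \<dots> = (\<integral>\<^sup>+ t. ennreal c * (ennreal (?h t) * (indicator {norm z..} t * indicator {0<..} t)) \<partial>lborel)"
        by (rule nn_integral_cmult[symmetric]) measurable
      finally show ?thesis .
    qed simp
  qed
  also have "\<dots> = (\<integral>\<^sup>+ t. (\<integral>\<^sup>+ z. ennreal c * (ennreal (?h t) * (indicator {norm z..} t * indicator {0<..} t)) \<partial>(lborel :: 'a measure)) \<partial>lborel)"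
    by (rule lborel_pair.Fubini'[symmetric]) (simp add: split_beta lborel_prod)
  also have "\<dots> = (\<integral>\<^sup>+ t. ennreal (c * \<omega>) * (ennreal (min 1 (a * t) * t powr (- 1 - s)) * indicator {0<..} t) \<partial>lborel)"
  proof (intro nn_integral_cong)
    fix t :: real
    show "(\<integral>\<^sup>+ z. ennreal c * (ennreal (?h t) * (indicator {norm z..} t * indicator {0<..} t)) \<partial>(lborel :: 'a measure))
       = ennreal (c * \<omega>) * (ennreal (min 1 (a * t) * t powr (- 1 - s)) * indicator {0<..} t)"
    proof (cases "0 < t")
      case True
      have "(\<integral>\<^sup>+ z. ennreal c * (ennreal (?h t) * (indicator {norm z..} t * indicator {0<..} t)) \<partial>(lborel :: 'a measure))
         = (\<integral>\<^sup>+ z. ennreal (c * ?h t) * indicator (cball 0 t) z \<partial>(lborel :: 'a measure))"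
        using True a c by (intro nn_integral_cong) (auto simp: indicator_def ennreal_mult)
      also have "\<dots> = ennreal (c * ?h t) * emeasure lborel (cball (0::'a) t)"
        by (rule nn_integral_cmult_indicator) simp
      also have "\<dots> = ennreal (c * ?h t * (\<omega> * t powr n))"
        using True a c \<omega> by (simp add: emeasure_cball \<omega>_def n_def powr_realpow ennreal_mult)
      also have "c * ?h t * (\<omega> * t powr n) = (c * \<omega>) * (min 1 (a * t) * (t powr (- n - s - 1) * t powr n))"
        by simp
      also have "t powr (- n - s - 1) * t powr n = t powr (- 1 - s)"
        by (simp add: powr_add[symmetric] add.commute minus_diff_commute)
      finally show ?thesis
        using True a c \<omega> by (simp add: ennreal_mult)
    qed simp
  qed
  also have "\<dots> = ennreal (c * \<omega>) * (\<integral>\<^sup>+ t. ennreal (min 1 (a * t) * t powr (- 1 - s)) * indicator {0<..} t \<partial>lborel)"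
    by (rule nn_integral_cmult) measurable
  also have "\<dots> \<le> ennreal (c * \<omega>) * ennreal ((1 / (1 - s) + 1 / s) * a powr s)"
    by (intro mult_left_mono radial_integral a s) simp
  also have "\<dots> = ennreal (trunc_kern_const TYPE('a) s * a powr s)"
    using c \<omega> s by (simp add: trunc_kern_const_def c_def \<omega>_def n_def ennreal_mult[symmetric] mult.assoc)
  finally show ?thesis .
qed

lemma nn_integral_lborel_reflect_translate:
  fixes h :: "'a::euclidean_space \<Rightarrow> ennreal"
  assumes [measurable]: "h \<in> borel_measurable borel"
  shows "(\<integral>\<^sup>+ y. h (x - y) \<partial>lborel) = (\<integral>\<^sup>+ z. h z \<partial>lborel)"
proof -
  have "lborel = distr lborel borel (\<lambda>y. x - y)"
    using lborel_affine[of "-1" x] by (simp add: density_1)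
  then have "(\<integral>\<^sup>+ z. h z \<partial>lborel) = (\<integral>\<^sup>+ z. h z \<partial>distr lborel borel (\<lambda>y. x - y))"
    by (rule arg_cong[where f = "\<lambda>M. integral\<^sup>N M h"])
  also have "\<dots> = (\<integral>\<^sup>+ y. h (x - y) \<partial>lborel)"
    by (rule nn_integral_distr) simp_all
  finally show ?thesis ..
qed

text \<open>
  A Lipschitz cutoff at scale \<open>1 / k\<close>: zero at distance at most \<open>1 / k\<close> from \<open>S\<close>, one from distance
  \<open>2 / k\<close> on.
\<close>

definition cutoff :: "'a::metric_space set \<Rightarrow> nat \<Rightarrow> 'a \<Rightarrow> real" where
  "cutoff S k x = min 1 (max 0 (real k * infdist x S - 1))"

lemma cutoff_bounds [simp]: "0 \<le> cutoff S k x" "cutoff S k x \<le> 1"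
  by (auto simp: cutoff_def)

lemma cutoff_measurable [measurable]: "cutoff S k \<in> borel_measurable borel"
proof -
  have [measurable]: "(\<lambda>x. infdist x S) \<in> borel_measurable borel"
    by (intro borel_measurable_continuous_onI continuous_on_infdist continuous_on_id)
  show ?thesis
    unfolding cutoff_def[abs_def] by measurable
qed

text \<open>
  The bound does not depend on \<open>k\<close>. For \<open>k * d \<le> 4\<close> the Lipschitz constant \<open>k\<close> is at most \<open>4 / d\<close>.
  Otherwise the cutoff is \<open>1\<close> at \<open>x\<close>, and a point \<open>y\<close> where it is not \<open>1\<close> has distance at least \<open>d / 2\<close>
  from \<open>x\<close>.
\<close>

lemma cutoff_diff:
  assumes "0 < infdist x S"
  shows "\<bar>cutoff S k x - cutoff S k y\<bar> \<le> min 1 (4 / infdist x S * dist x y)"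
proof -
  let ?d = "infdist x S"
  have tri: "\<bar>?d - infdist y S\<bar> \<le> dist x y"
    by (rule infdist_triangle_abs)
  have "\<bar>cutoff S k x - cutoff S k y\<bar> \<le> 4 / ?d * dist x y"
  proof (cases "real k * ?d \<le> 4")
    case True
    then have k: "real k \<le> 4 / ?d"
      using assms by (simp add: field_simps)
    have "\<bar>cutoff S k x - cutoff S k y\<bar> \<le> \<bar>real k * ?d - real k * infdist y S\<bar>"
      unfolding cutoff_def by linarith
    also have "\<dots> = real k * \<bar>?d - infdist y S\<bar>"
      by (simp add: abs_mult flip: right_diff_distrib)
    also have "\<dots> \<le> 4 / ?d * dist x y"
      using k tri assms by (intro mult_mono) auto
    finally show ?thesis .
  next
    case False
    then have x1: "cutoff S k x = 1"
      by (simp add: cutoff_def)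
    show ?thesis
    proof (cases "cutoff S k y = 1")
      case True
      then show ?thesis using x1 assms by simp
    next
      case y1: False
      then have "real k * infdist y S < 2"
        by (auto simp: cutoff_def)
      then have "real k * infdist y S < real k * (?d / 2)"
        using False by simp
      then have "infdist y S < ?d / 2"
        by (rule mult_left_less_imp_less) simp
      then have "?d / 2 \<le> dist x y"
        using tri by linarith
      then have "1 \<le> 4 / ?d * dist x y"
        using assms by (simp add: field_simps)
      moreover have "\<bar>cutoff S k x - cutoff S k y\<bar> \<le> 1"
        unfolding cutoff_def by linarith
      ultimately show ?thesis by linarith
    qed
  qed
  moreover have "\<bar>cutoff S k x - cutoff S k y\<bar> \<le> 1"
    unfolding cutoff_def by linarith
  ultimately show ?thesis by simp
qed

lemma cutoff_tendsto:
  assumes "0 < infdist x S"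
  shows "(\<lambda>k. cutoff S k x) \<longlonglongrightarrow> 1"
proof (rule tendsto_eventually)
  obtain K :: nat where K: "2 / infdist x S < real K"
    using reals_Archimedean2 by blast
  show "\<forall>\<^sub>F k in sequentially. cutoff S k x = 1"
    using eventually_ge_at_top[of K]
  proof eventually_elim
    case (elim k)
    then have "2 / infdist x S \<le> real k" using K by linarith
    then have "2 \<le> real k * infdist x S"
      using assms by (simp add: field_simps)
    then show ?case by (simp add: cutoff_def)
  qed
qed

text \<open>
  Only pairs with both points in \<open>F\<close> contribute to the error \<open>e k\<close>: if exactly one point lies in \<open>F\<close>,
  the cutoff can only decrease the difference. On \<open>F\<close> the cutoffs tend to \<open>1\<close>, and the \<open>k\<close>-independent
  majorant from \<open>cutoff_diff\<close> is integrable by the kernel estimate and the Hardy inequality.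
\<close>

lemma cutoff_energy_tendsto:
  fixes \<Omega> :: "'a::euclidean_space set"
  assumes \<Omega>: "open \<Omega>" "bounded \<Omega>" "lipschitz_boundary \<Omega>" and s: "0 < s" "s < 1"
  assumes F[measurable]: "F \<in> sets borel" and sub: "F \<subseteq> \<Omega>"
    and fin: "gagliardo s UNIV (indicator F) < \<infinity>"
  defines "e \<equiv> \<lambda>k. \<integral>\<^sup>+ p. ennreal (indicator F (fst p) * indicator F (snd p) *
      \<bar>cutoff (- \<Omega>) k (fst p) - cutoff (- \<Omega>) k (snd p)\<bar> * kern s (fst p - snd p)) \<partial>lborel"
  shows "e \<longlonglongrightarrow> 0"
    and "gagliardo s UNIV (\<lambda>x. indicator F x * cutoff (- \<Omega>) k x) \<le> gagliardo s UNIV (indicator F) + e k"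
proof -
  let ?d = "\<lambda>x. infdist x (- \<Omega>)"
  let ?\<eta> = "cutoff (- \<Omega>)"
  let ?w = "\<lambda>p::'a \<times> 'a. indicator F (fst p) * min 1 (4 / ?d (fst p) * norm (fst p - snd p)) * kern s (fst p - snd p)"
  obtain z where "z \<notin> \<Omega>"
    using \<Omega>(2) not_bounded_UNIV by (metis UNIV_eq_I)
  then have ne: "- \<Omega> \<noteq> {}" and cl: "closed (- \<Omega>)"
    using \<Omega>(1) by auto
  have d_pos: "0 < ?d x" if "x \<in> F" for x
    using that sub by (intro infdist_pos_not_in_closed cl ne) auto
  have [measurable]: "?d \<in> borel_measurable borel"
    by (intro borel_measurable_continuous_onI continuous_on_infdist continuous_on_id)
  have w_fin: "(\<integral>\<^sup>+ p. ennreal (?w p) \<partial>lborel) < \<infinity>"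
  proof -
    have "(\<integral>\<^sup>+ p. ennreal (?w p) \<partial>lborel) = (\<integral>\<^sup>+ x. \<integral>\<^sup>+ y. ennreal (?w (x, y)) \<partial>lborel \<partial>lborel)"
      unfolding lborel_prod[symmetric] by (subst lborel.nn_integral_fst[symmetric]) auto
    also have "\<dots> \<le> (\<integral>\<^sup>+ x. ennreal (trunc_kern_const TYPE('a) s * 4 powr s) * (ennreal (?d x powr (- s)) * indicator F x) \<partial>lborel)"
    proof (intro nn_integral_mono)
      fix x :: 'a
      show "(\<integral>\<^sup>+ y. ennreal (?w (x, y)) \<partial>lborel) \<le> ennreal (trunc_kern_const TYPE('a) s * 4 powr s) * (ennreal (?d x powr (- s)) * indicator F x)"
      proof (cases "x \<in> F")
        case True
        have "(\<integral>\<^sup>+ y. ennreal (?w (x, y)) \<partial>lborel) = (\<integral>\<^sup>+ y. ennreal (min 1 (4 / ?d x * norm (x - y)) * kern s (x - y)) \<partial>lborel)"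
          using True by simp
        also have "\<dots> = (\<integral>\<^sup>+ z. ennreal (min 1 (4 / ?d x * norm z) * kern s z) \<partial>(lborel :: 'a measure))"
          by (rule nn_integral_lborel_reflect_translate) measurable
        also have "\<dots> \<le> ennreal (trunc_kern_const TYPE('a) s * (4 / ?d x) powr s)"
          using d_pos[OF True] s by (intro truncated_kernel_integral) auto
        also have "trunc_kern_const TYPE('a) s * (4 / ?d x) powr s = trunc_kern_const TYPE('a) s * 4 powr s * ?d x powr (- s)"
          using d_pos[OF True] by (simp add: powr_divide powr_minus_divide)
        finally show ?thesis
          using True by (simp add: ennreal_mult'')
      qed simp
    qed
    also have "\<dots> = ennreal (trunc_kern_const TYPE('a) s * 4 powr s) * (\<integral>\<^sup>+ x. ennreal (?d x powr (- s)) * indicator F x \<partial>lborel)"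
      by (rule nn_integral_cmult) measurable
    also have "\<dots> < \<infinity>"
      using hardy_inequality_indicator[OF \<Omega> s(1) F sub fin] by (simp add: ennreal_mult_less_top)
    finally show ?thesis .
  qed
  show "e \<longlonglongrightarrow> 0"
  proof -
    have "e \<longlonglongrightarrow> (\<integral>\<^sup>+ p. 0 \<partial>(lborel :: ('a \<times> 'a) measure))"
      unfolding e_def
    proof (rule nn_integral_dominated_convergence[where w = "\<lambda>p. ennreal (?w p)"])
      show "AE p in lborel. ennreal (indicator F (fst p) * indicator F (snd p) * \<bar>?\<eta> k (fst p) - ?\<eta> k (snd p)\<bar> * kern s (fst p - snd p))
          \<le> ennreal (?w p)" for k
      proof (intro AE_I2 ennreal_leI mult_right_mono)
        fix p :: "'a \<times> 'a"
        have "\<bar>?\<eta> k (fst p) - ?\<eta> k (snd p)\<bar> \<le> min 1 (4 / ?d (fst p) * norm (fst p - snd p))" if "fst p \<in> F"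
          using cutoff_diff[OF d_pos[OF that]] by (simp only: dist_norm)
        then show "indicator F (fst p) * indicator F (snd p) * \<bar>?\<eta> k (fst p) - ?\<eta> k (snd p)\<bar>
           \<le> indicator F (fst p) * min 1 (4 / ?d (fst p) * norm (fst p - snd p))"
          using infdist_nonneg[of "fst p" "- \<Omega>"] by (auto simp: indicator_def)
      qed simp
      show "AE p in lborel. (\<lambda>k. ennreal (indicator F (fst p) * indicator F (snd p) * \<bar>?\<eta> k (fst p) - ?\<eta> k (snd p)\<bar> * kern s (fst p - snd p))) \<longlonglongrightarrow> 0"
      proof (rule AE_I2)
        fix p :: "'a \<times> 'a"
        show "(\<lambda>k. ennreal (indicator F (fst p) * indicator F (snd p) * \<bar>?\<eta> k (fst p) - ?\<eta> k (snd p)\<bar> * kern s (fst p - snd p))) \<longlonglongrightarrow> 0"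
        proof (cases "fst p \<in> F \<and> snd p \<in> F")
          case True
          then have "(\<lambda>k. \<bar>?\<eta> k (fst p) - ?\<eta> k (snd p)\<bar>) \<longlonglongrightarrow> \<bar>1 - 1\<bar>"
            by (intro tendsto_rabs tendsto_diff cutoff_tendsto d_pos) auto
          then have "(\<lambda>k. ennreal (\<bar>?\<eta> k (fst p) - ?\<eta> k (snd p)\<bar> * kern s (fst p - snd p))) \<longlonglongrightarrow> ennreal (\<bar>1 - 1\<bar> * kern s (fst p - snd p))"
            by (intro tendsto_ennrealI tendsto_mult tendsto_const)
          then show ?thesis
            using True by simp
        qed (auto simp: indicator_def)
      qed
    qed (use w_fin in simp_all)
    then show ?thesis by simp
  qed
  show "gagliardo s UNIV (\<lambda>x. indicator F x * ?\<eta> k x) \<le> gagliardo s UNIV (indicator F) + e k"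
  proof -
    have "gagliardo s UNIV (\<lambda>x. indicator F x * ?\<eta> k x)
       \<le> (\<integral>\<^sup>+ p. ennreal (\<bar>indicator F (fst p) - indicator F (snd p)\<bar> * kern s (fst p - snd p))
           + ennreal (indicator F (fst p) * indicator F (snd p) * \<bar>?\<eta> k (fst p) - ?\<eta> k (snd p)\<bar> * kern s (fst p - snd p)) \<partial>lborel)"
      unfolding gagliardo_UNIV
    proof (intro nn_integral_mono)
      fix p :: "'a \<times> 'a"
      let ?a = "\<bar>indicator F (fst p) - indicator F (snd p) :: real\<bar>"
      let ?b = "indicator F (fst p) * indicator F (snd p) * \<bar>?\<eta> k (fst p) - ?\<eta> k (snd p)\<bar>"
      have "\<bar>indicator F (fst p) * ?\<eta> k (fst p) - indicator F (snd p) * ?\<eta> k (snd p)\<bar> \<le> ?a + ?b"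
        by (cases "fst p \<in> F"; cases "snd p \<in> F") simp_all
      then have "\<bar>indicator F (fst p) * ?\<eta> k (fst p) - indicator F (snd p) * ?\<eta> k (snd p)\<bar> * kern s (fst p - snd p)
        \<le> ?a * kern s (fst p - snd p) + ?b * kern s (fst p - snd p)"
        unfolding distrib_right[symmetric] by (rule mult_right_mono) simp
      then show "ennreal (\<bar>indicator F (fst p) * ?\<eta> k (fst p) - indicator F (snd p) * ?\<eta> k (snd p)\<bar> * kern s (fst p - snd p))
        \<le> ennreal (?a * kern s (fst p - snd p)) + ennreal (?b * kern s (fst p - snd p))"
        by (subst ennreal_plus[symmetric]) (simp_all only: ennreal_leI mult_nonneg_nonneg indicator_pos_le abs_ge_zero kern_nonneg)
    qed
    also have "\<dots> = gagliardo s UNIV (indicator F) + e k"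
      unfolding gagliardo_UNIV e_def by (rule nn_integral_add) measurable
    finally show ?thesis .
  qed
qed

section \<open>Smooth compactly supported mollifiers\<close>

definition flat :: "nat \<Rightarrow> real \<Rightarrow> real" where
  "flat m t = (if 0 < t then exp (- 1 / t) / t ^ m else 0)"

lemma flat_div_tendsto_0: "((\<lambda>t. flat m t / t) \<longlongrightarrow> 0) (at 0)"
  unfolding filterlim_at_split
proof
  show "((\<lambda>t. flat m t / t) \<longlongrightarrow> 0) (at_left 0)"
    by (rule tendsto_eventually) (auto simp: eventually_at_filter flat_def)
  have "((\<lambda>t::real. inverse t ^ Suc m / exp (inverse t)) \<longlongrightarrow> 0) (at_right 0)"
    by (rule filterlim_compose[OF tendsto_power_div_exp_0 filterlim_inverse_at_top_right])
  then show "((\<lambda>t. flat m t / t) \<longlongrightarrow> 0) (at_right 0)"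
    by (rule Lim_transform_eventually)
      (auto simp: eventually_at_filter flat_def exp_minus field_simps intro!: always_eventually)
qed

lemma flat_derivative:
  "(flat m has_real_derivative (flat (Suc (Suc m)) t - real m * flat (Suc m) t)) (at t)"
proof -
  consider "t < 0" | "t = 0" | "0 < t" by linarith
  then show ?thesis
  proof cases
    case 1
    have "((\<lambda>_. 0) has_real_derivative 0) (at t)" by simp
    then have "(flat m has_real_derivative 0) (at t)"
      by (rule has_field_derivative_transform_within_open[of _ _ _ "{..<0}"]) (use 1 in \<open>auto simp: flat_def\<close>)
    then show ?thesis using 1 by (simp add: flat_def)
  next
    case 2
    then show ?thesis
      using flat_div_tendsto_0[of m] by (simp add: DERIV_def flat_def)
  next
    case 3
    have "((\<lambda>t. exp (- 1 / t) / t ^ m) has_real_derivative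
        (flat (Suc (Suc m)) t - real m * flat (Suc m) t)) (at t)"
      using 3
      by (auto intro!: derivative_eq_intros simp: flat_def field_simps power_Suc[symmetric] simp del: power_Suc)
         (cases m; simp add: field_simps)
    then show ?thesis
      by (rule has_field_derivative_transform_within_open[of _ _ _ "{0<..}"]) (use 3 in \<open>auto simp: flat_def\<close>)
  qed
qed

text \<open>
  A class of functions supported in the ball of squared radius \<open>r\<close> that is closed under directional
  derivatives: a derivative of \<open>flat m (r - x \<bullet> x)\<close> is a combination of functions of the same form
  multiplied by a linear coordinate. Smoothness of all orders then follows by a plain induction.
\<close>

inductive bump :: "real \<Rightarrow> ('a::euclidean_space \<Rightarrow> real) \<Rightarrow> bool" for r where
  base: "bump r (\<lambda>x. flat m (r - x \<bullet> x))"
| add: "bump r f \<Longrightarrow> bump r g \<Longrightarrow> bump r (\<lambda>x. f x + g x)"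
| coord: "bump r f \<Longrightarrow> bump r (\<lambda>x. (x \<bullet> v) * f x)"
| scale: "bump r f \<Longrightarrow> bump r (\<lambda>x. c * f x)"

lemma bump_support: "bump r f \<Longrightarrow> r \<le> x \<bullet> x \<Longrightarrow> f x = 0"
  by (induction rule: bump.induct) (auto simp: flat_def)

lemma bump_derivative:
  "bump r f \<Longrightarrow> \<exists>D. (\<forall>x. (f has_derivative D x) (at x)) \<and> (\<forall>w. bump r (\<lambda>x. D x w))"
proof (induction rule: bump.induct)
  case (base m)
  let ?g = "\<lambda>x::'a. flat (Suc (Suc m)) (r - x \<bullet> x) + - real m * flat (Suc m) (r - x \<bullet> x)"
  have "((\<lambda>x. flat m (r - x \<bullet> x)) has_derivative (\<lambda>w. (x \<bullet> w) * (- 2 * ?g x))) (at x)" for x :: 'a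
  proof -
    have "((\<lambda>x::'a. r - x \<bullet> x) has_derivative (\<lambda>w. - 2 * (x \<bullet> w))) (at x)"
      by (auto intro!: derivative_eq_intros simp: inner_commute)
    from has_derivative_compose[OF this flat_derivative[unfolded has_field_derivative_def]]
    show ?thesis
      by (simp add: algebra_simps)
  qed
  moreover have "bump r (\<lambda>x. (x \<bullet> w) * (- 2 * ?g x))" for w :: 'a
    by (intro bump.intros)
  ultimately show ?case
    by (intro exI[of _ "\<lambda>x w. (x \<bullet> w) * (- 2 * ?g x)"]) blast
next
  case (add f g)
  then obtain Df Dg where "\<And>x. (f has_derivative Df x) (at x)" "\<And>w. bump r (\<lambda>x. Df x w)"
    "\<And>x. (g has_derivative Dg x) (at x)" "\<And>w. bump r (\<lambda>x. Dg x w)"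
    by blast
  then show ?case
    by (intro exI[of _ "\<lambda>x w. Df x w + Dg x w"]) (auto intro: has_derivative_add bump.add)
next
  case (coord f v)
  then obtain D where D: "\<And>x. (f has_derivative D x) (at x)" "\<And>w. bump r (\<lambda>x. D x w)"
    by blast
  have "((\<lambda>x. (x \<bullet> v) * f x) has_derivative (\<lambda>w. (x \<bullet> v) * D x w + (w \<bullet> v) * f x)) (at x)" for x
    by (rule has_derivative_mult[OF _ D(1)]) (auto intro!: derivative_eq_intros)
  moreover have "bump r (\<lambda>x. (x \<bullet> v) * D x w + (w \<bullet> v) * f x)" for w
    by (intro bump.intros D(2) coord)
  ultimately show ?case
    by (intro exI[of _ "\<lambda>x w. (x \<bullet> v) * D x w + (w \<bullet> v) * f x"]) blast
next
  case (scale f c)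
  then obtain D where D: "\<And>x. (f has_derivative D x) (at x)" "\<And>w. bump r (\<lambda>x. D x w)"
    by blast
  then show ?case
    by (intro exI[of _ "\<lambda>x w. c * D x w"]) (auto intro: has_derivative_mult_right bump.scale)
qed

lemma bump_continuous: "bump r f \<Longrightarrow> continuous_on UNIV f"
  using bump_derivative by (metis continuous_at_imp_continuous_on has_derivative_continuous)

lemma bump_measurable: "bump r f \<Longrightarrow> f \<in> borel_measurable borel"
  by (rule borel_measurable_continuous_onI[OF bump_continuous])

lemma bump_bounded:
  fixes f :: "'a::euclidean_space \<Rightarrow> real"
  assumes "bump r f"
  obtains M where "0 \<le> M" "\<And>x. \<bar>f x\<bar> \<le> M"
proof -
  have "compact (f ` cball 0 (1 + \<bar>r\<bar>))"
    by (intro compact_continuous_image continuous_on_subset[OF bump_continuous[OF assms]]) auto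
  then have "bounded (f ` cball 0 (1 + \<bar>r\<bar>))"
    by (rule compact_imp_bounded)
  then obtain M where M: "\<And>x. x \<in> cball 0 (1 + \<bar>r\<bar>) \<Longrightarrow> \<bar>f x\<bar> \<le> M"
    unfolding bounded_iff by (metis image_eqI real_norm_def)
  have "\<bar>f x\<bar> \<le> \<bar>M\<bar>" for x
  proof (cases "norm x \<le> 1 + \<bar>r\<bar>")
    case True
    then show ?thesis using M[of x] by simp
  next
    case False
    have "r \<le> (1 + \<bar>r\<bar>)\<^sup>2"
      using self_le_power[of "1 + \<bar>r\<bar>" 2] by simp
    also have "\<dots> \<le> (norm x)\<^sup>2"
      using False by (intro power_mono) auto
    finally have "f x = 0"
      using bump_support[OF assms, of x] by (simp add: dot_square_norm)
    then show ?thesis by simp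
  qed
  then show thesis using that[of "\<bar>M\<bar>"] by simp
qed

lemma bump_lipschitz:
  fixes f :: "'a::euclidean_space \<Rightarrow> real"
  assumes D: "\<And>x. (f has_derivative D x) (at x)" "\<And>w. bump r (\<lambda>x. D x w)"
  obtains M where "0 \<le> M" "\<And>x h. \<bar>D x h\<bar> \<le> M * norm h" "\<And>x h. \<bar>f (x + h) - f x\<bar> \<le> M * norm h"
proof -
  have "\<forall>b::'a. \<exists>M. 0 \<le> M \<and> (\<forall>x. \<bar>D x b\<bar> \<le> M)"
    using bump_bounded[OF D(2)] by metis
  then obtain B where B: "\<And>b. 0 \<le> B b" "\<And>b x. \<bar>D x b\<bar> \<le> B b"
    by metis
  define M where "M = (\<Sum>b\<in>Basis. B b)"
  have DM: "\<bar>D x h\<bar> \<le> M * norm h" for x h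
  proof -
    interpret bounded_linear "D x" by (rule has_derivative_bounded_linear[OF D(1)])
    have "D x h = D x (\<Sum>b\<in>Basis. (h \<bullet> b) *\<^sub>R b)"
      by (simp add: euclidean_representation)
    also have "\<dots> = (\<Sum>b\<in>Basis. (h \<bullet> b) * D x b)"
      by (simp add: sum scaleR)
    also have "\<bar>\<dots>\<bar> \<le> (\<Sum>b\<in>Basis. \<bar>(h \<bullet> b) * D x b\<bar>)"
      by (rule sum_abs)
    also have "\<dots> \<le> (\<Sum>b\<in>Basis. norm h * B b)"
      using B Basis_le_norm by (intro sum_mono) (auto simp: abs_mult intro!: mult_mono)
    also have "\<dots> = M * norm h"
      by (simp add: M_def sum_distrib_left mult.commute)
    finally show ?thesis .
  qed
  have "norm (f (x + h) - f x) \<le> M * norm (x + h - x)" for x h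
  proof (rule differentiable_bound[of UNIV])
    show "onorm (D y) \<le> M" for y
      using DM by (intro onorm_bound) (auto simp: M_def B sum_nonneg)
  qed (use D(1) in auto)
  then show thesis
    using that[of M] DM by (simp add: M_def B sum_nonneg)
qed

definition conv :: "('a::euclidean_space \<Rightarrow> real) \<Rightarrow> ('a \<Rightarrow> real) \<Rightarrow> 'a \<Rightarrow> real" where
  "conv v \<rho> x = (LINT y|lborel. \<rho> (x - y) * v y)"

lemma conv_integrable:
  assumes v: "integrable lborel v" and \<rho>: "bump r \<rho>"
  shows "integrable lborel (\<lambda>y. \<rho> (x - y) * v y)"
proof -
  obtain M where M: "0 \<le> M" "\<And>x. \<bar>\<rho> x\<bar> \<le> M"
    using bump_bounded[OF \<rho>] by metis
  have [measurable]: "\<rho> \<in> borel_measurable borel" "v \<in> borel_measurable borel"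
    using bump_measurable[OF \<rho>] v by auto
  have "integrable lborel (\<lambda>y. M * v y)"
    using v by simp
  then show ?thesis
    by (rule Bochner_Integration.integrable_bound)
      (use M in \<open>auto simp: abs_mult intro!: mult_right_mono\<close>)
qed

text \<open>
  Differentiation under the integral sign. The normalized remainders of \<open>\<rho>\<close> are bounded by twice its
  Lipschitz constant, so dominated convergence applies along every sequence of increments.
\<close>

lemma conv_derivative:
  fixes v :: "'a::euclidean_space \<Rightarrow> real"
  assumes v: "integrable lborel v" and \<rho>: "bump r \<rho>"
    and D: "\<And>x. (\<rho> has_derivative D x) (at x)" "\<And>w. bump r (\<lambda>x. D x w)"
  shows "(conv v \<rho> has_derivative (\<lambda>w. conv v (\<lambda>x. D x w) x)) (at x)"
  unfolding has_derivative_at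
proof
  obtain M where M: "0 \<le> M" "\<And>x h. \<bar>D x h\<bar> \<le> M * norm h" "\<And>x h. \<bar>\<rho> (x + h) - \<rho> x\<bar> \<le> M * norm h"
    using bump_lipschitz[OF D] by metis
  note int = conv_integrable[OF v \<rho>] conv_integrable[OF v D(2)]
  have [measurable]: "\<rho> \<in> borel_measurable borel" "v \<in> borel_measurable borel" "(\<lambda>x. D x w) \<in> borel_measurable borel" for w
    using bump_measurable[OF \<rho>] bump_measurable[OF D(2)] v by auto
  have lin: "linear (D y)" for y
    using has_derivative_linear[OF D(1)] .
  have "linear (\<lambda>w. conv v (\<lambda>x. D x w) x)"
  proof (rule linearI)
    show "conv v (\<lambda>x. D x (a + b)) x = conv v (\<lambda>x. D x a) x + conv v (\<lambda>x. D x b) x" for a b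
      unfolding conv_def linear_add[OF lin] distrib_right by (rule Bochner_Integration.integral_add[OF int(2) int(2)])
    show "conv v (\<lambda>x. D x (c *\<^sub>R a)) x = c *\<^sub>R conv v (\<lambda>x. D x a) x" for c a
      unfolding conv_def linear_cmul[OF lin] by (simp add: mult.assoc)
  qed
  then show "bounded_linear (\<lambda>w. conv v (\<lambda>x. D x w) x)"
    by (simp add: linear_conv_bounded_linear)
  show "(\<lambda>h. norm (conv v \<rho> (x + h) - conv v \<rho> x - conv v (\<lambda>x. D x h) x) / norm h) \<midarrow>0\<rightarrow> 0"
    unfolding tendsto_at_iff_sequentially
  proof (intro allI impI)
    fix h :: "nat \<Rightarrow> 'a"
    assume h: "\<forall>i. h i \<in> UNIV - {0}" "h \<longlonglongrightarrow> 0"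
    define q where "q i y = \<bar>\<rho> (x - y + h i) - \<rho> (x - y) - D (x - y) (h i)\<bar> / norm (h i) * \<bar>v y\<bar>" for i y
    have h0: "0 < norm (h i)" for i using h(1) by simp
    have q_bound: "q i y \<le> 2 * M * \<bar>v y\<bar>" for i y
    proof -
      have "\<bar>\<rho> (x - y + h i) - \<rho> (x - y) - D (x - y) (h i)\<bar> \<le> 2 * M * norm (h i)"
        using M(2)[of "x - y" "h i"] M(3)[of "x - y" "h i"] by linarith
      then have "\<bar>\<rho> (x - y + h i) - \<rho> (x - y) - D (x - y) (h i)\<bar> / norm (h i) \<le> 2 * M"
        using h0[of i] by (simp add: divide_le_eq)
      then show ?thesis
        unfolding q_def by (intro mult_right_mono) auto
    qed
    have q_nonneg: "0 \<le> q i y" for i y by (simp add: q_def)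
    have q_meas [measurable]: "q i \<in> borel_measurable borel" for i
      unfolding q_def by measurable
    have q_lim: "(\<lambda>i. q i y) \<longlonglongrightarrow> 0" for y
    proof -
      have "(\<lambda>h. norm (\<rho> (x - y + h) - \<rho> (x - y) - D (x - y) h) / norm h) \<midarrow>0\<rightarrow> 0"
        using D(1)[of "x - y"] unfolding has_derivative_at by blast
      then have "(\<lambda>i. \<bar>\<rho> (x - y + h i) - \<rho> (x - y) - D (x - y) (h i)\<bar> / norm (h i)) \<longlonglongrightarrow> 0"
        using h unfolding tendsto_at_iff_sequentially by (simp add: o_def)
      then show ?thesis
        unfolding q_def using tendsto_mult_left_zero by blast
    qed
    have dom: "integrable lborel (\<lambda>y. 2 * M * \<bar>v y\<bar>)"
      using v by simp
    have q_int: "integrable lborel (q i)" for i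
      by (rule Bochner_Integration.integrable_bound[OF dom]) (use q_bound q_nonneg M(1) in \<open>auto simp: abs_mult\<close>)
    have "(\<lambda>i. LINT y|lborel. q i y) \<longlonglongrightarrow> (LINT y|(lborel :: 'a measure). 0)"
      by (rule integral_dominated_convergence[OF _ _ dom]) (use q_lim q_bound q_nonneg in auto)
    then have lim: "(\<lambda>i. LINT y|lborel. q i y) \<longlonglongrightarrow> 0" by simp
    have le: "norm (conv v \<rho> (x + h i) - conv v \<rho> x - conv v (\<lambda>x. D x (h i)) x) / norm (h i) \<le> (LINT y|lborel. q i y)" for i
    proof -
      have "conv v \<rho> (x + h i) - conv v \<rho> x - conv v (\<lambda>x. D x (h i)) x
        = (LINT y|lborel. \<rho> (x + h i - y) * v y - \<rho> (x - y) * v y - D (x - y) (h i) * v y)"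
        unfolding conv_def using int by simp
      also have "\<dots> = (LINT y|lborel. (\<rho> (x - y + h i) - \<rho> (x - y) - D (x - y) (h i)) * v y)"
        by (simp add: algebra_simps)
      finally have "norm (conv v \<rho> (x + h i) - conv v \<rho> x - conv v (\<lambda>x. D x (h i)) x)
         \<le> (LINT y|lborel. norm ((\<rho> (x - y + h i) - \<rho> (x - y) - D (x - y) (h i)) * v y))"
        by (simp only: integral_norm_bound)
      also have "\<dots> = (LINT y|lborel. norm (h i) * q i y)"
        using h0[of i] by (intro Bochner_Integration.integral_cong) (auto simp: q_def abs_mult)
      also have "\<dots> = norm (h i) * (LINT y|lborel. q i y)"
        by simp
      finally show ?thesis
        using h0[of i] by (simp add: divide_le_eq mult.commute)
    qed
    show "((\<lambda>h. norm (conv v \<rho> (x + h) - conv v \<rho> x - conv v (\<lambda>x. D x h) x) / norm h) \<circ> h) \<longlonglongrightarrow> 0"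
      by (rule tendsto_sandwich[OF _ _ tendsto_const lim]) (use le in \<open>auto simp: o_def\<close>)
  qed
qed

lemma conv_C_k:
  fixes v :: "'a::euclidean_space \<Rightarrow> real"
  assumes v: "integrable lborel v"
  shows "bump r \<rho> \<Longrightarrow> C_k k (conv v \<rho>)"
proof (induction k arbitrary: \<rho>)
  case 0
  obtain D where D: "\<And>x. (\<rho> has_derivative D x) (at x)" "\<And>w. bump r (\<lambda>x. D x w)"
    using bump_derivative[OF 0] by blast
  have "continuous_on UNIV (conv v \<rho>)"
    using conv_derivative[OF v 0 D] by (metis continuous_at_imp_continuous_on has_derivative_continuous)
  then show ?case by simp
next
  case (Suc k)
  obtain D where D: "\<And>x. (\<rho> has_derivative D x) (at x)" "\<And>w. bump r (\<lambda>x. D x w)"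
    using bump_derivative[OF Suc.prems] by blast
  note der = conv_derivative[OF v Suc.prems D]
  have "frechet_derivative (conv v \<rho>) (at x) = (\<lambda>w. conv v (\<lambda>x. D x w) x)" for x
    by (rule frechet_derivative_at[OF der, symmetric])
  moreover have "conv v \<rho> differentiable_on UNIV"
    using der by (auto simp: differentiable_on_def differentiable_def)
  ultimately show ?case
    using Suc.IH[OF D(2)] by simp
qed

text \<open>
  Points closer than \<open>c - \<delta>\<close> to the complement of \<open>\<Omega>\<close> are at distance at least \<open>\<delta>\<close> from the support of
  \<open>v\<close>, so the convolution vanishes there.
\<close>

lemma conv_test_function:
  fixes v :: "'a::euclidean_space \<Rightarrow> real"
  assumes v: "integrable lborel v" and \<rho>: "bump (\<delta>\<^sup>2) \<rho>" and \<delta>: "0 < \<delta>" "\<delta> < c"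
    and \<Omega>: "bounded \<Omega>" and supp: "\<And>y. v y \<noteq> 0 \<Longrightarrow> c \<le> infdist y (- \<Omega>)"
  shows "conv v \<rho> \<in> Cc_infinity \<Omega>"
proof -
  let ?K = "{x. c - \<delta> \<le> infdist x (- \<Omega>)}"
  have "closed ?K"
    by (intro closed_Collect_le continuous_intros)
  have "?K \<subseteq> \<Omega>"
  proof
    fix x assume "x \<in> ?K"
    then have "infdist x (- \<Omega>) \<noteq> 0" using \<delta> by auto
    then show "x \<in> \<Omega>"
      using infdist_zero[of x "- \<Omega>"] by blast
  qed
  have "x \<in> ?K" if "conv v \<rho> x \<noteq> 0" for x
  proof (rule ccontr)
    assume x: "x \<notin> ?K"
    have "\<rho> (x - y) * v y = 0" for y
    proof (cases "v y = 0")
      case False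
      then have "c \<le> infdist y (- \<Omega>)" by (rule supp)
      also have "\<dots> \<le> infdist x (- \<Omega>) + dist y x"
        by (rule infdist_triangle)
      finally have "\<delta> \<le> norm (x - y)"
        using x by (simp add: dist_norm norm_minus_commute)
      then have "\<delta>\<^sup>2 \<le> (x - y) \<bullet> (x - y)"
        using \<delta>(1) by (simp add: dot_square_norm power_mono)
      then show ?thesis
        using bump_support[OF \<rho>] by simp
    qed simp
    then have "conv v \<rho> x = 0" unfolding conv_def by (simp only: Bochner_Integration.integral_zero)
    then show False using that by simp
  qed
  then have "closure {x. conv v \<rho> x \<noteq> 0} \<subseteq> ?K"
    using \<open>closed ?K\<close> by (intro closure_minimal) auto
  moreover have "compact (closure {x. conv v \<rho> x \<noteq> 0})"
    using bounded_subset[OF \<Omega>] calculation \<open>?K \<subseteq> \<Omega>\<close> by (simp add: compact_eq_bounded_closed)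
  ultimately show ?thesis
    using conv_C_k[OF v \<rho>] \<open>?K \<subseteq> \<Omega>\<close> unfolding Cc_infinity_def by blast
qed

lemma mollifier_exists:
  assumes \<delta>: "0 < \<delta>"
  obtains \<rho> :: "'a::euclidean_space \<Rightarrow> real" where "bump (\<delta>\<^sup>2) \<rho>" "\<And>x. 0 \<le> \<rho> x"
    "(\<integral>\<^sup>+ x. ennreal (\<rho> x) \<partial>lborel) = 1"
proof -
  let ?f = "\<lambda>x::'a. flat 0 (\<delta>\<^sup>2 - x \<bullet> x)"
  have b: "bump (\<delta>\<^sup>2) ?f" by (rule bump.base)
  have [measurable]: "?f \<in> borel_measurable borel" by (rule bump_measurable[OF b])
  have nn: "0 \<le> ?f x" for x by (simp add: flat_def)
  define I where "I = (\<integral>\<^sup>+ x. ennreal (?f x) \<partial>lborel)"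
  have "I < \<infinity>"
  proof -
    have "I \<le> (\<integral>\<^sup>+ x. indicator (cball (0::'a) \<delta>) x \<partial>lborel)"
      unfolding I_def
    proof (intro nn_integral_mono)
      fix x :: 'a
      show "ennreal (?f x) \<le> indicator (cball 0 \<delta>) x"
      proof (cases "norm x \<le> \<delta>")
        case True
        have "?f x \<le> 1" by (simp add: flat_def)
        then show ?thesis using True by simp
      next
        case False
        then have "\<delta>\<^sup>2 \<le> x \<bullet> x"
          using \<delta> by (simp add: dot_square_norm power_mono)
        then show ?thesis by (simp add: flat_def)
      qed
    qed
    also have "\<dots> < \<infinity>"
      using emeasure_lborel_cball_finite[of "0::'a" \<delta>] by simp
    finally show ?thesis .
  qed
  moreover have "I \<noteq> 0"
  proof
    assume "I = 0"
    then have "emeasure lborel {x\<in>space lborel. ennreal (?f x) \<noteq> 0} = 0"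
      unfolding I_def by (subst (asm) nn_integral_0_iff) auto
    moreover have M: "{x::'a\<in>space lborel. ennreal (?f x) \<noteq> 0} \<in> sets lborel"
      by measurable
    moreover have "ball 0 \<delta> \<subseteq> {x\<in>space lborel. ennreal (?f x) \<noteq> 0}"
    proof
      fix x :: 'a
      assume "x \<in> ball 0 \<delta>"
      then have "x \<bullet> x < \<delta>\<^sup>2"
        by (simp add: dot_square_norm power_strict_mono)
      then have "0 < ?f x" by (simp add: flat_def)
      then show "x \<in> {x\<in>space lborel. ennreal (?f x) \<noteq> 0}"
        by (simp add: ennreal_eq_0_iff)
    qed
    ultimately have "emeasure lborel (ball (0::'a) \<delta>) \<le> 0"
      by (metis (mono_tags, lifting) M emeasure_mono)
    then show False
      using \<delta> unit_ball_vol_pos[of "real DIM('a)"] by (simp add: emeasure_ball)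
  qed
  ultimately obtain i where i: "I = ennreal i" "0 < i"
    by (cases I) (auto simp: less_le)
  show thesis
  proof (rule that)
    show "bump (\<delta>\<^sup>2) (\<lambda>x. 1 / i * ?f x)" by (rule bump.scale[OF b])
    show "0 \<le> 1 / i * ?f x" for x using i nn by simp
    have "(\<integral>\<^sup>+ x. ennreal (1 / i * ?f x) \<partial>lborel) = ennreal (1 / i) * I"
      unfolding I_def using i nn by (subst nn_integral_cmult[symmetric]) (auto simp: ennreal_mult[symmetric])
    then show "(\<integral>\<^sup>+ x. ennreal (1 / i * ?f x) \<partial>lborel) = 1"
      using i by (simp add: ennreal_mult[symmetric])
  qed
qed

section \<open>Convolution: energy and convergence of pairings\<close>

lemma nn_integral_lborel_translate:
  fixes h :: "'a::euclidean_space \<Rightarrow> ennreal"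
  assumes [measurable]: "h \<in> borel_measurable borel"
  shows "(\<integral>\<^sup>+ x. h (x + c) \<partial>lborel) = (\<integral>\<^sup>+ x. h x \<partial>lborel)"
proof -
  have "(\<integral>\<^sup>+ x. h x \<partial>distr lborel borel ((+) c)) = (\<integral>\<^sup>+ x. h (c + x) \<partial>lborel)"
    by (rule nn_integral_distr) simp_all
  then show ?thesis
    by (simp only: lborel_distr_plus add.commute)
qed

definition translation_modulus :: "('a::euclidean_space \<Rightarrow> real) \<Rightarrow> 'a \<Rightarrow> ennreal" where
  "translation_modulus f h = (\<integral>\<^sup>+ x. ennreal \<bar>f (x + h) - f x\<bar> \<partial>lborel)"

definition translation_continuous :: "('a::euclidean_space \<Rightarrow> real) \<Rightarrow> bool" where
  "translation_continuous f \<longleftrightarrow>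
     (\<forall>e>0. \<exists>\<delta>>0. \<forall>h. norm h < \<delta> \<longrightarrow> translation_modulus f h \<le> ennreal e)"

lemma translation_modulus_add:
  assumes [measurable]: "f \<in> borel_measurable borel" "g \<in> borel_measurable borel"
  shows "translation_modulus (\<lambda>x. f x + g x) h \<le> translation_modulus f h + translation_modulus g h"
proof -
  have "translation_modulus (\<lambda>x. f x + g x) h
     \<le> (\<integral>\<^sup>+ x. ennreal \<bar>f (x + h) - f x\<bar> + ennreal \<bar>g (x + h) - g x\<bar> \<partial>lborel)"
    unfolding translation_modulus_def
    by (intro nn_integral_mono) (auto simp flip: ennreal_plus intro!: ennreal_leI)
  also have "\<dots> = translation_modulus f h + translation_modulus g h"
    unfolding translation_modulus_def by (rule nn_integral_add) measurable
  finally show ?thesis .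
qed

lemma translation_modulus_le:
  assumes [measurable]: "f \<in> borel_measurable borel"
  shows "translation_modulus f h \<le> 2 * (\<integral>\<^sup>+ x. ennreal \<bar>f x\<bar> \<partial>lborel)"
proof -
  have "translation_modulus f h \<le> (\<integral>\<^sup>+ x. ennreal \<bar>f (x + h)\<bar> + ennreal \<bar>f x\<bar> \<partial>lborel)"
    unfolding translation_modulus_def
    by (intro nn_integral_mono) (auto simp flip: ennreal_plus intro!: ennreal_leI)
  also have "\<dots> = (\<integral>\<^sup>+ x. ennreal \<bar>f (x + h)\<bar> \<partial>lborel) + (\<integral>\<^sup>+ x. ennreal \<bar>f x\<bar> \<partial>lborel)"
    by (rule nn_integral_add) measurable
  also have "(\<integral>\<^sup>+ x. ennreal \<bar>f (x + h)\<bar> \<partial>lborel) = (\<integral>\<^sup>+ x. ennreal \<bar>f x\<bar> \<partial>lborel)"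
    by (rule nn_integral_lborel_translate) measurable
  finally show ?thesis
    by (simp add: mult_2)
qed

lemma translation_continuous_add:
  assumes [measurable]: "f \<in> borel_measurable borel" "g \<in> borel_measurable borel"
    and "translation_continuous f" "translation_continuous g"
  shows "translation_continuous (\<lambda>x. f x + g x)"
  unfolding translation_continuous_def
proof (intro allI impI)
  fix e :: real assume e: "0 < e"
  obtain \<delta>1 where \<delta>1: "0 < \<delta>1" "\<And>h. norm h < \<delta>1 \<Longrightarrow> translation_modulus f h \<le> ennreal (e / 2)"
    using assms(3) e unfolding translation_continuous_def by (meson half_gt_zero)
  obtain \<delta>2 where \<delta>2: "0 < \<delta>2" "\<And>h. norm h < \<delta>2 \<Longrightarrow> translation_modulus g h \<le> ennreal (e / 2)"
    using assms(4) e unfolding translation_continuous_def by (meson half_gt_zero)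
  show "\<exists>\<delta>>0. \<forall>h. norm h < \<delta> \<longrightarrow> translation_modulus (\<lambda>x. f x + g x) h \<le> ennreal e"
  proof (intro exI[of _ "min \<delta>1 \<delta>2"] conjI allI impI)
    fix h :: 'a assume h: "norm h < min \<delta>1 \<delta>2"
    have "translation_modulus (\<lambda>x. f x + g x) h \<le> translation_modulus f h + translation_modulus g h"
      by (rule translation_modulus_add) measurable
    also have "\<dots> \<le> ennreal (e / 2) + ennreal (e / 2)"
      using h by (intro add_mono \<delta>1(2) \<delta>2(2)) auto
    also have "\<dots> = ennreal e"
      using e by (simp flip: ennreal_plus)
    finally show "translation_modulus (\<lambda>x. f x + g x) h \<le> ennreal e" .
  qed (use \<delta>1(1) \<delta>2(1) in auto)
qed

text \<open>
  Translation continuity passes to \<open>L\<^sup>1\<close> limits: the error is counted twice, once translated and once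
  in place.
\<close>

lemma translation_continuous_approx:
  assumes [measurable]: "f \<in> borel_measurable borel"
    and approx: "\<And>e. 0 < e \<Longrightarrow> \<exists>g \<in> borel_measurable borel. translation_continuous g \<and>
      (\<integral>\<^sup>+ x. ennreal \<bar>f x - g x\<bar> \<partial>lborel) \<le> ennreal e"
  shows "translation_continuous f"
  unfolding translation_continuous_def
proof (intro allI impI)
  fix e :: real assume e: "0 < e"
  obtain g where [measurable]: "g \<in> borel_measurable borel" and g: "translation_continuous g"
    "(\<integral>\<^sup>+ x. ennreal \<bar>f x - g x\<bar> \<partial>lborel) \<le> ennreal (e / 4)"
    using approx[of "e / 4"] e by auto
  obtain \<delta> where \<delta>: "0 < \<delta>" "\<And>h. norm h < \<delta> \<Longrightarrow> translation_modulus g h \<le> ennreal (e / 2)"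
    using g(1) e unfolding translation_continuous_def by (meson half_gt_zero)
  show "\<exists>\<delta>>0. \<forall>h. norm h < \<delta> \<longrightarrow> translation_modulus f h \<le> ennreal e"
  proof (intro exI[of _ \<delta>] conjI allI impI \<delta>(1))
    fix h :: 'a assume h: "norm h < \<delta>"
    have "translation_modulus f h = translation_modulus (\<lambda>x. g x + (f x - g x)) h"
      by simp
    also have "\<dots> \<le> translation_modulus g h + translation_modulus (\<lambda>x. f x - g x) h"
      by (rule translation_modulus_add) measurable
    also have "\<dots> \<le> ennreal (e / 2) + 2 * (\<integral>\<^sup>+ x. ennreal \<bar>f x - g x\<bar> \<partial>lborel)"
      by (intro add_mono \<delta>(2) h translation_modulus_le) measurable
    also have "\<dots> \<le> ennreal (e / 2) + 2 * ennreal (e / 4)"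
      by (intro add_left_mono mult_left_mono g(2)) simp
    also have "2 * ennreal (e / 4) = ennreal (e / 2)"
      using e ennreal_mult[of 2 "e / 4"] by simp
    also have "ennreal (e / 2) + ennreal (e / 2) = ennreal e"
      using e by (simp flip: ennreal_plus)
    finally show "translation_modulus f h \<le> ennreal e" .
  qed
qed

text \<open>
  For open \<open>U\<close> the points of \<open>U\<close> stay in \<open>U\<close> under small translations, so the part of \<open>U\<close> that leaves
  tends to zero by dominated convergence; the part that enters is the same quantity for \<open>- h\<close>.
\<close>

lemma translation_continuous_open:
  fixes U :: "'a::euclidean_space set"
  assumes U: "open U" "emeasure lborel U < \<infinity>"
  shows "translation_continuous (indicator U :: 'a \<Rightarrow> real)"
proof -
  have [measurable]: "U \<in> sets borel" using U(1) by simp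
  define m where "m h = (\<integral>\<^sup>+ x. indicator U x * ennreal (1 - indicator U (x + h)) \<partial>lborel)" for h :: 'a
  have mod: "translation_modulus (indicator U) h = m h + m (- h)" for h :: 'a
  proof -
    have "translation_modulus (indicator U) h
      = (\<integral>\<^sup>+ x. indicator U x * ennreal (1 - indicator U (x + h)) + indicator U (x + h) * ennreal (1 - indicator U x) \<partial>lborel)"
      unfolding translation_modulus_def by (intro nn_integral_cong) (auto simp: indicator_def)
    also have "\<dots> = m h + (\<integral>\<^sup>+ x. indicator U (x + h) * ennreal (1 - indicator U x) \<partial>lborel)"
      unfolding m_def by (rule nn_integral_add) measurable
    also have "(\<integral>\<^sup>+ x. indicator U (x + h) * ennreal (1 - indicator U x) \<partial>lborel) = m (- h)"
      unfolding m_def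
      using nn_integral_lborel_translate[of "\<lambda>x. indicator U x * ennreal (1 - indicator U (x + - h))" h] by simp
    finally show ?thesis .
  qed
  have lim: "(m \<longlongrightarrow> 0) (at 0)"
    unfolding tendsto_at_iff_sequentially
  proof (intro allI impI)
    fix h :: "nat \<Rightarrow> 'a" assume h: "h \<longlonglongrightarrow> 0"
    have "(\<lambda>i. m (h i)) \<longlonglongrightarrow> (\<integral>\<^sup>+ x. 0 \<partial>(lborel :: 'a measure))"
      unfolding m_def
    proof (rule nn_integral_dominated_convergence[where w = "indicator U"])
      show "AE x in lborel. (\<lambda>i. indicator U x * ennreal (1 - indicator U (x + h i))) \<longlonglongrightarrow> 0"
      proof (rule AE_I2)
        fix x
        show "(\<lambda>i. indicator U x * ennreal (1 - indicator U (x + h i))) \<longlonglongrightarrow> 0"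
        proof (cases "x \<in> U")
          case True
          have "(\<lambda>i. x + h i) \<longlonglongrightarrow> x + 0"
            by (intro tendsto_add tendsto_const h)
          then have "\<forall>\<^sub>F i in sequentially. x + h i \<in> U"
            using topological_tendstoD[OF _ U(1)] True by simp
          then have "\<forall>\<^sub>F i in sequentially. indicator U x * ennreal (1 - indicator U (x + h i)) = 0"
            by eventually_elim simp
          then show ?thesis by (rule tendsto_eventually)
        qed simp
      qed
      show "AE x in lborel. indicator U x * ennreal (1 - indicator U (x + h i)) \<le> indicator U x" for i
        by (intro AE_I2) (auto simp: indicator_def)
    qed (use U(2) in auto)
    then show "(m \<circ> h) \<longlonglongrightarrow> 0"
      by (simp add: o_def)
  qed
  have m0: "m 0 = 0"
    unfolding m_def by (subst nn_integral_0_iff_AE) (auto simp: indicator_def)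
  show ?thesis
    unfolding translation_continuous_def
  proof (intro allI impI)
    fix e :: real assume e: "0 < e"
    then have "\<forall>\<^sub>F h in at 0. m h < ennreal (e / 2)"
      using order_tendstoD(2)[OF lim, of "ennreal (e / 2)"] by simp
    then obtain \<delta> where \<delta>: "0 < \<delta>" "\<And>h. h \<noteq> 0 \<Longrightarrow> norm h < \<delta> \<Longrightarrow> m h < ennreal (e / 2)"
      unfolding eventually_at by auto
    have small: "m h \<le> ennreal (e / 2)" if "norm h < \<delta>" for h
      using \<delta>(2)[of h] that m0 by (cases "h = 0") (auto intro: less_imp_le)
    show "\<exists>\<delta>>0. \<forall>h. norm h < \<delta> \<longrightarrow> translation_modulus (indicator U) h \<le> ennreal e"
    proof (intro exI[of _ \<delta>] conjI allI impI \<delta>(1))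
      fix h :: 'a assume h: "norm h < \<delta>"
      have "m h + m (- h) \<le> ennreal (e / 2) + ennreal (e / 2)"
        using h by (intro add_mono small) auto
      also have "\<dots> = ennreal e"
        using e by (simp flip: ennreal_plus)
      finally show "translation_modulus (indicator U) h \<le> ennreal e"
        by (simp only: mod)
    qed
  qed
qed

lemma translation_continuous_scale:
  assumes [measurable]: "f \<in> borel_measurable borel" and f: "translation_continuous f"
  shows "translation_continuous (\<lambda>x. c * f x)"
  unfolding translation_continuous_def
proof (intro allI impI)
  fix e :: real assume e: "0 < e"
  define e' where "e' = e / (\<bar>c\<bar> + 1)"
  have e': "0 < e'" "\<bar>c\<bar> * e' \<le> e"
    using e by (auto simp: e'_def field_simps)
  obtain \<delta> where \<delta>: "0 < \<delta>" "\<And>h. norm h < \<delta> \<Longrightarrow> translation_modulus f h \<le> ennreal e'"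
    using f e'(1) unfolding translation_continuous_def by meson
  show "\<exists>\<delta>>0. \<forall>h. norm h < \<delta> \<longrightarrow> translation_modulus (\<lambda>x. c * f x) h \<le> ennreal e"
  proof (intro exI[of _ \<delta>] conjI allI impI \<delta>(1))
    fix h :: 'a assume h: "norm h < \<delta>"
    have "translation_modulus (\<lambda>x. c * f x) h = (\<integral>\<^sup>+ x. ennreal \<bar>c\<bar> * ennreal \<bar>f (x + h) - f x\<bar> \<partial>lborel)"
      unfolding translation_modulus_def
      by (intro nn_integral_cong) (simp add: ennreal_mult[symmetric] abs_mult[symmetric] right_diff_distrib)
    also have "\<dots> = ennreal \<bar>c\<bar> * translation_modulus f h"
      unfolding translation_modulus_def by (rule nn_integral_cmult) measurable
    also have "\<dots> \<le> ennreal \<bar>c\<bar> * ennreal e'"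
      by (intro mult_left_mono \<delta>(2) h) simp
    also have "\<dots> \<le> ennreal e"
      using e' by (simp add: ennreal_mult[symmetric] ennreal_leI)
    finally show "translation_modulus (\<lambda>x. c * f x) h \<le> ennreal e" .
  qed
qed

text \<open>
  Open sets approximate measurable ones by outer regularity, and simple functions are dense in \<open>L\<^sup>1\<close>.
\<close>

lemma integrable_translation_continuous:
  fixes f :: "'a::euclidean_space \<Rightarrow> real"
  assumes "integrable lborel f"
  shows "translation_continuous f"
  using assms
proof (induction rule: integrable_induct)
  case (base A c)
  then have [measurable]: "A \<in> sets borel" by simp
  have "translation_continuous (indicator A :: 'a \<Rightarrow> real)"
  proof (rule translation_continuous_approx)
    fix e :: real assume e: "0 < e"
    obtain U where U: "open U" "A \<subseteq> U" "emeasure lborel (U - A) < ennreal e"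
      using outer_regular_lborel[of A e] e by auto
    have [measurable]: "U \<in> sets borel" using U(1) by simp
    have "emeasure lborel U \<le> emeasure lborel A + emeasure lborel (U - A)"
      using emeasure_subadditive[of A lborel "U - A"] U(2) by (simp add: Un_absorb1)
    also have "\<dots> < \<infinity>"
      using base(2) U(3) by (auto intro: less_trans)
    finally have "translation_continuous (indicator U :: 'a \<Rightarrow> real)"
      by (rule translation_continuous_open[OF U(1)])
    moreover have "(\<integral>\<^sup>+ x. ennreal \<bar>indicator A x - indicator U x\<bar> \<partial>lborel) = (\<integral>\<^sup>+ x. indicator (U - A) x \<partial>lborel)"
      using U(2) by (intro nn_integral_cong) (auto simp: indicator_def)
    then have "(\<integral>\<^sup>+ x. ennreal \<bar>indicator A x - indicator U x\<bar> \<partial>lborel) \<le> ennreal e"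
      using U(3) by simp
    ultimately show "\<exists>g\<in>borel_measurable borel. translation_continuous g \<and>
        (\<integral>\<^sup>+ x. ennreal \<bar>indicator A x - g x\<bar> \<partial>lborel) \<le> ennreal e"
      by (intro bexI[of _ "indicator U"]) auto
  qed simp
  then have "translation_continuous (\<lambda>x. c * indicator A x)"
    by (rule translation_continuous_scale[rotated]) simp
  then show ?case by (simp add: mult.commute)
next
  case (add f g)
  then show ?case
    by (intro translation_continuous_add) auto
next
  case (lim f s)
  have [measurable]: "f \<in> borel_measurable borel" "\<And>i. s i \<in> borel_measurable borel"
    using \<open>integrable lborel f\<close> \<open>\<And>i. integrable lborel (s i)\<close> by auto
  have conv: "(\<lambda>i. \<integral>\<^sup>+ x. ennreal (norm (f x - s i x)) \<partial>lborel) \<longlonglongrightarrow> 0"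
  proof (rule nn_integral_dominated_convergence_norm[where w = "\<lambda>x. 2 * norm (f x)"])
    show "(\<integral>\<^sup>+ x. ennreal (2 * norm (f x)) \<partial>lborel) < \<infinity>"
      using \<open>integrable lborel f\<close> by (simp add: integrable_iff_bounded ennreal_mult nn_integral_cmult ennreal_mult_less_top)
  qed (use lim in auto)
  show ?case
  proof (rule translation_continuous_approx)
    fix e :: real assume e: "0 < e"
    then have "\<forall>\<^sub>F i in sequentially. (\<integral>\<^sup>+ x. ennreal (norm (f x - s i x)) \<partial>lborel) < ennreal e"
      using order_tendstoD(2)[OF conv, of "ennreal e"] by simp
    then obtain i where "(\<integral>\<^sup>+ x. ennreal (norm (f x - s i x)) \<partial>lborel) < ennreal e"
      by (auto simp: eventually_sequentially)
    then show "\<exists>g\<in>borel_measurable borel. translation_continuous g \<and> (\<integral>\<^sup>+ x. ennreal \<bar>f x - g x\<bar> \<partial>lborel) \<le> ennreal e"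
      using lim.IH[of i] by (intro bexI[of _ "s i"]) (auto intro: less_imp_le)
  qed simp
qed

lemma conv_eq_nn_integral:
  fixes v :: "'a::euclidean_space \<Rightarrow> real"
  assumes v: "integrable lborel v" "\<And>x. 0 \<le> v x" and \<rho>: "bump r \<rho>" "\<And>x. 0 \<le> \<rho> x"
  shows "ennreal (conv v \<rho> x) = (\<integral>\<^sup>+ h. ennreal (\<rho> h) * ennreal (v (x - h)) \<partial>lborel)"
proof -
  have [measurable]: "\<rho> \<in> borel_measurable borel" "v \<in> borel_measurable borel"
    using bump_measurable[OF \<rho>(1)] v(1) by auto
  have "ennreal (conv v \<rho> x) = (\<integral>\<^sup>+ y. ennreal (\<rho> (x - y) * v y) \<partial>lborel)"
    unfolding conv_def using v(2) \<rho>(2)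
    by (intro nn_integral_eq_integral[symmetric] conv_integrable[OF v(1) \<rho>(1)]) auto
  also have "\<dots> = (\<integral>\<^sup>+ y. ennreal (\<rho> (x - y)) * ennreal (v (x - (x - y))) \<partial>lborel)"
    using v(2) \<rho>(2) by (simp add: ennreal_mult)
  also have "\<dots> = (\<integral>\<^sup>+ h. ennreal (\<rho> h) * ennreal (v (x - h)) \<partial>lborel)"
    by (rule nn_integral_lborel_reflect_translate) measurable
  finally show ?thesis .
qed

lemma conv_nonneg:
  assumes "\<And>x. 0 \<le> v x" "\<And>x. 0 \<le> \<rho> x"
  shows "0 \<le> conv v \<rho> x"
  unfolding conv_def using assms by (intro Bochner_Integration.integral_nonneg) auto

text \<open>
  Both convolutions are averages over the same shifts, so their difference is at most the average of
  the shifted differences. The argument stays with nonnegative integrals, where subtraction is avoided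
  by proving both one-sided bounds.
\<close>

lemma conv_diff_le:
  fixes v :: "'a::euclidean_space \<Rightarrow> real"
  assumes v: "integrable lborel v" "\<And>x. 0 \<le> v x" and \<rho>: "bump r \<rho>" "\<And>x. 0 \<le> \<rho> x"
  shows "ennreal \<bar>conv v \<rho> x - conv v \<rho> y\<bar> \<le> (\<integral>\<^sup>+ h. ennreal (\<rho> h) * ennreal \<bar>v (x - h) - v (y - h)\<bar> \<partial>lborel)"
proof -
  have [measurable]: "\<rho> \<in> borel_measurable borel" "v \<in> borel_measurable borel"
    using bump_measurable[OF \<rho>(1)] v(1) by auto
  have half: "ennreal (conv v \<rho> a - conv v \<rho> b) \<le> (\<integral>\<^sup>+ h. ennreal (\<rho> h) * ennreal \<bar>v (a - h) - v (b - h)\<bar> \<partial>lborel)" for a b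
  proof -
    have "ennreal (conv v \<rho> a) \<le> (\<integral>\<^sup>+ h. ennreal (\<rho> h) * ennreal (v (b - h)) + ennreal (\<rho> h) * ennreal \<bar>v (a - h) - v (b - h)\<bar> \<partial>lborel)"
      unfolding conv_eq_nn_integral[OF v \<rho>] distrib_left[symmetric]
      by (intro nn_integral_mono mult_left_mono)
        (use v(2) in \<open>auto simp flip: ennreal_plus intro!: ennreal_leI\<close>)
    also have "\<dots> = ennreal (conv v \<rho> b) + (\<integral>\<^sup>+ h. ennreal (\<rho> h) * ennreal \<bar>v (a - h) - v (b - h)\<bar> \<partial>lborel)"
      unfolding conv_eq_nn_integral[OF v \<rho>] by (rule nn_integral_add) measurable
    finally have *: "ennreal (conv v \<rho> a) \<le> ennreal (conv v \<rho> b) + (\<integral>\<^sup>+ h. ennreal (\<rho> h) * ennreal \<bar>v (a - h) - v (b - h)\<bar> \<partial>lborel)" .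
    show ?thesis
    proof (cases "\<integral>\<^sup>+ h. ennreal (\<rho> h) * ennreal \<bar>v (a - h) - v (b - h)\<bar> \<partial>lborel")
      case (real c)
      then have "conv v \<rho> a \<le> conv v \<rho> b + c"
        using * conv_nonneg[of v \<rho> b, OF v(2) \<rho>(2)] by (simp flip: ennreal_plus)
      then show ?thesis
        using real by (simp add: ennreal_leI)
    qed simp
  qed
  show ?thesis
  proof (cases "conv v \<rho> y \<le> conv v \<rho> x")
    case True
    then show ?thesis using half[of x y] by simp
  next
    case False
    then show ?thesis using half[of y x] by (simp add: abs_minus_commute)
  qed
qed

text \<open>
  The energy is convex and invariant under simultaneous translation of both points.
\<close>

lemma gagliardo_conv_le:
  fixes v :: "'a::euclidean_space \<Rightarrow> real"
  assumes v: "integrable lborel v" "\<And>x. 0 \<le> v x" and \<rho>: "bump r \<rho>" "\<And>x. 0 \<le> \<rho> x"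
    and mass: "(\<integral>\<^sup>+ h. ennreal (\<rho> h) \<partial>lborel) = 1"
  shows "gagliardo s UNIV (conv v \<rho>) \<le> gagliardo s UNIV v"
proof -
  have [measurable]: "\<rho> \<in> borel_measurable borel" "v \<in> borel_measurable borel"
    using bump_measurable[OF \<rho>(1)] v(1) by auto
  let ?G = "\<lambda>p::'a \<times> 'a. ennreal (\<bar>v (fst p) - v (snd p)\<bar> * kern s (fst p - snd p))"
  have "gagliardo s UNIV (conv v \<rho>) \<le> (\<integral>\<^sup>+ p. \<integral>\<^sup>+ h. ennreal (\<rho> h) * ?G (p + (- h, - h)) \<partial>lborel \<partial>lborel)"
    unfolding gagliardo_UNIV
  proof (intro nn_integral_mono)
    fix p :: "'a \<times> 'a"
    have "ennreal (\<bar>conv v \<rho> (fst p) - conv v \<rho> (snd p)\<bar> * kern s (fst p - snd p))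
       \<le> (\<integral>\<^sup>+ h. ennreal (\<rho> h) * ennreal \<bar>v (fst p - h) - v (snd p - h)\<bar> \<partial>lborel) * ennreal (kern s (fst p - snd p))"
      by (simp add: ennreal_mult mult_right_mono conv_diff_le[OF v \<rho>])
    also have "\<dots> = (\<integral>\<^sup>+ h. ennreal (\<rho> h) * ennreal \<bar>v (fst p - h) - v (snd p - h)\<bar> * ennreal (kern s (fst p - snd p)) \<partial>lborel)"
      by (rule nn_integral_multc[symmetric]) measurable
    also have "\<dots> = (\<integral>\<^sup>+ h. ennreal (\<rho> h) * ?G (p + (- h, - h)) \<partial>lborel)"
      by (simp add: ennreal_mult mult.assoc)
    finally show "ennreal (\<bar>conv v \<rho> (fst p) - conv v \<rho> (snd p)\<bar> * kern s (fst p - snd p))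
       \<le> (\<integral>\<^sup>+ h. ennreal (\<rho> h) * ?G (p + (- h, - h)) \<partial>lborel)" .
  qed
  also have "\<dots> = (\<integral>\<^sup>+ h. \<integral>\<^sup>+ p. ennreal (\<rho> h) * ?G (p + (- h, - h)) \<partial>lborel \<partial>lborel)"
    by (rule lborel_pair.Fubini'[symmetric]) (simp add: split_beta lborel_prod)
  also have "\<dots> = (\<integral>\<^sup>+ h. ennreal (\<rho> h) * gagliardo s UNIV v \<partial>lborel)"
  proof (intro nn_integral_cong)
    fix h :: 'a
    have "(\<integral>\<^sup>+ p. ?G (p + (- h, - h)) \<partial>lborel) = (\<integral>\<^sup>+ p. ?G p \<partial>lborel)"
      by (rule nn_integral_lborel_translate) measurable
    moreover have "(\<integral>\<^sup>+ p. ennreal (\<rho> h) * ?G (p + (- h, - h)) \<partial>lborel) = ennreal (\<rho> h) * (\<integral>\<^sup>+ p. ?G (p + (- h, - h)) \<partial>lborel)"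
      by (rule nn_integral_cmult) measurable
    ultimately show "(\<integral>\<^sup>+ p. ennreal (\<rho> h) * ?G (p + (- h, - h)) \<partial>lborel) = ennreal (\<rho> h) * gagliardo s UNIV v"
      unfolding gagliardo_UNIV by simp
  qed
  also have "\<dots> = gagliardo s UNIV v"
    by (subst nn_integral_multc) (auto simp: mass)
  finally show ?thesis .
qed

text \<open>
  The translation is moved from \<open>v\<close>, which may be discontinuous, to the weight \<open>g\<close>: since \<open>0 \<le> v \<le> 1\<close>,
  each shift \<open>h\<close> costs at most the \<open>L\<^sup>1\<close> distance between \<open>g\<close> and its translate.
\<close>

lemma conv_pairing:
  fixes v :: "'a::euclidean_space \<Rightarrow> real"
  assumes v: "integrable lborel v" "\<And>x. 0 \<le> v x" "\<And>x. v x \<le> 1"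
    and \<rho>: "bump (\<delta>\<^sup>2) \<rho>" "\<And>x. 0 \<le> \<rho> x" and \<delta>: "0 < \<delta>"
    and mass: "(\<integral>\<^sup>+ h. ennreal (\<rho> h) \<partial>lborel) = 1"
    and g[measurable]: "g \<in> borel_measurable borel" and g_nonneg: "\<And>x. 0 \<le> g x"
    and mod: "\<And>h. norm h < \<delta> \<Longrightarrow> translation_modulus g h \<le> ennreal e"
  shows "(\<integral>\<^sup>+ x. ennreal (g x) * ennreal (v x) \<partial>lborel)
    \<le> (\<integral>\<^sup>+ x. ennreal (g x) * ennreal (conv v \<rho> x) \<partial>lborel) + ennreal e"
proof -
  have [measurable]: "\<rho> \<in> borel_measurable borel" "v \<in> borel_measurable borel"
    using bump_measurable[OF \<rho>(1)] v(1) by auto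
  have shift: "(\<integral>\<^sup>+ x. ennreal (g x) * ennreal (v x) \<partial>lborel)
    \<le> (\<integral>\<^sup>+ x. ennreal (g x) * ennreal (v (x - h)) \<partial>lborel) + ennreal e" if h: "norm h < \<delta>" for h
  proof -
    have "(\<integral>\<^sup>+ x. ennreal (g x) * ennreal (v x) \<partial>lborel)
       \<le> (\<integral>\<^sup>+ x. ennreal (g (x + h)) * ennreal (v x) + ennreal \<bar>g (x + h) - g x\<bar> \<partial>lborel)"
    proof (intro nn_integral_mono)
      fix x
      have "g x * v x = g (x + h) * v x + (g x - g (x + h)) * v x"
        by (simp add: algebra_simps)
      also have "(g x - g (x + h)) * v x \<le> \<bar>g (x + h) - g x\<bar> * 1"
        using v(2,3) by (intro mult_mono) auto
      finally have "g x * v x \<le> g (x + h) * v x + \<bar>g (x + h) - g x\<bar>" by simp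
      then show "ennreal (g x) * ennreal (v x) \<le> ennreal (g (x + h)) * ennreal (v x) + ennreal \<bar>g (x + h) - g x\<bar>"
        using g_nonneg v(2) by (simp add: ennreal_mult[symmetric] ennreal_leI flip: ennreal_plus)
    qed
    also have "\<dots> = (\<integral>\<^sup>+ x. ennreal (g (x + h)) * ennreal (v x) \<partial>lborel) + translation_modulus g h"
      unfolding translation_modulus_def by (rule nn_integral_add) measurable
    also have "(\<integral>\<^sup>+ x. ennreal (g (x + h)) * ennreal (v x) \<partial>lborel) = (\<integral>\<^sup>+ x. ennreal (g x) * ennreal (v (x - h)) \<partial>lborel)"
      using nn_integral_lborel_translate[of "\<lambda>x. ennreal (g x) * ennreal (v (x - h))" h] by simp
    also have "\<dots> + translation_modulus g h \<le> \<dots> + ennreal e"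
      by (intro add_left_mono mod h)
    finally show ?thesis .
  qed
  have "(\<integral>\<^sup>+ x. ennreal (g x) * ennreal (v x) \<partial>lborel)
    = (\<integral>\<^sup>+ h. ennreal (\<rho> h) * (\<integral>\<^sup>+ x. ennreal (g x) * ennreal (v x) \<partial>lborel) \<partial>lborel)"
    by (subst nn_integral_multc) (auto simp: mass)
  also have "\<dots> \<le> (\<integral>\<^sup>+ h. ennreal (\<rho> h) * (\<integral>\<^sup>+ x. ennreal (g x) * ennreal (v (x - h)) \<partial>lborel) + ennreal (\<rho> h) * ennreal e \<partial>lborel)"
    unfolding distrib_left[symmetric]
  proof (intro nn_integral_mono)
    fix h :: 'a
    show "ennreal (\<rho> h) * (\<integral>\<^sup>+ x. ennreal (g x) * ennreal (v x) \<partial>lborel)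
      \<le> ennreal (\<rho> h) * ((\<integral>\<^sup>+ x. ennreal (g x) * ennreal (v (x - h)) \<partial>lborel) + ennreal e)"
    proof (cases "norm h < \<delta>")
      case True
      then show ?thesis by (intro mult_left_mono shift) auto
    next
      case False
      then have "\<delta>\<^sup>2 \<le> h \<bullet> h"
        using \<delta> by (simp add: dot_square_norm power_mono)
      then show ?thesis using bump_support[OF \<rho>(1)] by simp
    qed
  qed
  also have "\<dots> = (\<integral>\<^sup>+ h. ennreal (\<rho> h) * (\<integral>\<^sup>+ x. ennreal (g x) * ennreal (v (x - h)) \<partial>lborel) \<partial>lborel) + (\<integral>\<^sup>+ h. ennreal (\<rho> h) * ennreal e \<partial>lborel)"
    by (rule nn_integral_add) measurable
  also have "(\<integral>\<^sup>+ h. ennreal (\<rho> h) * ennreal e \<partial>lborel) = ennreal e"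
    by (subst nn_integral_multc) (auto simp: mass)
  also have "(\<integral>\<^sup>+ h. ennreal (\<rho> h) * (\<integral>\<^sup>+ x. ennreal (g x) * ennreal (v (x - h)) \<partial>lborel) \<partial>lborel)
     = (\<integral>\<^sup>+ h. \<integral>\<^sup>+ x. ennreal (g x) * (ennreal (\<rho> h) * ennreal (v (x - h))) \<partial>lborel \<partial>lborel)"
    by (intro nn_integral_cong, subst nn_integral_cmult[symmetric]) (auto simp: mult_ac)
  also have "\<dots> = (\<integral>\<^sup>+ x. \<integral>\<^sup>+ h. ennreal (g x) * (ennreal (\<rho> h) * ennreal (v (x - h))) \<partial>lborel \<partial>lborel)"
    by (rule lborel_pair.Fubini') (simp add: split_beta lborel_prod)
  also have "\<dots> = (\<integral>\<^sup>+ x. ennreal (g x) * ennreal (conv v \<rho> x) \<partial>lborel)"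
    unfolding conv_eq_nn_integral[OF v(1,2) \<rho>] by (intro nn_integral_cong nn_integral_cmult) measurable
  finally show ?thesis .
qed

section \<open>A minimizing function has minimizing level sets\<close>

lemma test_function_in_W0s1:
  assumes "\<phi> \<in> Cc_infinity \<Omega>"
  shows "\<phi> \<in> W0s1 s \<Omega>"
proof -
  have "\<phi> \<in> borel_measurable borel"
    using Cc_infinity_integrable[OF assms] by simp
  then have "\<phi> \<in> borel_measurable lebesgue"
    by (rule measurable_completion[of \<phi> lborel borel, simplified])
  moreover have "\<phi> x = 0" if "x \<notin> \<Omega>" for x
    using assms closure_subset[of "{x. \<phi> x \<noteq> 0}"] that by (auto simp: Cc_infinity_def)
  moreover have "Ws1_norm s \<Omega> (\<lambda>x. \<phi> x - \<phi> x) = 0"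
    by (simp add: Ws1_norm_def gagliardo_def)
  then have "\<exists>\<psi>\<in>Cc_infinity \<Omega>. Ws1_norm s \<Omega> (\<lambda>x. \<phi> x - \<psi> x) < ennreal \<epsilon>" if "0 < \<epsilon>" for \<epsilon>
    using assms that by (intro bexI[of _ \<phi>]) simp_all
  ultimately show ?thesis
    by (simp add: W0s1_def)
qed

lemma C_k_zero: "C_k k (\<lambda>x. 0)"
proof (induction k)
  case (Suc k)
  have "frechet_derivative (\<lambda>x::'a. 0::real) (at x) = (\<lambda>_. 0)" for x
    by (rule frechet_derivative_at[symmetric]) simp
  with Suc show ?case by simp
qed simp

lemma zero_in_W0s1: "(\<lambda>x. 0) \<in> W0s1 s \<Omega>"
  by (rule test_function_in_W0s1) (simp add: Cc_infinity_def C_k_zero)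

lemma F_energy_zero: "F_energy s \<Omega> f (\<lambda>x. 0) = 0"
  by (simp add: F_energy_def gagliardo_def zero_ereal_def[symmetric] zero_ennreal.rep_eq)

text \<open>
  This is where \<open>\<bar>z\<bar> \<le> 1\<close> enters. If the integrand with \<open>z\<close> is not integrable, its integral is \<open>0\<close> by
  convention and the bound still holds.
\<close>

lemma weak_solution_pairing_le:
  assumes "weak_solution s \<Omega> f u" "w \<in> W0s1 s \<Omega>"
  shows "ennreal (LINT x:\<Omega>|lebesgue. f x * w x) \<le> gagliardo s UNIV w / 2"
proof -
  obtain z where z: "AE p in lebesgue. \<bar>z p\<bar> \<le> 1"
    and eq: "\<forall>w\<in>W0s1 s \<Omega>. (LINT p|lebesgue. z p / norm (fst p - snd p) powr (real DIM('a) + s) *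
              (w (fst p) - w (snd p))) / 2 = (LINT x:\<Omega>|lebesgue. f x * w x)"
    using assms(1) unfolding weak_solution_def by blast
  let ?h = "\<lambda>p. z p / norm (fst p - snd p) powr (real DIM('a) + s) * (w (fst p) - w (snd p))"
  let ?I = "LINT p|lebesgue. ?h p"
  have "ennreal \<bar>?I\<bar> \<le> gagliardo s UNIV w"
  proof (cases "integrable lebesgue ?h")
    case True
    have "ennreal (norm ?I) \<le> (\<integral>\<^sup>+ p. ennreal (norm (?h p)) \<partial>lebesgue)"
      by (rule integral_norm_bound_ennreal[OF True])
    also have "\<dots> \<le> gagliardo s UNIV w"
      unfolding gagliardo_UNIV nn_integral_completion
    proof (rule nn_integral_mono_AE, use z[unfolded AE_completion_iff] in eventually_elim)
      case (elim p)
      have "norm (?h p) = \<bar>z p\<bar> * (\<bar>w (fst p) - w (snd p)\<bar> * kern s (fst p - snd p))"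
        by (simp add: kern_def abs_mult)
      also have "\<dots> \<le> 1 * (\<bar>w (fst p) - w (snd p)\<bar> * kern s (fst p - snd p))"
        using elim by (intro mult_right_mono) auto
      finally show ?case by (simp add: ennreal_leI)
    qed
    finally show ?thesis by simp
  qed (simp add: not_integrable_integral_eq)
  then have "ennreal \<bar>?I\<bar> / 2 \<le> gagliardo s UNIV w / 2"
    by (rule divide_right_mono_ennreal)
  moreover have "ennreal (LINT x:\<Omega>|lebesgue. f x * w x) \<le> ennreal \<bar>?I\<bar> / 2"
  proof -
    have "(LINT x:\<Omega>|lebesgue. f x * w x) = ?I / 2"
      using eq assms(2) by simp
    then have "ennreal (LINT x:\<Omega>|lebesgue. f x * w x) \<le> ennreal (\<bar>?I\<bar> / 2)"
      by (intro ennreal_leI) simp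
    also have "\<dots> = ennreal \<bar>?I\<bar> / 2"
      by (rule ennreal_divide_numeral[symmetric]) simp
    finally show ?thesis .
  qed
  ultimately show ?thesis by (rule order_trans[rotated])
qed

lemma AE_lborel_exists_between:
  fixes a b :: real
  assumes "AE t in lborel. P t" "a < b"
  shows "\<exists>t. a < t \<and> t < b \<and> P t"
proof (rule ccontr)
  assume none: "\<not> ?thesis"
  have "AE t in lborel. t \<notin> {a<..<b}"
    using assms(1) by eventually_elim (use none in auto)
  then have "{a<..<b} \<in> null_sets lborel"
    by (subst (asm) AE_iff_null_sets[symmetric]) auto
  then show False
    using assms(2) by (simp add: null_sets_def)
qed

context weight_representative
begin

text \<open>
  Mollify \<open>v\<close> at a scale smaller than the distance of its support to the boundary. The result is a
  test function with no more energy, and its pairing falls short of that of \<open>v\<close> by at most \<open>e\<close>.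
\<close>

lemma test_inequality_interior_support:
  assumes test: "\<And>\<phi>. \<phi> \<in> Cc_infinity \<Omega> \<Longrightarrow>
      ennreal (LINT x:\<Omega>|lebesgue. f x * \<phi> x) \<le> gagliardo s UNIV \<phi> / 2"
    and bdd: "bounded \<Omega>"
    and v: "v \<in> borel_measurable borel" "\<And>x. 0 \<le> v x" "\<And>x. v x \<le> 1"
    and c: "0 < c" "\<And>y. v y \<noteq> 0 \<Longrightarrow> c \<le> infdist y (- \<Omega>)"
  shows "(\<integral>\<^sup>+ x. ennreal (g x) * ennreal (v x) \<partial>lborel) \<le> gagliardo s UNIV v / 2"
proof (rule ennreal_le_epsilon)
  fix e :: real assume e: "0 < e"
  note [measurable] = v(1)
  have v_out: "v x = 0" if "x \<notin> \<Omega>" for x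
    using c(1) c(2)[of x] infdist_zero[of x "- \<Omega>"] that by force
  have v_int: "integrable lborel v"
  proof (rule integrableI_nonneg)
    have "(\<integral>\<^sup>+ x. ennreal (v x) \<partial>lborel) \<le> (\<integral>\<^sup>+ x. indicator \<Omega> x \<partial>lborel)"
      by (intro nn_integral_mono) (use v(3) v_out in \<open>auto simp: indicator_def\<close>)
    also have "\<dots> < \<infinity>"
      using emeasure_bounded_finite[OF bdd] by simp
    finally show "(\<integral>\<^sup>+ x. ennreal (v x) \<partial>lborel) < \<infinity>" .
  qed (use v in auto)
  obtain \<delta>0 where \<delta>0: "0 < \<delta>0" "\<And>h. norm h < \<delta>0 \<Longrightarrow> translation_modulus g h \<le> ennreal e"
    using integrable_translation_continuous[OF weight_integrable] e
    unfolding translation_continuous_def by meson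
  \<comment> \<open>small enough for the translates of \<open>g\<close> and for the support to stay inside \<open>\<Omega>\<close>\<close>
  define \<delta> where "\<delta> = min \<delta>0 (c / 2)"
  have \<delta>: "0 < \<delta>" "\<delta> < c" "\<And>h. norm h < \<delta> \<Longrightarrow> translation_modulus g h \<le> ennreal e"
    using \<delta>0 c(1) by (auto simp: \<delta>_def)
  obtain \<rho> :: "'a \<Rightarrow> real" where \<rho>: "bump (\<delta>\<^sup>2) \<rho>" "\<And>x. 0 \<le> \<rho> x"
    and mass: "(\<integral>\<^sup>+ x. ennreal (\<rho> x) \<partial>lborel) = 1"
    using mollifier_exists[OF \<delta>(1)] by metis
  let ?\<phi> = "conv v \<rho>"
  have \<phi>: "?\<phi> \<in> Cc_infinity \<Omega>"
    by (rule conv_test_function[OF v_int \<rho>(1) \<delta>(1,2) bdd c(2)])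
  have \<phi>_nn: "0 \<le> ?\<phi> x" for x
    by (rule conv_nonneg[OF v(2) \<rho>(2)])
  have [measurable]: "\<rho> \<in> borel_measurable borel"
    by (rule bump_measurable[OF \<rho>(1)])
  have \<phi>_le: "ennreal (?\<phi> x) \<le> 1" for x
  proof -
    have "ennreal (?\<phi> x) \<le> (\<integral>\<^sup>+ h. ennreal (\<rho> h) * 1 \<partial>lborel)"
      unfolding conv_eq_nn_integral[OF v_int v(2) \<rho>] using v(3)
      by (intro nn_integral_mono mult_left_mono) auto
    then show ?thesis by (simp add: mass)
  qed
  have "(\<integral>\<^sup>+ x. ennreal (g x) * ennreal (?\<phi> x) \<partial>lborel) \<le> (\<integral>\<^sup>+ x. ennreal (g x) * 1 \<partial>lborel)"
    by (intro nn_integral_mono mult_left_mono \<phi>_le) simp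
  then have fin: "(\<integral>\<^sup>+ x. ennreal (g x) * ennreal (?\<phi> x) \<partial>lborel) < \<infinity>"
    using weight_nn_integral_finite by (simp add: le_less_trans)
  have \<phi>_meas: "?\<phi> \<in> borel_measurable lebesgue"
    using test_function_in_W0s1[OF \<phi>] by (simp add: W0s1_def)
  have "(\<integral>\<^sup>+ x. ennreal (g x) * ennreal (v x) \<partial>lborel)
     \<le> (\<integral>\<^sup>+ x. ennreal (g x) * ennreal (?\<phi> x) \<partial>lborel) + ennreal e"
    by (rule conv_pairing[OF v_int v(2,3) \<rho> \<delta>(1) mass weight_measurable weight_nonneg \<delta>(3)])
  also have "(\<integral>\<^sup>+ x. ennreal (g x) * ennreal (?\<phi> x) \<partial>lborel) = ennreal (LINT x:\<Omega>|lebesgue. f x * ?\<phi> x)"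
    by (rule pairing_eq(1)[OF \<phi>_meas _ fin, symmetric]) (use \<phi>_nn in auto)
  also have "\<dots> + ennreal e \<le> gagliardo s UNIV ?\<phi> / 2 + ennreal e"
    by (intro add_right_mono test \<phi>)
  also have "\<dots> \<le> gagliardo s UNIV v / 2 + ennreal e"
    by (intro add_right_mono divide_right_mono_ennreal gagliardo_conv_le[OF v_int v(2) \<rho> mass])
  finally show "(\<integral>\<^sup>+ x. ennreal (g x) * ennreal (v x) \<partial>lborel) \<le> gagliardo s UNIV v / 2 + ennreal e" .
qed

text \<open>
  The inequality is known for the indicator times a cutoff. As \<open>k\<close> tends to infinity, the pairing
  converges by dominated convergence and the extra energy of the cutoff tends to zero.
\<close>

lemma test_inequality_imp_vol_le_Per:
  assumes test: "\<And>\<phi>. \<phi> \<in> Cc_infinity \<Omega> \<Longrightarrow>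
      ennreal (LINT x:\<Omega>|lebesgue. f x * \<phi> x) \<le> gagliardo s UNIV \<phi> / 2"
    and \<Omega>: "bounded \<Omega>" "lipschitz_boundary \<Omega>" and s: "0 < s" "s < 1"
    and F: "F \<in> sets lebesgue" "F \<subseteq> \<Omega>"
  shows "ennreal (weighted_vol f F) \<le> Per s F"
proof (cases "Per s F = \<infinity>")
  case False
  obtain F' where [measurable]: "F' \<in> sets borel" and sub: "F' \<subseteq> F" and ae: "AE x in lborel. x \<in> F \<longleftrightarrow> x \<in> F'"
    using borel_inner_representative[OF F(1)] .
  have gag_eq: "gagliardo s UNIV (indicator F) = gagliardo s UNIV (indicator F')"
    by (rule gagliardo_cong_AE) (use ae in eventually_elim, simp add: indicator_def)
  have fin: "gagliardo s UNIV (indicator F') < \<infinity>"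
    using False by (simp add: Per_def gag_eq[symmetric] ennreal_divide_eq_top_iff less_top)
  let ?\<eta> = "cutoff (- \<Omega>)"
  let ?v = "\<lambda>k x. indicator F' x * ?\<eta> k x"
  define e where "e k = (\<integral>\<^sup>+ p. ennreal (indicator F' (fst p) * indicator F' (snd p) *
      \<bar>?\<eta> k (fst p) - ?\<eta> k (snd p)\<bar> * kern s (fst p - snd p)) \<partial>lborel)" for k
  have sub': "F' \<subseteq> \<Omega>" using sub F(2) by blast
  note cut = cutoff_energy_tendsto[OF open_domain \<Omega> s _ sub' fin, folded e_def]
  have bound: "(\<integral>\<^sup>+ x. ennreal (g x) * ennreal (?v k x) \<partial>lborel) \<le> (gagliardo s UNIV (indicator F') + e k) / 2"
    if k: "1 \<le> k" for k
  proof -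
    have "(\<integral>\<^sup>+ x. ennreal (g x) * ennreal (?v k x) \<partial>lborel) \<le> gagliardo s UNIV (?v k) / 2"
    proof (rule test_inequality_interior_support[OF test \<Omega>(1)])
      show "0 < 1 / real k" using k by simp
      show "1 / real k \<le> infdist y (- \<Omega>)" if "?v k y \<noteq> 0" for y
      proof -
        have "1 \<le> real k * infdist y (- \<Omega>)"
          using that by (auto simp: cutoff_def max_def split: if_splits)
        then show ?thesis using k by (simp add: field_simps)
      qed
    qed (auto simp: indicator_def)
    also have "\<dots> \<le> (gagliardo s UNIV (indicator F') + e k) / 2"
      by (intro divide_right_mono_ennreal cut(2)) simp
    finally show ?thesis .
  qed
  obtain z where "z \<notin> \<Omega>"
    using \<Omega>(1) not_bounded_UNIV by (metis UNIV_eq_I)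
  then have ne: "- \<Omega> \<noteq> {}" and cl: "closed (- \<Omega>)"
    using open_domain by auto
  have lhs: "(\<lambda>k. \<integral>\<^sup>+ x. ennreal (g x) * ennreal (?v k x) \<partial>lborel) \<longlonglongrightarrow> (\<integral>\<^sup>+ x. ennreal (g x) * indicator F' x \<partial>lborel)"
  proof (rule nn_integral_dominated_convergence[where w = "\<lambda>x. ennreal (g x)"])
    show "AE x in lborel. (\<lambda>k. ennreal (g x) * ennreal (?v k x)) \<longlonglongrightarrow> ennreal (g x) * indicator F' x"
    proof (rule AE_I2)
      fix x
      show "(\<lambda>k. ennreal (g x) * ennreal (?v k x)) \<longlonglongrightarrow> ennreal (g x) * indicator F' x"
      proof (cases "x \<in> F'")
        case True
        then have "0 < infdist x (- \<Omega>)"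
          using sub' by (intro infdist_pos_not_in_closed cl ne) auto
        then have "(\<lambda>k. ennreal (g x * ?\<eta> k x)) \<longlonglongrightarrow> ennreal (g x * 1)"
          by (intro tendsto_ennrealI tendsto_mult tendsto_const cutoff_tendsto)
        then show ?thesis
          using True weight_nonneg[of x] by (simp add: ennreal_mult)
      qed simp
    qed
    show "AE x in lborel. ennreal (g x) * ennreal (?v k x) \<le> ennreal (g x)" for k
    proof (rule AE_I2)
      fix x
      have "ennreal (?v k x) \<le> 1"
        by (cases "x \<in> F'") auto
      then have "ennreal (g x) * ennreal (?v k x) \<le> ennreal (g x) * 1"
        by (intro mult_left_mono) auto
      then show "ennreal (g x) * ennreal (?v k x) \<le> ennreal (g x)" by simp
    qed
  qed (use weight_nn_integral_finite in auto)
  have rhs: "(\<lambda>k. (gagliardo s UNIV (indicator F') + e k) / 2) \<longlonglongrightarrow> (gagliardo s UNIV (indicator F') + 0) / 2"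
    unfolding divide_ennreal_def mult.commute[of _ "inverse 2"]
    by (intro ennreal_tendsto_cmult tendsto_add tendsto_const cut(1)) (simp_all add: less_top[symmetric])
  have "ennreal (weighted_vol f F) = (\<integral>\<^sup>+ x. ennreal (g x) * indicator F' x \<partial>lborel)"
    unfolding weighted_vol_eq(1)[OF F]
    by (rule nn_integral_cong_AE) (use ae in eventually_elim, simp add: indicator_def)
  also have "\<dots> \<le> (gagliardo s UNIV (indicator F') + 0) / 2"
    by (rule LIMSEQ_le[OF lhs rhs]) (use bound in blast)
  also have "\<dots> = Per s F"
    by (simp add: Per_def gag_eq)
  finally show ?thesis .
qed simp

text \<open>
  Approximate the level \<open>t\<close> from below by good levels \<open>r k\<close>. From below, the closed superlevel sets
  converge pointwise, the perimeter is lower semicontinuous and the weighted volume is continuous.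
\<close>

lemma level_inequality_AE_imp_all:
  fixes u :: "'a \<Rightarrow> real"
  assumes u: "u \<in> borel_measurable lebesgue" "\<And>x. x \<notin> \<Omega> \<Longrightarrow> u x = 0"
    and le: "AE t in lborel. 0 < t \<longrightarrow> Per s {x. t \<le> u x} \<le> ennreal (weighted_vol f {x. t \<le> u x})"
    and t: "0 < t"
  shows "Per s {x. t \<le> u x} \<le> ennreal (weighted_vol f {x. t \<le> u x})"
proof -
  obtain w where [measurable]: "w \<in> borel_measurable borel" and uw: "AE x in lborel. u x = w x"
    using borel_representative[OF u(1)] .
  have "\<exists>r. max 0 (t - 1 / real (Suc k)) < r \<and> r < t \<and> (0 < r \<longrightarrow> Per s {x. r \<le> u x} \<le> ennreal (weighted_vol f {x. r \<le> u x}))" for k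
    by (rule AE_lborel_exists_between[OF le]) (use t in auto)
  then obtain r where r: "\<And>k. max 0 (t - 1 / real (Suc k)) < r k" "\<And>k. r k < t"
    and r_le: "\<And>k. 0 < r k \<longrightarrow> Per s {x. r k \<le> u x} \<le> ennreal (weighted_vol f {x. r k \<le> u x})"
    by metis
  have r0: "0 < r k" for k using r(1)[of k] by simp
  have "(\<lambda>k. t - 1 / real (Suc k)) \<longlonglongrightarrow> t - 0"
    by (intro tendsto_diff tendsto_const LIMSEQ_inverse_real_of_nat[unfolded inverse_eq_divide])
  then have r_lim: "r \<longlonglongrightarrow> t"
    by (intro tendsto_sandwich[of "\<lambda>k. t - 1 / real (Suc k)" r _ "\<lambda>_. t"])
      (use r in \<open>auto intro!: always_eventually less_imp_le simp del: of_nat_Suc\<close>)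
  have levels: "(\<lambda>k. indicator {x. r k \<le> w x} x :: real) \<longlonglongrightarrow> indicator {x. t \<le> w x} x" for x
  proof (cases "t \<le> w x")
    case True
    then have "r k \<le> w x" for k using r(2)[of k] by simp
    then show ?thesis using True by simp
  next
    case False
    then have "\<forall>\<^sub>F k in sequentially. w x < r k"
      by (intro order_tendstoD(1)[OF r_lim]) simp
    then have "\<forall>\<^sub>F k in sequentially. (indicator {x. r k \<le> w x} x :: real) = indicator {x. t \<le> w x} x"
      by eventually_elim (use False in simp)
    then show ?thesis by (rule tendsto_eventually)
  qed
  have gag: "gagliardo s UNIV (indicator {x. a \<le> w x}) = 2 * Per s {x. a \<le> u x}" for a
  proof -
    have "gagliardo s UNIV (indicator {x. a \<le> w x}) = gagliardo s UNIV (indicator {x. a \<le> u x})"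
      by (intro gagliardo_cong_AE level_sets_AE AE_symmetric[OF uw])
    then show ?thesis
      by (simp add: Per_def ennreal_times_divide mult.commute[of 2] mult_divide_eq_ennreal)
  qed
  have vol: "ennreal (weighted_vol f {x. a \<le> u x}) = (\<integral>\<^sup>+ x. ennreal (g x) * ennreal (indicator {x. a \<le> w x} x) \<partial>lborel)"
    if "0 < a" for a
  proof -
    have "ennreal (weighted_vol f {x. a \<le> u x}) = (\<integral>\<^sup>+ x. ennreal (g x) * indicator {x. a \<le> u x} x \<partial>lborel)"
      by (rule weighted_vol_eq(1)[OF level_set_in_domain[OF u that]])
    also have "\<dots> = (\<integral>\<^sup>+ x. ennreal (g x) * ennreal (indicator {x. a \<le> w x} x) \<partial>lborel)"
      by (rule nn_integral_cong_AE) (use uw in eventually_elim, simp add: indicator_def)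
    finally show ?thesis .
  qed
  have "(\<lambda>k. \<integral>\<^sup>+ x. ennreal (g x) * ennreal (indicator {x. r k \<le> w x} x) \<partial>lborel)
     \<longlonglongrightarrow> (\<integral>\<^sup>+ x. ennreal (g x) * ennreal (indicator {x. t \<le> w x} x) \<partial>lborel)"
  proof (rule nn_integral_dominated_convergence[where w = "\<lambda>x. ennreal (g x)"])
    show "AE x in lborel. (\<lambda>k. ennreal (g x) * ennreal (indicator {x. r k \<le> w x} x))
        \<longlonglongrightarrow> ennreal (g x) * ennreal (indicator {x. t \<le> w x} x)"
    proof (rule AE_I2)
      fix x
      have "(\<lambda>k. ennreal (g x * indicator {x. r k \<le> w x} x)) \<longlonglongrightarrow> ennreal (g x * indicator {x. t \<le> w x} x)"
        by (intro tendsto_ennrealI tendsto_mult tendsto_const levels)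
      then show "(\<lambda>k. ennreal (g x) * ennreal (indicator {x. r k \<le> w x} x))
        \<longlonglongrightarrow> ennreal (g x) * ennreal (indicator {x. t \<le> w x} x)"
        using weight_nonneg[of x] by (simp add: ennreal_mult)
    qed
  qed (use weight_nn_integral_finite in \<open>auto simp: indicator_def\<close>)
  then have vol_lim: "(\<lambda>k. 2 * ennreal (weighted_vol f {x. r k \<le> u x})) \<longlonglongrightarrow> 2 * ennreal (weighted_vol f {x. t \<le> u x})"
    unfolding vol[OF r0] vol[OF t] by (intro ennreal_tendsto_cmult) auto
  have "2 * Per s {x. t \<le> u x} \<le> liminf (\<lambda>k. 2 * Per s {x. r k \<le> u x})"
    unfolding gag[symmetric] by (rule gagliardo_liminf) (use levels in auto)
  also have "\<dots> \<le> liminf (\<lambda>k. 2 * ennreal (weighted_vol f {x. r k \<le> u x}))"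
    using r_le r0 by (intro Liminf_mono always_eventually allI mult_left_mono) auto
  also have "\<dots> = 2 * ennreal (weighted_vol f {x. t \<le> u x})"
    by (rule lim_imp_Liminf[OF trivial_limit_sequentially vol_lim])
  finally have "2 * Per s {x. t \<le> u x} / 2 \<le> 2 * ennreal (weighted_vol f {x. t \<le> u x}) / 2"
    by (rule divide_right_mono_ennreal)
  then show ?thesis
    by (simp add: mult.commute[of 2] mult_divide_eq_ennreal)
qed

text \<open>
  Volume is at most perimeter on every level, while the integrals over all levels satisfy the opposite
  inequality. The finiteness needed to subtract the integrals is automatic: the volumes are
  bounded by the perimeters, and these by the real number \<open>\<integral> f u\<close>.
\<close>

lemma minimizer_levels_AE:
  assumes vol_le: "\<And>A. A \<in> sets lebesgue \<Longrightarrow> A \<subseteq> \<Omega> \<Longrightarrow> ennreal (weighted_vol f A) \<le> Per s A"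
    and u: "u \<in> borel_measurable lebesgue" "\<And>x. x \<notin> \<Omega> \<Longrightarrow> u x = 0" "AE x in lborel. 0 \<le> u x"
    and nonpos: "F_energy s \<Omega> f u \<le> 0"
  shows "AE t in lborel. 0 < t \<longrightarrow> Per s {x. t \<le> u x} \<le> ennreal (weighted_vol f {x. t \<le> u x})"
proof -
  let ?P = "\<lambda>t. Per s {x. t \<le> u x} * indicator {0<..} t"
  let ?V = "\<lambda>t. ennreal (weighted_vol f {x. t \<le> u x}) * indicator {0<..} t"
  have [measurable]: "?P \<in> borel_measurable borel" "?V \<in> borel_measurable borel"
    by (rule coarea_Per(2)[OF u(1,3)], rule pairing_layer_cake(2)[OF u])
  have VP: "?V t \<le> ?P t" for t
    using vol_le[OF level_set_in_domain[OF u(1,2), of t]] by (cases "0 < t") auto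
  have int_P: "(\<integral>\<^sup>+ t. ?P t \<partial>lborel) = gagliardo s UNIV u / 2"
    by (rule coarea_Per(1)[OF u(1,3), symmetric])
  have int_V: "(\<integral>\<^sup>+ t. ?V t \<partial>lborel) = (\<integral>\<^sup>+ x. ennreal (g x) * ennreal (u x) \<partial>lborel)"
    by (rule pairing_layer_cake(1)[OF u, symmetric])
  have upper: "gagliardo s UNIV u / 2 \<le> ennreal (LINT x:\<Omega>|lebesgue. f x * u x)"
    using nonpos unfolding F_energy_def by (rule energy_nonpos_imp)
  have "(\<integral>\<^sup>+ t. ?V t \<partial>lborel) \<le> (\<integral>\<^sup>+ t. ?P t \<partial>lborel)"
    by (intro nn_integral_mono VP)
  also have "\<dots> \<le> ennreal (LINT x:\<Omega>|lebesgue. f x * u x)"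
    using upper by (simp add: int_P)
  also have "\<dots> < \<infinity>" by simp
  finally have fin: "(\<integral>\<^sup>+ t. ?V t \<partial>lborel) < \<infinity>" .
  have "gagliardo s UNIV u / 2 \<le> (\<integral>\<^sup>+ x. ennreal (g x) * ennreal (u x) \<partial>lborel)"
  proof -
    note upper
    also have "ennreal (LINT x:\<Omega>|lebesgue. f x * u x) = (\<integral>\<^sup>+ x. ennreal (g x) * ennreal (u x) \<partial>lborel)"
      using fin unfolding int_V by (rule pairing_eq(1)[OF u(1,3)])
    finally show ?thesis .
  qed
  then have "(\<integral>\<^sup>+ t. ?P t \<partial>lborel) - (\<integral>\<^sup>+ t. ?V t \<partial>lborel) = 0"
    unfolding int_P int_V using le_less_trans[OF upper ennreal_less_top] by (simp add: diff_eq_0_iff_ennreal)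
  then have "(\<integral>\<^sup>+ t. ?P t - ?V t \<partial>lborel) = 0"
    using fin VP by (subst nn_integral_diff) auto
  then have "AE t in lborel. ?P t - ?V t = 0"
    by (subst (asm) nn_integral_0_iff_AE) auto
  then show ?thesis
  proof eventually_elim
    case (elim t)
    then show ?case
      by (auto simp: diff_eq_0_iff_ennreal)
  qed
qed

theorem minimizer_imp_minimizing_levels:
  assumes \<Omega>: "bounded \<Omega>" "lipschitz_boundary \<Omega>" and s: "0 < s" "s < 1"
    and weak: "weak_solution s \<Omega> f w"
    and u: "u \<in> W0s1 s \<Omega>" "AE x in lebesgue. 0 \<le> u x" "F_minimizer s \<Omega> f u"
    and t: "0 < t"
  shows "P_minimizer s \<Omega> f {x. t \<le> u x}"
proof -
  have u': "u \<in> borel_measurable lebesgue" "\<And>x. x \<notin> \<Omega> \<Longrightarrow> u x = 0" "AE x in lborel. 0 \<le> u x"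
    using u(1,2) by (auto simp: W0s1_def AE_completion_iff)
  have vol_le: "ennreal (weighted_vol f A) \<le> Per s A" if "A \<in> sets lebesgue" "A \<subseteq> \<Omega>" for A
    using weak_solution_pairing_le[OF weak] test_function_in_W0s1
    by (intro test_inequality_imp_vol_le_Per[OF _ \<Omega> s that]) blast
  have "F_energy s \<Omega> f u \<le> F_energy s \<Omega> f (\<lambda>x. 0)"
    using u(3) zero_in_W0s1 unfolding F_minimizer_def by blast
  then have "F_energy s \<Omega> f u \<le> 0"
    by (simp add: F_energy_zero)
  from level_inequality_AE_imp_all[OF u'(1,2) minimizer_levels_AE[OF vol_le u' this] t]
  have "P_energy s f {x. t \<le> u x} \<le> 0"
    using P_energy_nonpos_iff[OF level_set_in_domain[OF u'(1,2) t]] by simp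
  moreover have "0 \<le> P_energy s f A" if "A \<in> sets lebesgue" "A \<subseteq> \<Omega>" for A
    using vol_le[OF that] by (simp add: P_energy_def energy_nonneg_iff)
  ultimately show ?thesis
    unfolding P_minimizer_def using level_set_in_domain[OF u'(1,2) t] by (auto intro: order_trans)
qed

end

theorem proposition4p12:
  fixes \<Omega> :: "'a::euclidean_space set"
    and f :: "'a \<Rightarrow> real"
    and s \<sigma> :: real
  assumes s: "0 < s" "s < 1"
    and \<Omega>: "open \<Omega>" "bounded \<Omega>" "lipschitz_boundary \<Omega>"
    and \<sigma>: "0 < \<sigma>" "\<sigma> < s"
    and f_nonneg: "AE x in lebesgue. x \<in> \<Omega> \<longrightarrow> 0 \<le> f x"
    and f_measurable: "set_borel_measurable lebesgue \<Omega> f"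
    and f_Lp: "set_integrable lebesgue \<Omega> (\<lambda>x. \<bar>f x\<bar> powr (real DIM('a) / \<sigma>))"
    and f_ball: "\<exists>r\<^sub>o>0. \<exists>x\<^sub>o\<in>\<Omega>. ball x\<^sub>o r\<^sub>o \<subseteq> \<Omega> \<and> 0 < (LINT x:ball x\<^sub>o r\<^sub>o|lebesgue. f x)"
  shows "(1 \<le> cheeger s f \<Omega> \<longrightarrow>
           (\<forall>u\<in>W0s1 s \<Omega>.
              (AE x in lebesgue. 0 \<le> u x) \<longrightarrow>
              (AE t in lebesgue. 0 < t \<longrightarrow> P_minimizer s \<Omega> f {x. t \<le> u x}) \<longrightarrow>
              (AE x in lebesgue. 0 \<le> u x) \<and> F_minimizer s \<Omega> f u))
       \<and> ((\<exists>w. weak_solution s \<Omega> f w) \<longrightarrow>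
           (\<forall>u\<in>W0s1 s \<Omega>.
              (AE x in lebesgue. 0 \<le> u x) \<and> F_minimizer s \<Omega> f u \<longrightarrow>
              (\<forall>t>0. P_minimizer s \<Omega> f {x. t \<le> u x})))"
proof -
  have "\<sigma> < real DIM('a)"
    using s \<sigma> DIM_positive[where 'a='a] by (smt (verit) of_nat_1 of_nat_mono One_nat_def Suc_leI)
  then have p: "1 < real DIM('a) / \<sigma>"
    using \<sigma>(1) by (simp add: less_divide_eq)
  obtain g C where g: "weight_representative \<Omega> f g" and C: "0 \<le> C"
    "(\<integral>\<^sup>+ x. ennreal (g x powr (real DIM('a) / \<sigma>)) \<partial>lborel) \<le> ennreal C"
    using weight_representative_exists[OF \<Omega>(1,2) p f_nonneg f_measurable f_Lp] .
  interpret weight_representative \<Omega> f g by (rule g)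
  show ?thesis
    using minimizing_levels_imp_minimizer[OF \<sigma> s(2) C(2,1) \<Omega>(2)] minimizer_imp_minimizing_levels[OF \<Omega>(2,3) s]
    by blast
qed

end
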